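(* Consider Problem (P) with $f=0$ and $G=0$. The set of decentralized control laws $\{\hat u_1,\dots,\hat u_N\}$ given by $$\hat u_i(t)=-R^{-1}B^T[P\hat x_i(t)+(\Pi-P)\bar x(t)+s(t)],\quad t\ge 0,\ i=1,\dots,N,$$ is a representation of the set $\{\breve u_1,\dots,\breve u_N\}$ given by $$\breve u_i(t)=-R^{-1}B^T[Px_i(t)+\bar s(t)],\quad \bar s=\bar Kx^\dag+\phi,\quad i=1,\dots,N.$$
   Context: $\rho>0$; there are $N$ agents. $A,\Gamma,Q\in\mathbb{R}^{n\times n}$, $B\in\mathbb{R}^{n\times r}$, $R\in\mathbb{R}^{r\times r}$ are constant matrices, $Q,R$ symmetric ($Q$ may be indefinite), $R>0$. $\|z\|_S^2=z^TSz$. $C_{\rho/2}([0,\infty),\mathbb{R}^n)$ is the space of continuous $h:[0,\infty)\to\mathbb{R}^n$ with $\int_0^\infty e^{-\rho t}\|h(t)\|^2dt<\infty$; $\sigma,\eta$ belong to it. $W_1,\dots,W_N$ are independent one-dimensional Brownian motions. The initial states $x_i(0)$ are mutually independent with common mean $\bar x_0$ and $\max_i\mathbb{E}\|x_i(0)\|^2<C_0$, $C_0$ independent of $N$. Notation: $\Xi=\Gamma^TQ+Q\Gamma-\Gamma^TQ\Gamma$, $\bar\eta=Q\eta-\Gamma^TQ\eta$. Problem (P) with $f=0,G=0$: the dynamics are $dx_i=[Ax_i+Bu_i]dt+\sigma dW_i$, the cost of agent $i$ is $J_i(u)=\mathbb{E}\int_0^\infty e^{-\rho t}\{\|x_i-\Gamma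 x^{(N)}-\eta\|_Q^2+\|u_i\|_R^2\}dt$ with $x^{(N)}=\frac1N\sum_jx_j$, and one seeks decentralized control laws to optimize the social cost $\sum_iJ_i$, where $u_i$ is decentralized if $u_i(t)$ is adapted to $\sigma(x_i(\tau),0\le \tau\le t)$ and $\mathbb{E}\int_0^\infty e^{-\rho t}\|u_i(t)\|^2dt<\infty$. Definition (representation). For a control problem with admissible control set $\mathcal U$, a control law $u\in\mathcal U$ is said to be a representation of another control $u^*\in\mathcal U$ if (i) they both generate the same unique state trajectory, and (ii) they both have the same open-loop value on this trajectory. For the first set of laws: $\hat x_i$ is the state of agent $i$ under $\hat u_i$; $P,\Pi$ are the maximal solutions (a solution $P$ is maximal if $P-P'\ge 0$ for every solution $P'$) of $$\rho P=A^TP+PA-PBR^{-1}B^TP+Q,\qquad \rho\Pi=A^T\Pi+\Pi A-\Pi BR^{-1}B^T\Pi+Q-\Xi,$$ and $s,\bar x\in C_{\rho/2}([0,\infty),\mathbb{R}^n)$ are determined by $$\rho s=\dot s+(A-BR^{-1}B^T\Pi)^Ts-\bar\eta,\qquad \dot{\bar x}=A\bar x-BR^{-1}B^T(\Pi\bar x+s),\quad \bar x(0)=\bar x_0,$$ where $s(0)$ is to be determined. For the second set of laws: $x_i$ is the state of agent $i$ under $\breve u_i$; $P$ is the stabilizing solution of the first Riccati equation above (that is, all eigenvalues of $A-BR^{-1}B^TP-\frac\rho2I$ are in the open left half-plane); with $\bar A=A-BR^{-1}B^TP$, $\bar K$ satisfies $$\rho\bar K=\bar K\bar A+\bar A^T\bar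 K-\bar KBR^{-1}B^T\bar K^T-\Xi;$$ and $x^\dag,\phi\in C_{\rho/2}([0,\infty),\mathbb{R}^n)$ are given by $$\dot x^\dag=\bar Ax^\dag-BR^{-1}B^T(\bar Kx^\dag+\phi),\quad x^\dag(0)=\bar x_0,$$ $$\dot\phi=-[A-BR^{-1}B^T(P+\bar K)-\rho I]^T\phi+\bar\eta,$$ where $\phi(0)$ is to be determined by $\phi\in C_{\rho/2}([0,\infty),\mathbb{R}^n)$. *)

theory Defs
  imports "HOL-Probability.Probability"
begin

section \<open>Matrices and Riccati equations\<close>

definition pos_def :: "real^'n^'n \<Rightarrow> bool" where
  "pos_def M \<longleftrightarrow> transpose M = M \<and> (\<forall>z. z \<noteq> 0 \<longrightarrow> 0 < z \<bullet> (M *v z))"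

definition pos_semidef :: "real^'n^'n \<Rightarrow> bool" where
  "pos_semidef M \<longleftrightarrow> transpose M = M \<and> (\<forall>z. 0 \<le> z \<bullet> (M *v z))"

definition eigenvalue_of :: "real^'n^'n \<Rightarrow> complex \<Rightarrow> bool" where
  "eigenvalue_of M l \<longleftrightarrow>
     (\<exists>v :: complex^'n. v \<noteq> 0 \<and> (\<chi> i j. complex_of_real (M $ i $ j)) *v v = l *s v)"

definition hurwitz :: "real^'n^'n \<Rightarrow> bool" where
  "hurwitz M \<longleftrightarrow> (\<forall>l. eigenvalue_of M l \<longrightarrow> Re l < 0)"

text \<open>As usual for algebraic Riccati equations, solutions are real symmetric matrices.\<close>

definition riccati_solution ::
  "real \<Rightarrow> real^'n^'n \<Rightarrow> real^'r^'n \<Rightarrow> real^'r^'r \<Rightarrow> real^'n^'n \<Rightarrow> real^'n^'n \<Rightarrow> bool" where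
  "riccati_solution \<rho> A B R Q P \<longleftrightarrow> transpose P = P \<and>
     \<rho> *\<^sub>R P = transpose A ** P + P ** A - P ** B ** matrix_inv R ** transpose B ** P + Q"

definition maximal_riccati_solution ::
  "real \<Rightarrow> real^'n^'n \<Rightarrow> real^'r^'n \<Rightarrow> real^'r^'r \<Rightarrow> real^'n^'n \<Rightarrow> real^'n^'n \<Rightarrow> bool" where
  "maximal_riccati_solution \<rho> A B R Q P \<longleftrightarrow> riccati_solution \<rho> A B R Q P \<and>
     (\<forall>P'. riccati_solution \<rho> A B R Q P' \<longrightarrow> pos_semidef (P - P'))"

definition stabilizing_riccati_solution ::
  "real \<Rightarrow> real^'n^'n \<Rightarrow> real^'r^'n \<Rightarrow> real^'r^'r \<Rightarrow> real^'n^'n \<Rightarrow> real^'n^'n \<Rightarrow> bool" where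
  "stabilizing_riccati_solution \<rho> A B R Q P \<longleftrightarrow> riccati_solution \<rho> A B R Q P \<and>
     hurwitz (A - B ** matrix_inv R ** transpose B ** P - (\<rho> / 2) *\<^sub>R mat 1)"

definition Xi :: "real^'n^'n \<Rightarrow> real^'n^'n \<Rightarrow> real^'n^'n" where
  "Xi \<Gamma> Q = transpose \<Gamma> ** Q + Q ** \<Gamma> - transpose \<Gamma> ** Q ** \<Gamma>"

definition eta_bar :: "real^'n^'n \<Rightarrow> real^'n^'n \<Rightarrow> (real \<Rightarrow> real^'n) \<Rightarrow> real \<Rightarrow> real^'n" where
  "eta_bar \<Gamma> Q \<eta> t = Q *v \<eta> t - (transpose \<Gamma> ** Q) *v \<eta> t"

text \<open>The space \<open>C\<^bsub>c\<^esub>([0,\<infinity>), \<real>\<^sup>n)\<close> with weight \<open>exp (- 2 c t)\<close>; functions on the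
  half-line are total functions of which only the values on \<open>{0..}\<close> matter.\<close>

definition C_weighted :: "real \<Rightarrow> (real \<Rightarrow> real^'n) set" where
  "C_weighted c = {h. continuous_on {0..} h \<and>
     set_integrable lborel {0..} (\<lambda>t. exp (- (2 * c) * t) * (norm (h t))\<^sup>2)}"


section \<open>Brownian motion and the stochastic dynamics\<close>

definition brownian_motion :: "'w measure \<Rightarrow> (real \<Rightarrow> 'w \<Rightarrow> real) \<Rightarrow> bool" where
  "brownian_motion M W \<longleftrightarrow>
     (\<forall>t\<ge>0. W t \<in> borel_measurable M) \<and>
     (AE \<omega> in M. W 0 \<omega> = 0) \<and>
     (AE \<omega> in M. continuous_on {0..} (\<lambda>t. W t \<omega>)) \<and>
     (\<forall>s t. 0 \<le> s \<longrightarrow> s < t \<longrightarrow>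
        distributed M lborel (\<lambda>\<omega>. W t \<omega> - W s \<omega>) (normal_density 0 (sqrt (t - s)))) \<and>
     (\<forall>(m::nat) (t :: nat \<Rightarrow> real). 0 \<le> t 0 \<longrightarrow> mono t \<longrightarrow>
        prob_space.indep_vars M (\<lambda>_. borel) (\<lambda>k \<omega>. W (t (Suc k)) \<omega> - W (t k) \<omega>) {..<m})"

definition independent_processes ::
  "'w measure \<Rightarrow> (nat \<Rightarrow> real \<Rightarrow> 'w \<Rightarrow> real) \<Rightarrow> nat set \<Rightarrow> bool" where
  "independent_processes M W I \<longleftrightarrow>
     prob_space.indep_vars M (\<lambda>_. PiM {0..} (\<lambda>_. borel)) (\<lambda>i \<omega>. \<lambda>t\<in>{0..}. W i t \<omega>) I"

text \<open>\<open>Y\<close> is (a version of) \<open>\<integral>\<^sub>0\<^sup>t g dW\<close> for a deterministic continuous integrand \<open>g\<close>: for such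
  integrands the Ito integral is the mean-square limit of the left-point Riemann sums.\<close>

definition is_stochastic_integral ::
  "'w measure \<Rightarrow> (real \<Rightarrow> 'w \<Rightarrow> real) \<Rightarrow> (real \<Rightarrow> real^'n) \<Rightarrow> real \<Rightarrow> ('w \<Rightarrow> real^'n) \<Rightarrow> bool" where
  "is_stochastic_integral M W g t Y \<longleftrightarrow> Y \<in> borel_measurable M \<and>
     (\<lambda>m::nat. \<integral>\<^sup>+\<omega>. ennreal ((norm
        ((\<Sum>k<m. (W (real (Suc k) * t / real m) \<omega> - W (real k * t / real m) \<omega>) *\<^sub>R g (real k * t / real m))
         - Y \<omega>))\<^sup>2) \<partial>M) \<longlonglongrightarrow> 0"

text \<open>A control law assigns to agent, time and the paths of all agents a control value. It may a
  priori look at all paths and at the future; decentralization and non-anticipation are imposed in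
  \<open>admissible\<close> below. The open-loop value of a law on a trajectory is the control process obtained
  by evaluating the law along the trajectory.\<close>

type_synonym ('n, 'w) trajectory = "nat \<Rightarrow> real \<Rightarrow> 'w \<Rightarrow> real^'n"

type_synonym ('n, 'r) control_law = "nat \<Rightarrow> real \<Rightarrow> (nat \<Rightarrow> real \<Rightarrow> real^'n) \<Rightarrow> real^'r"

definition open_loop_value ::
  "('n::finite, 'r::finite) control_law \<Rightarrow> ('n, 'w) trajectory \<Rightarrow> nat \<Rightarrow> real \<Rightarrow> 'w \<Rightarrow> real^'r" where
  "open_loop_value u x i t \<omega> = u i t (\<lambda>j \<tau>. x j \<tau> \<omega>)"

text \<open>\<open>x\<close> is a continuous solution of \<open>dx\<^sub>i = (A x\<^sub>i + B u\<^sub>i) dt + \<sigma> dW\<^sub>i\<close>, with initial states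
  \<open>x0\<close>, under the law \<open>u\<close>.\<close>

definition generates ::
  "'w measure \<Rightarrow> nat \<Rightarrow> real^'n^'n \<Rightarrow> real^'r^'n \<Rightarrow> (real \<Rightarrow> real^'n) \<Rightarrow> (nat \<Rightarrow> real \<Rightarrow> 'w \<Rightarrow> real)
   \<Rightarrow> (nat \<Rightarrow> 'w \<Rightarrow> real^'n) \<Rightarrow> ('n, 'r) control_law \<Rightarrow> ('n, 'w) trajectory \<Rightarrow> bool" where
  "generates M N A B \<sigma> W x0 u x \<longleftrightarrow> (\<forall>i\<in>{1..N}.
     (\<forall>t\<ge>0. x i t \<in> borel_measurable M) \<and>
     (\<forall>\<omega>\<in>space M. continuous_on {0..} (\<lambda>t. x i t \<omega>)) \<and>
     (AE \<omega> in M. x i 0 \<omega> = x0 i \<omega>) \<and>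
     (\<forall>t\<ge>0. \<exists>Y. is_stochastic_integral M (W i) \<sigma> t Y \<and>
        (AE \<omega> in M.
           (\<lambda>\<tau>. A *v x i \<tau> \<omega> + B *v open_loop_value u x i \<tau> \<omega>) absolutely_integrable_on {0..t} \<and>
           x i t \<omega> = x i 0 \<omega>
             + integral {0..t} (\<lambda>\<tau>. A *v x i \<tau> \<omega> + B *v open_loop_value u x i \<tau> \<omega>) + Y \<omega>)))"

text \<open>The \<open>\<sigma>\<close>-algebra generated by \<open>z \<tau>\<close>, \<open>0 \<le> \<tau> \<le> t\<close> (without completion).\<close>

definition history :: "'w measure \<Rightarrow> (real \<Rightarrow> 'w \<Rightarrow> real^'n) \<Rightarrow> real \<Rightarrow> 'w measure" where
  "history M z t = sigma (space M) {z \<tau> -` S \<inter> space M | \<tau> S. \<tau> \<in> {0..t} \<and> S \<in> sets borel}"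

text \<open>The admissible set of the problem: laws whose control processes are decentralized, i.e.
  adapted to the history of the agent's own state, and of finite discounted energy. Joint
  measurability makes the latter meaningful.\<close>

definition admissible ::
  "'w measure \<Rightarrow> nat \<Rightarrow> real \<Rightarrow> real^'n^'n \<Rightarrow> real^'r^'n \<Rightarrow> (real \<Rightarrow> real^'n)
   \<Rightarrow> (nat \<Rightarrow> real \<Rightarrow> 'w \<Rightarrow> real) \<Rightarrow> (nat \<Rightarrow> 'w \<Rightarrow> real^'n) \<Rightarrow> ('n, 'r) control_law set" where
  "admissible M N \<rho> A B \<sigma> W x0 = {u.
     (\<exists>x. generates M N A B \<sigma> W x0 u x) \<and>
     (\<forall>x. generates M N A B \<sigma> W x0 u x \<longrightarrow> (\<forall>i\<in>{1..N}.
        (\<lambda>(t, \<omega>). open_loop_value u x i t \<omega>) \<in> borel_measurable (restrict_space borel {0..} \<Otimes>\<^sub>M M) \<and>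
        (\<forall>t\<ge>0. open_loop_value u x i t \<in> borel_measurable (history M (x i) t)) \<and>
        (\<integral>\<^sup>+\<omega>. (\<integral>\<^sup>+t\<in>{0..}. ennreal (exp (- \<rho> * t) * (norm (open_loop_value u x i t \<omega>))\<^sup>2) \<partial>lborel) \<partial>M) < \<infinity>))}"

definition indistinguishable ::
  "'w measure \<Rightarrow> nat \<Rightarrow> (nat \<Rightarrow> real \<Rightarrow> 'w \<Rightarrow> 'a) \<Rightarrow> (nat \<Rightarrow> real \<Rightarrow> 'w \<Rightarrow> 'a) \<Rightarrow> bool" where
  "indistinguishable M N x y \<longleftrightarrow> (\<forall>i\<in>{1..N}. AE \<omega> in M. \<forall>t\<ge>0. x i t \<omega> = y i t \<omega>)"

text \<open>Processes are identified when indistinguishable; uniqueness of the trajectory and equality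
  of the open-loop values are meant in this sense.\<close>

definition is_representation ::
  "'w measure \<Rightarrow> nat \<Rightarrow> real \<Rightarrow> real^'n^'n \<Rightarrow> real^'r^'n \<Rightarrow> (real \<Rightarrow> real^'n)
   \<Rightarrow> (nat \<Rightarrow> real \<Rightarrow> 'w \<Rightarrow> real) \<Rightarrow> (nat \<Rightarrow> 'w \<Rightarrow> real^'n)
   \<Rightarrow> ('n, 'r) control_law \<Rightarrow> ('n, 'r) control_law \<Rightarrow> bool" where
  "is_representation M N \<rho> A B \<sigma> W x0 u u' \<longleftrightarrow>
     u \<in> admissible M N \<rho> A B \<sigma> W x0 \<and> u' \<in> admissible M N \<rho> A B \<sigma> W x0 \<and>
     (\<exists>x. generates M N A B \<sigma> W x0 u x \<and> generates M N A B \<sigma> W x0 u' x \<and>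
        (\<forall>y. generates M N A B \<sigma> W x0 u y \<longrightarrow> indistinguishable M N y x) \<and>
        (\<forall>y. generates M N A B \<sigma> W x0 u' y \<longrightarrow> indistinguishable M N y x) \<and>
        indistinguishable M N (open_loop_value u x) (open_loop_value u' x))"

end

theory Submission
  imports Defs "HOL-Computational_Algebra.Fundamental_Theorem_Algebra"
begin

text \<open>
  Write \<open>S = B R\<^sup>-\<^sup>1 B\<^sup>T\<close>. The stabilizing solution \<open>Ps\<close> equals the maximal one: for \<open>E = P - Ps \<ge> 0\<close>
  and the Hurwitz matrix \<open>F = A - S Ps - \<rho>/2\<close> one has \<open>F\<^sup>T E + E F = E S E \<ge> 0\<close>, so \<open>E = 0\<close>. Likewise
  \<open>Z = Kbar - Kbar\<^sup>T\<close> satisfies \<open>F\<^sup>T Z + Z F = 0\<close>, so \<open>Kbar\<close> is symmetric and \<open>Ps + Kbar\<close> solves the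
  second Riccati equation. It need not equal \<open>Pm\<close>, but \<open>X = xbar - xdag\<close> and
  \<open>z = s - \<phi> + (Pm - Ps - Kbar) xdag\<close> solve the homogeneous Hamiltonian system with \<open>X(0) = 0\<close>. The
  integrable function \<open>exp (-\<rho> t) (X \<bullet> z)\<close> is then nonincreasing with initial value \<open>0\<close>, hence vanishes,
  which forces \<open>X = 0\<close> and \<open>R\<^sup>-\<^sup>1 B\<^sup>T z = 0\<close>. So the two laws coincide for \<open>t \<ge> 0\<close>.

  There remain existence and uniqueness of the trajectory and the admissibility of the laws. A continuous
  version of \<open>\<integral> \<sigma> dW\<close> is the sum of a series of step integrals controlled by Kolmogorov's maximal
  inequality, the state equation is then solved path by path, and a Lyapunov form for \<open>F\<close>, applied on
  unit time intervals, bounds the discounted energy.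
\<close>

section \<open>Lyapunov forms of Hurwitz matrices\<close>

text \<open>The choice of \<open>z\<close> comes from the costates. Both mean-field equations have
  the form x' = A x - S p, with costate p = \<open>Pm xbar + s\<close> for the first law and p =
  \<open>(Ps + Kbar) xdag + \<phi>\<close> for the second, and the difference of the costates is
  \<open>Pm X + z\<close>. Stability of A - S (Ps + Kbar) is not among the data, so the offsets can
  only be compared through the trajectories, with membership of all four functions in the weighted
  space in place of a stability argument. The probabilistic part is shaped by what a trajectory is:
  every path is continuous, measurability refers to \<open>M\<close> itself, and controls are
  adapted to the history without completion. The noise is additive with a deterministic integrand,
  so once a continuous version of the Wiener integral is fixed, the rest is deterministic for each
  \<omega>, and subtracting the noise from the state takes the place of Ito's formula. Of \<sigma>
  only the discounted energy is known to be finite, so second moments are followed from one integer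
  time to the next, where the noise is controlled by the energy of \<sigma> on that
  interval.\<close>

definition poly_op :: "complex poly \<Rightarrow> complex^'n^'n \<Rightarrow> complex^'n \<Rightarrow> complex^'n" where
  "poly_op p G v = fold_coeffs (\<lambda>a w. a *s v + G *v w) p 0"

lemma poly_op_0 [simp]: "poly_op 0 G v = 0"
  by (simp add: poly_op_def)

lemma poly_op_pCons [simp]: "poly_op (pCons a p) G v = a *s v + G *v poly_op p G v"
  by (cases "p = 0 \<and> a = 0") (auto simp: poly_op_def)

lemma poly_op_add: "poly_op (p + q) G v = poly_op p G v + poly_op q G v"
proof (induction p q rule: poly_induct2)
  case (pCons a p b q)
  then show ?case by (simp add: matrix_vector_right_distrib vector_sadd_rdistrib algebra_simps)
qed simp

lemma poly_op_smult: "poly_op (smult c p) G v = c *s poly_op p G v"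
  by (induction p) (simp_all add: vector_scalar_commute vector_add_ldistrib vector_smult_assoc)

text \<open>Polynomials in \<open>G\<close> commute, so a linear factor can act on the vector first,
  as here, or on the result, as in \<open>poly_op_linear_mult\<close>. The first order unfolds a
  product of linear factors from the head of a list, the second exhibits eigenvectors.\<close>

lemma poly_op_mult_linear:
  "poly_op ([:-l, 1:] * p) G v = poly_op p G (G *v v - l *s v)"
proof (induction p)
  case (pCons a p)
  have "[:-l, 1:] * pCons a p = smult a [:-l,1:] + pCons 0 ([:-l, 1:] * p)"
    by (simp add: mult_pCons_right)
  then show ?case using pCons
    by (simp add: poly_op_add poly_op_smult vector_scalar_commute matrix_vector_mult_diff_distrib
        matrix_vector_right_distrib vector_ssub_ldistrib vector_smult_assoc del: mult_pCons_left)
qed simp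

lemma poly_op_linear_mult:
  "poly_op ([:-l, 1:] * p) G v = G *v poly_op p G v - l *s poly_op p G v"
proof -
  have "[:-l, 1:] * p = smult (-l) p + pCons 0 p" by simp
  then show ?thesis unfolding \<open>[:-l, 1:] * p = _\<close> poly_op_add poly_op_smult by simp
qed

lemma poly_op_monom: "poly_op (monom c k) G v = c *s (((**) G ^^ k) (mat 1) *v v)"
  by (induction k) (simp_all add: monom_0 monom_Suc vector_scalar_commute flip: matrix_vector_mul_assoc)

lemma poly_op_sum: "poly_op (sum h I) G v = (\<Sum>i\<in>I. poly_op (h i) G v)"
  by (induction I rule: infinite_finite_induct) (simp_all add: poly_op_add)

text \<open>There are d + 1 powers of \<open>G\<close> with exponent up to \<open>d\<close>, the
  real dimension of the space of matrices, so they are linearly dependent already over the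
  reals.\<close>

lemma annihilating_poly:
  fixes G :: "complex^'n^'n"
  shows "\<exists>p. p \<noteq> 0 \<and> (\<forall>v. poly_op p G v = 0)"
proof -
  define mp where "mp k = ((**) G ^^ k) (mat 1)" for k
  define d where "d = DIM(complex^'n^'n)"
  have "\<exists>c :: nat \<Rightarrow> real. (\<exists>k\<le>d. c k \<noteq> 0) \<and> (\<Sum>k\<le>d. c k *\<^sub>R mp k) = 0"
  proof (cases "inj_on mp {..d}")
    case True
    have "dependent (mp ` {..d})"
      by (rule dependent_biggerset) (use card_image[OF True] in \<open>simp add: d_def\<close>)
    then obtain u where u: "\<exists>v\<in>mp ` {..d}. u v \<noteq> 0" "(\<Sum>v\<in>mp ` {..d}. u v *\<^sub>R v) = 0"
      by (auto simp: dependent_finite)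
    show ?thesis
      using u by (intro exI[of _ "u \<circ> mp"]) (auto simp: sum.reindex[OF True])
  next
    case False
    \<comment> \<open>Two equal powers form a dependence that the set of powers does not show,
      because it contains their common value once.\<close>
    then obtain i j where ij: "i \<le> d" "j \<le> d" "i \<noteq> j" "mp i = mp j" by (auto simp: inj_on_def)
    define c where "c k = (if k = i then 1 else if k = j then -1 else (0::real))" for k
    have "(\<Sum>k\<le>d. c k *\<^sub>R mp k) = (\<Sum>k\<in>{i,j}. c k *\<^sub>R mp k)"
      by (rule sum.mono_neutral_right) (use ij in \<open>auto simp: c_def\<close>)
    also have "\<dots> = 0" using ij by (simp add: c_def)
    finally show ?thesis using ij by (intro exI[of _ c]) (auto simp: c_def)
  qed
  then obtain c k where c: "k \<le> d" "c k \<noteq> 0" "(\<Sum>k\<le>d. c k *\<^sub>R mp k) = 0" by blast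
  define p where "p = (\<Sum>k\<le>d. monom (complex_of_real (c k)) k)"
  have "coeff p k = c k" using c(1) by (simp add: p_def coeff_sum)
  then have "p \<noteq> 0" using c(2) by auto
  moreover have "poly_op p G v = 0" for v
  proof -
    have "poly_op p G v = (\<Sum>k\<le>d. (c k *\<^sub>R mp k) *v v)"
      unfolding p_def poly_op_sum poly_op_monom mp_def[symmetric]
      by (intro sum.cong refl) (simp add: vec_eq_iff matrix_vector_mult_def sum_distrib_left scaleR_conv_of_real[where ?'a = complex] mult_ac)
    also have "\<dots> = (\<Sum>k\<le>d. c k *\<^sub>R mp k) *v v"
      by (induction d) (simp_all add: matrix_vector_mult_add_rdistrib)
    finally show ?thesis using c(3) by simp
  qed
  ultimately show ?thesis by blast
qed

text \<open>The product of the factors \<open>G - l\<close> applied to \<open>v\<close>, head of the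
  list first. If u is in the kernel for \<open>l # ls\<close>, then (G - l) u is in the kernel for
  \<open>ls\<close>, which suits an induction on the list. Multiple eigenvalues are repeated
  entries, so Jordan blocks are covered.\<close>

fun shift_op :: "complex list \<Rightarrow> complex^'n^'n \<Rightarrow> complex^'n \<Rightarrow> complex^'n" where
  "shift_op [] G v = v"
| "shift_op (l # ls) G v = shift_op ls G (G *v v - l *s v)"

lemma complex_poly_split:
  fixes p :: "complex poly"
  assumes "p \<noteq> 0"
  shows "\<exists>c ls. c \<noteq> 0 \<and> p = smult c (\<Prod>l\<leftarrow>ls. [:-l, 1:])"
proof -
  obtain ls where "mset ls = proots p" by (metis ex_mset)
  then have "p = smult (lead_coeff p) (\<Prod>l\<leftarrow>ls. [:-l, 1:])"
    using complex_poly_decompose_multiset[of p] by (metis mset_map prod_mset_prod_list)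
  then show ?thesis using assms by (metis leading_coeff_0_iff)
qed

lemma poly_op_prod_list: "poly_op (\<Prod>l\<leftarrow>ls. [:-l, 1:]) G v = shift_op ls G v"
  by (induction ls arbitrary: v) (simp_all add: poly_op_mult_linear one_pCons del: mult_pCons_left)

text \<open>Take an annihilating polynomial of least degree. If l is one of its roots, it is X - l
  times some q; by minimality q(G) v is nonzero for some v, and G - l kills this vector. So every
  root is an eigenvalue, and a spectral hypothesis speaks about the list.\<close>

lemma annihilating_shifts:
  fixes G :: "complex^'n^'n"
  shows "\<exists>ls. (\<forall>l\<in>set ls. \<exists>v. v \<noteq> 0 \<and> G *v v = l *s v) \<and> (\<forall>v. shift_op ls G v = 0)"
proof -
  define ann where "ann p \<longleftrightarrow> p \<noteq> 0 \<and> (\<forall>v. poly_op p G v = 0)" for p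
  obtain p where p: "ann p" and min: "\<And>q. ann q \<Longrightarrow> degree p \<le> degree q"
    using ex_has_least_nat[of ann _ degree] annihilating_poly[of G] unfolding ann_def by metis
  obtain c ls where c: "c \<noteq> 0" "p = smult c (\<Prod>l\<leftarrow>ls. [:-l, 1:])"
    using complex_poly_split p ann_def by blast
  have "shift_op ls G v = 0" for v
    using p c by (simp add: ann_def poly_op_smult poly_op_prod_list)
  moreover have "\<exists>v. v \<noteq> 0 \<and> G *v v = l *s v" if "l \<in> set ls" for l
  proof -
    have "[:-l, 1:] dvd (\<Prod>l\<leftarrow>ls. [:-l, 1:])"
      using that by (induction ls) (auto simp del: mult_pCons_left intro: dvd_mult)
    then obtain q where q: "p = [:-l, 1:] * q" using c by (metis dvd_smult dvdE)
    have "q \<noteq> 0" using p q by (auto simp: ann_def)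
    moreover have "degree p = 1 + degree q" unfolding q
      by (subst degree_mult_eq) (use \<open>q \<noteq> 0\<close> in auto)
    ultimately obtain v where "poly_op q G v \<noteq> 0" using min[of q] by (auto simp: ann_def)
    moreover have "G *v poly_op q G v = l *s poly_op q G v"
      using p poly_op_linear_mult[of l q G v] unfolding q[symmetric] by (simp add: ann_def)
    ultimately show ?thesis by blast
  qed
  ultimately show ?thesis by blast
qed

text \<open>On the kernel of \<open>(G - l\<^sub>1) \<cdots> (G - l\<^sub>k)\<close> the Lyapunov form is built up as
  \<open>\<beta>'(v, w) = v \<bullet> w + c \<beta>((G - l) v, (G - l) w)\<close> with \<open>c\<close> large.\<close>

lemma shift_op_lyapunov:
  fixes G :: "complex^'n^'n"
  assumes "\<forall>l\<in>set ls. Re l < 0"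
  shows "\<exists>\<beta> \<kappa>. \<kappa> > 0 \<and> bilinear \<beta> \<and> (\<forall>u w. \<beta> u w = \<beta> w u) \<and> (\<forall>u. \<beta> u u \<ge> (0::real)) \<and>
    (\<forall>u. shift_op ls G u = 0 \<longrightarrow> (norm u)\<^sup>2 \<le> \<beta> u u \<and> 2 * \<beta> u (G *v u) \<le> - \<kappa> * \<beta> u u)"
  using assms
proof (induction ls)
  case Nil
  show ?case
    by (intro exI[of _ "\<lambda>u w. 0"] exI[of _ 1]) (auto simp: bilinear_def intro: linear_zero)
next
  case (Cons l ls)
  then obtain \<beta> \<kappa> where \<kappa>: "\<kappa> > 0" and bil: "bilinear \<beta>" and sym: "\<And>u w. \<beta> u w = \<beta> w u"
    and nn: "\<And>u. \<beta> u u \<ge> 0"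
    and lo: "\<And>u. shift_op ls G u = 0 \<Longrightarrow> (norm u)\<^sup>2 \<le> \<beta> u u"
    and de: "\<And>u. shift_op ls G u = 0 \<Longrightarrow> 2 * \<beta> u (G *v u) \<le> - \<kappa> * \<beta> u u"
    by auto
  define a where "a = - Re l"
  have a: "a > 0" using Cons.prems by (simp add: a_def)
  \<comment> \<open>With this weight the decay c \<kappa> \<beta> t t of the second term equals 2
    \<beta> t t / a. One half pays for the cross term u \<bullet> t, the other half remains as decay
    at the rate \<kappa>/2.\<close>
  define c where "c = 2 / (a * \<kappa>)"
  have c: "c > 0" using a \<kappa> by (simp add: c_def)
  define T where "T v = G *v v - l *s v" for v
  have T: "linear T"
  proof (rule linearI)
    show "T (x + y) = T x + T y" for x y
      by (simp add: T_def matrix_vector_right_distrib vector_add_ldistrib)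
    show "T (r *\<^sub>R x) = r *\<^sub>R T x" for r x
      by (simp add: T_def vec_eq_iff matrix_vector_mult_def scaleR_sum_right scaleR_right_diff_distrib)
  qed
  define \<beta>' where "\<beta>' v w = v \<bullet> w + c * \<beta> (T v) (T w)" for v w
  have "bilinear \<beta>'"
    unfolding bilinear_def \<beta>'_def
    by (auto intro!: linearI simp: inner_add inner_scaleR algebra_simps linear_add[OF T] linear_scale[OF T]
        bilinear_ladd[OF bil] bilinear_radd[OF bil] bilinear_lmul[OF bil] bilinear_rmul[OF bil])
  moreover have "\<beta>' u w = \<beta>' w u" for u w
    unfolding \<beta>'_def using sym by (simp add: inner_commute)
  moreover have "\<beta>' u u \<ge> 0" for u unfolding \<beta>'_def using c nn by simp
  moreover have "(norm u)\<^sup>2 \<le> \<beta>' u u" for u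
    unfolding \<beta>'_def using c nn by (simp add: power2_norm_eq_inner)
  moreover have "2 * \<beta>' u (G *v u) \<le> - min a (\<kappa> / 2) * \<beta>' u u" if "shift_op (l # ls) G u = 0" for u
  proof -
    define t where "t = T u"
    have st: "shift_op ls G t = 0" using that by (simp add: t_def T_def)
    have Gu: "G *v u = l *s u + t" by (simp add: t_def T_def)
    have TG: "T (G *v u) = G *v t" by (simp add: t_def T_def matrix_vector_mult_diff_distrib vector_scalar_commute)
    \<comment> \<open>The inner product on complex vectors is the real one, so only the real part of
      \<open>l\<close> survives.\<close>
    have "u \<bullet> (l *s u) = - a * (norm u)\<^sup>2"
    proof -
      have "u \<bullet> (l *s u) = (\<Sum>i\<in>UNIV. Re l * (u$i \<bullet> u$i))"
        unfolding inner_vec_def by (intro sum.cong refl) (simp add: inner_complex_def algebra_simps)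
      also have "\<dots> = Re l * (u \<bullet> u)" by (simp add: inner_vec_def sum_distrib_left)
      finally show ?thesis by (simp add: a_def power2_norm_eq_inner)
    qed
    then have 1: "2 * (u \<bullet> (G *v u)) = - 2 * a * (norm u)\<^sup>2 + 2 * (u \<bullet> t)"
      by (simp add: Gu inner_add_right)
    \<comment> \<open>Young's inequality with weight \<open>a\<close>: half of the decay of the
      first term absorbs a |u|^2, and \<open>\<beta> t t\<close> dominates |t|^2.\<close>
    have "0 \<le> (norm (sqrt a *\<^sub>R u - (1 / sqrt a) *\<^sub>R t))\<^sup>2" by simp
    also have "\<dots> = a * (norm u)\<^sup>2 + (norm t)\<^sup>2 / a - 2 * (u \<bullet> t)"
      using a by (simp add: power2_norm_eq_inner inner_diff algebra_simps inner_commute field_simps power2_eq_square[symmetric])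
    finally have 2: "2 * (u \<bullet> t) \<le> a * (norm u)\<^sup>2 + (norm t)\<^sup>2 / a" by simp
    have 3: "(norm t)\<^sup>2 / a \<le> \<beta> t t / a" using lo[OF st] a by (simp add: divide_right_mono)
    have "c * (2 * \<beta> t (G *v t)) \<le> c * (- \<kappa> * \<beta> t t)"
      using de[OF st] c by (intro mult_left_mono) auto
    also have "\<dots> = - (\<beta> t t / a) - (\<kappa> / 2) * (c * \<beta> t t)"
      using a \<kappa> by (simp add: c_def field_simps)
    finally have 4: "c * (2 * \<beta> t (G *v t)) \<le> - (\<beta> t t / a) - (\<kappa> / 2) * (c * \<beta> t t)" .
    have "2 * \<beta>' u (G *v u) = 2 * (u \<bullet> (G *v u)) + c * (2 * \<beta> t (G *v t))"
      by (simp add: \<beta>'_def TG t_def)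
    also have "\<dots> \<le> - a * (norm u)\<^sup>2 - (\<kappa> / 2) * (c * \<beta> t t)" using 1 2 3 4 by linarith
    also have "\<dots> \<le> - min a (\<kappa>/2) * (norm u)\<^sup>2 - min a (\<kappa>/2) * (c * \<beta> t t)"
    proof -
      have "min a (\<kappa>/2) * (norm u)\<^sup>2 \<le> a * (norm u)\<^sup>2" by (intro mult_right_mono) auto
      moreover have "min a (\<kappa>/2) * (c * \<beta> t t) \<le> (\<kappa>/2) * (c * \<beta> t t)"
        using c nn by (intro mult_right_mono) auto
      ultimately show ?thesis by linarith
    qed
    also have "\<dots> = - min a (\<kappa>/2) * \<beta>' u u"
      by (simp add: \<beta>'_def t_def power2_norm_eq_inner algebra_simps)
    finally show ?thesis .
  qed
  ultimately show ?case using a \<kappa>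
    by (intro exI[of _ \<beta>'] exI[of _ "min a (\<kappa>/2)"]) auto
qed

section \<open>Lyapunov forms of real Hurwitz matrices and the comparison principle\<close>

definition lyapunov_form :: "('a::real_inner \<Rightarrow> 'a) \<Rightarrow> ('a \<Rightarrow> 'a \<Rightarrow> real) \<Rightarrow> real \<Rightarrow> bool" where
  "lyapunov_form f \<beta> \<kappa> \<longleftrightarrow> \<kappa> > 0 \<and> bilinear \<beta> \<and> (\<forall>u w. \<beta> u w = \<beta> w u) \<and>
    (\<forall>u. (norm u)\<^sup>2 \<le> \<beta> u u) \<and> (\<forall>u. 2 * \<beta> u (f u) \<le> - \<kappa> * \<beta> u u)"

text \<open>The form is built for the complexification \<open>G\<close>, where the eigenvalues live,
  and pulled back along the embedding \<open>cv\<close> of real vectors, which is real linear,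
  isometric and intertwines \<open>F\<close> with \<open>G\<close>.\<close>

lemma hurwitz_lyapunov:
  fixes F :: "real^'n^'n"
  assumes "hurwitz F"
  shows "\<exists>\<beta> \<kappa>. lyapunov_form ((*v) F) \<beta> \<kappa>"
proof -
  define G :: "complex^'n^'n" where "G = (\<chi> i j. complex_of_real (F $ i $ j))"
  obtain ls where ls: "\<forall>l\<in>set ls. \<exists>v. v \<noteq> 0 \<and> G *v v = l *s v" "\<And>v. shift_op ls G v = 0"
    using annihilating_shifts[of G] by blast
  have "\<forall>l\<in>set ls. Re l < 0"
    using ls(1) assms unfolding hurwitz_def eigenvalue_of_def G_def by blast
  from shift_op_lyapunov[OF this, of G] ls(2) obtain \<beta> \<kappa> where
    \<kappa>: "\<kappa> > 0" and bil: "bilinear \<beta>" and sym: "\<And>u w. \<beta> u w = \<beta> w u"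
    and lo: "\<And>u. (norm u)\<^sup>2 \<le> \<beta> u u" and de: "\<And>u. 2 * \<beta> u (G *v u) \<le> - \<kappa> * \<beta> u u"
    by auto
  define cv :: "real^'n \<Rightarrow> complex^'n" where "cv v = (\<chi> i. complex_of_real (v $ i))" for v
  have cv: "linear cv" by (rule linearI) (auto simp: cv_def vec_eq_iff scaleR_conv_of_real[where ?'a = complex])
  have cvF: "cv (F *v v) = G *v cv v" for v
    by (simp add: cv_def G_def vec_eq_iff matrix_vector_mult_def)
  have ncv: "norm (cv v) = norm v" for v
    by (simp add: cv_def norm_vec_def)
  have "lyapunov_form ((*v) F) (\<lambda>u w. \<beta> (cv u) (cv w)) \<kappa>"
    unfolding lyapunov_form_def
  proof (intro conjI allI)
    show "bilinear (\<lambda>u w. \<beta> (cv u) (cv w))"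
      unfolding bilinear_def
      by (auto intro!: linearI simp: linear_add[OF cv] linear_scale[OF cv]
        bilinear_ladd[OF bil] bilinear_radd[OF bil] bilinear_lmul[OF bil] bilinear_rmul[OF bil])
    show "2 * \<beta> (cv u) (cv (F *v u)) \<le> - \<kappa> * \<beta> (cv u) (cv u)" for u
      unfolding cvF by (rule de)
    show "(norm u)\<^sup>2 \<le> \<beta> (cv u) (cv u)" for u using lo[of "cv u"] by (simp add: ncv)
  qed (use \<kappa> sym in auto)
  then show ?thesis by blast
qed

text \<open>At a maximizer of \<open>b u u / \<beta> u u\<close> with positive value, moving along \<open>f\<close> would increase
  the quotient further.\<close>

lemma lyapunov_comparison:
  fixes f :: "'a::euclidean_space \<Rightarrow> 'a"
  assumes lf: "lyapunov_form f \<beta> \<kappa>" and b: "bilinear b"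
    and mon: "\<And>u. 0 \<le> b u (f u) + b (f u) u"
  shows "b u u \<le> (0::real)"
proof (rule ccontr)
  assume "\<not> b u u \<le> 0"
  then have pos: "b u u > 0" by simp
  have \<kappa>: "\<kappa> > 0" and bil: "bilinear \<beta>" and sym: "\<And>u w. \<beta> u w = \<beta> w u"
    and lo: "\<And>u. (norm u)\<^sup>2 \<le> \<beta> u u" and de: "\<And>u. 2 * \<beta> u (f u) \<le> - \<kappa> * \<beta> u u"
    using lf by (auto simp: lyapunov_form_def)
  have \<beta>pos: "\<beta> v v > 0" if "v \<noteq> 0" for v
    by (rule less_le_trans[OF _ lo]) (use that in simp)
  have u0: "u \<noteq> 0" using pos bilinear_lzero[OF b] by auto
  let ?r = "\<lambda>v. b v v / \<beta> v v"
  have "continuous_on (sphere 0 1) ?r"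
    by (intro continuous_on_divide bilinear_continuous_on_compose[OF _ _ b]
        bilinear_continuous_on_compose[OF _ _ bil] continuous_on_id)
      (use \<beta>pos in \<open>metis less_irrefl norm_zero mem_sphere_0 zero_neq_one\<close>)
  moreover have "sphere (0::'a) 1 \<noteq> {}" by simp
  ultimately obtain v where v: "v \<in> sphere 0 1" and max: "\<And>w. w \<in> sphere 0 1 \<Longrightarrow> ?r w \<le> ?r v"
    using continuous_attains_sup[OF compact_sphere, of 0 1 ?r] by blast
  define m where "m = ?r v"
  \<comment> \<open>Both forms are homogeneous of degree two, so the maximum over the sphere bounds
    the quotient everywhere.\<close>
  have le: "b w w \<le> m * \<beta> w w" for w
  proof (cases "w = 0")
    case False
    have "?r ((1 / norm w) *\<^sub>R w) \<le> m" unfolding m_def by (rule max) (use False in simp)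
    then have "?r w \<le> m" using False
      by (simp add: bilinear_lmul[OF b] bilinear_rmul[OF b] bilinear_lmul[OF bil] bilinear_rmul[OF bil])
    then show ?thesis using \<beta>pos[OF False] by (simp add: divide_le_eq)
  qed (simp add: bilinear_lzero[OF b] bilinear_lzero[OF bil])
  have v0: "v \<noteq> 0" using v by auto
  have eq: "b v v = m * \<beta> v v" using \<beta>pos[OF v0] by (simp add: m_def)
  have m: "m > 0"
    using le[of u] pos \<beta>pos[OF u0] by (smt (verit) mult_nonpos_nonneg)
  \<comment> \<open>\<open>d\<close> and \<open>e\<close> are the linear and the quadratic
    coefficient in \<open>t\<close> of the quadratic form b - m \<beta> at v + t f v. The constant
    term vanishes at the maximizer, and the whole is never positive.\<close>
  define d where "d = b v (f v) + b (f v) v - m * (2 * \<beta> v (f v))"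
  have "m * (2 * \<beta> v (f v)) \<le> m * (- \<kappa> * \<beta> v v)" using de m by (intro mult_left_mono) auto
  moreover have "m * (\<kappa> * \<beta> v v) > 0" using m \<kappa> \<beta>pos[OF v0] by simp
  ultimately have d: "d > 0" using mon[of v] unfolding d_def by simp
  define e where "e = b (f v) (f v) - m * \<beta> (f v) (f v)"
  have q: "t * d + t\<^sup>2 * e \<le> 0" for t
  proof -
    have "t * d + t\<^sup>2 * e = b (v + t *\<^sub>R f v) (v + t *\<^sub>R f v) - m * \<beta> (v + t *\<^sub>R f v) (v + t *\<^sub>R f v)"
      using sym[of v "f v"] eq unfolding d_def e_def
      by (simp add: bilinear_ladd[OF b] bilinear_radd[OF b] bilinear_lmul[OF b] bilinear_rmul[OF b]
        bilinear_ladd[OF bil] bilinear_radd[OF bil] bilinear_lmul[OF bil] bilinear_rmul[OF bil]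
        algebra_simps power2_eq_square)
    then show ?thesis using le by simp
  qed
  \<comment> \<open>Small enough for the linear term to beat the quadratic one.\<close>
  define t where "t = d / (2 * (\<bar>e\<bar> + 1))"
  have t: "t > 0" using d by (simp add: t_def)
  have "t * \<bar>e\<bar> < d"
    using d mult_nonneg_nonneg[of d "\<bar>e\<bar>"] unfolding t_def by (simp add: field_simps add_nonneg_pos)
  then have "t * (d - t * \<bar>e\<bar>) > 0" using t by simp
  moreover have "t\<^sup>2 * \<bar>e\<bar> \<ge> - (t\<^sup>2 * e)" by (metis abs_ge_minus_self abs_mult abs_power2)
  ultimately show False using q[of t] by (simp add: algebra_simps power2_eq_square)
qed

lemma bilinear_inner_matrix: "bilinear (\<lambda>u w. u \<bullet> ((E::real^'n^'n) *v w))"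
  unfolding bilinear_def
  by (auto intro!: linearI simp: inner_add matrix_vector_right_distrib inner_scaleR matrix_vector_mult_scaleR)

lemma inner_matrix_transpose: "u \<bullet> ((E::real^'n^'m) *v w) = (transpose E *v u) \<bullet> w"
  by (metis dot_lmul_matrix transpose_matrix_vector)

text \<open>Along u' = F u the form of \<open>E\<close> does not decrease while a Lyapunov form
  decays, so the comparison makes it nonpositive. Being semidefinite it then vanishes on the
  diagonal, and polarization with the symmetry of \<open>E\<close> gives the claim.\<close>

lemma lyapunov_semidef_eq_0:
  fixes E F :: "real^'n^'n"
  assumes F: "hurwitz F" and E: "pos_semidef E"
    and mon: "\<And>u. 0 \<le> u \<bullet> ((transpose F ** E + E ** F) *v u)"
  shows "E = 0"
proof -
  obtain \<beta> \<kappa> where lf: "lyapunov_form ((*v) F) \<beta> \<kappa>" using hurwitz_lyapunov[OF F] by blast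
  have sym: "transpose E = E" and nn: "\<And>u. 0 \<le> u \<bullet> (E *v u)" using E by (auto simp: pos_semidef_def)
  have "u \<bullet> (E *v u) \<le> 0" for u
  proof (rule lyapunov_comparison[OF lf bilinear_inner_matrix])
    fix u
    have "(F *v u) \<bullet> (E *v u) = u \<bullet> ((transpose F ** E) *v u)"
      by (metis inner_matrix_transpose transpose_transpose matrix_vector_mul_assoc)
    then show "0 \<le> u \<bullet> (E *v (F *v u)) + (F *v u) \<bullet> (E *v u)"
      using mon[of u] by (simp add: matrix_vector_mult_add_rdistrib inner_add_right matrix_vector_mul_assoc)
  qed
  then have z: "u \<bullet> (E *v u) = 0" for u using nn by (metis antisym)
  have "w \<bullet> (E *v u) = 0" for u w
  proof -
    have "w \<bullet> (E *v u) = u \<bullet> (E *v w)"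
      by (metis inner_commute inner_matrix_transpose sym)
    then show ?thesis using z[of "u + w"] z[of u] z[of w]
      by (simp add: matrix_vector_right_distrib inner_add)
  qed
  then have "E *v u = 0" for u by (metis inner_eq_zero_iff)
  then show ?thesis by (metis matrix_eq matrix_vector_mult_0)
qed

text \<open>A matrix that is not symmetric is not determined by its quadratic form. Doubling the
  state repairs this: on pairs, u \<bullet> Z w is a quadratic form with zero derivative along the
  doubled system, and at the pair (Z w, w) its value is the squared norm of Z w. This is why
  \<open>lyapunov_form\<close> takes a map on any inner product space and not a matrix.\<close>

lemma lyapunov_kernel:
  fixes Z F :: "real^'n^'n"
  assumes F: "hurwitz F" and Z: "transpose F ** Z + Z ** F = 0"
  shows "Z = 0"
proof -
  obtain \<beta> \<kappa> where lf: "lyapunov_form ((*v) F) \<beta> \<kappa>" using hurwitz_lyapunov[OF F] by blast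
  then have bil: "bilinear \<beta>" by (simp add: lyapunov_form_def)
  define \<beta>2 where "\<beta>2 u w = \<beta> (fst u) (fst w) + \<beta> (snd u) (snd w)" for u w
  define F2 where "F2 u = (F *v fst u, F *v snd u)" for u
  have lf2: "lyapunov_form F2 \<beta>2 \<kappa>"
    unfolding lyapunov_form_def
  proof (intro conjI allI)
    show "bilinear \<beta>2"
      unfolding bilinear_def \<beta>2_def
      by (auto intro!: linearI simp: algebra_simps
        bilinear_ladd[OF bil] bilinear_radd[OF bil] bilinear_lmul[OF bil] bilinear_rmul[OF bil])
    fix u :: "(real^'n) \<times> (real^'n)"
    show "(norm u)\<^sup>2 \<le> \<beta>2 u u"
      using lf by (cases u) (simp add: lyapunov_form_def \<beta>2_def norm_Pair add_mono)
    have 1: "\<And>u. 2 * \<beta> u (F *v u) \<le> - \<kappa> * \<beta> u u" using lf by (simp add: lyapunov_form_def)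
    show "2 * \<beta>2 u (F2 u) \<le> - \<kappa> * \<beta>2 u u"
      using 1[of "fst u"] 1[of "snd u"] by (simp add: \<beta>2_def F2_def algebra_simps)
  qed (use lf in \<open>auto simp: lyapunov_form_def \<beta>2_def\<close>)
  define b where "b u w = fst u \<bullet> (Z *v snd w)" for u w :: "(real^'n) \<times> (real^'n)"
  have bb: "bilinear b" unfolding b_def bilinear_def
    by (auto intro!: linearI simp: inner_add matrix_vector_right_distrib inner_scaleR matrix_vector_mult_scaleR)
  have "b u u \<le> 0" for u
  proof (rule lyapunov_comparison[OF lf2 bb])
    fix u
    have "b u (F2 u) + b (F2 u) u = fst u \<bullet> ((transpose F ** Z + Z ** F) *v snd u)"
      by (simp add: b_def F2_def matrix_vector_mult_add_rdistrib inner_add_right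
          inner_matrix_transpose[of _ "transpose F"] del: transpose_matrix_vector flip: matrix_vector_mul_assoc)
    then show "0 \<le> b u (F2 u) + b (F2 u) u" by (simp add: Z)
  qed
  from this[of "(Z *v w, w)" for w] have "Z *v w = 0" for w
    by (simp add: b_def) (metis inner_eq_zero_iff inner_ge_zero antisym)
  then show ?thesis by (metis matrix_eq matrix_vector_mult_0)
qed

section \<open>Riccati equations and the Hamiltonian system\<close>

lemma nonincreasing_if_derivative_nonpos:
  fixes f :: "real \<Rightarrow> real"
  assumes "a \<le> b"
    and der: "\<And>t. t \<in> {a..b} \<Longrightarrow> (f has_real_derivative f' t) (at t within {a..b})"
    and neg: "\<And>t. t \<in> {a<..<b} \<Longrightarrow> f' t \<le> 0"
  shows "f b \<le> f a"
proof (rule DERIV_nonpos_imp_decreasing_open[OF \<open>a \<le> b\<close>])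
  show "\<exists>y. (f has_real_derivative y) (at x) \<and> y \<le> 0" if "a < x" "x < b" for x
    using der[of x] neg[of x] that by (auto simp: at_within_Icc_at)
  show "continuous_on {a..b} f"
    using der by (intro DERIV_continuous_on) auto
qed

text \<open>Gronwall's argument: the weight with rate 2 K outweighs the growth of the squared norm,
  which therefore stays at its initial value 0.\<close>

lemma linear_ode_zero:
  fixes X :: "real \<Rightarrow> real^'n"
  assumes der: "\<And>t. t \<ge> 0 \<Longrightarrow> (X has_vector_derivative (M *v X t)) (at t within {0..})"
    and X0: "X 0 = 0" and t: "t \<ge> 0"
  shows "X t = 0"
proof -
  obtain K where K: "K > 0" "\<And>v. norm (M *v v) \<le> norm v * K"
    using bounded_linear.pos_bounded[OF matrix_vector_mul_bounded_linear[of M]] by blast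
  define h where "h t = exp (- 2 * K * t) * (X t \<bullet> X t)" for t
  have "h t \<le> h 0"
  proof (rule nonincreasing_if_derivative_nonpos[OF t])
    fix r assume r: "r \<in> {0..t}"
    have X': "(X has_vector_derivative (M *v X r)) (at r within {0..t})"
      using der[of r] r by (auto intro: has_vector_derivative_within_subset)
    have "((\<lambda>r. X r \<bullet> X r) has_real_derivative (X r \<bullet> (M *v X r) + (M *v X r) \<bullet> X r)) (at r within {0..t})"
      using bounded_bilinear.has_vector_derivative[OF bounded_bilinear_inner X' X']
      by (simp add: has_real_derivative_iff_has_vector_derivative)
    then show "(h has_real_derivative (exp (- 2 * K * r) * (2 * (X r \<bullet> (M *v X r)) - 2 * K * (X r \<bullet> X r))))
        (at r within {0..t})"
      unfolding h_def by (auto intro!: derivative_eq_intros simp: algebra_simps inner_commute)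
  next
    fix r
    have "X r \<bullet> (M *v X r) \<le> norm (X r) * (norm (X r) * K)"
      by (meson K(2) mult_left_mono norm_cauchy_schwarz norm_ge_zero order_trans)
    then show "exp (- 2 * K * r) * (2 * (X r \<bullet> (M *v X r)) - 2 * K * (X r \<bullet> X r)) \<le> 0"
      by (simp add: mult_le_0_iff power2_norm_eq_inner[symmetric] power2_eq_square algebra_simps)
  qed
  then have "X t \<bullet> X t \<le> 0" by (simp add: h_def X0 mult_le_0_iff)
  then show ?thesis by (metis antisym inner_eq_zero_iff inner_ge_zero)
qed

section \<open>The weighted space and the homogeneous Hamiltonian system\<close>

lemma C_weightedD:
  assumes "h \<in> C_weighted c"
  shows "continuous_on {0..} h" "set_integrable lborel {0..} (\<lambda>t. exp (- (2 * c) * t) * (norm (h t))\<^sup>2)"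
  using assms by (auto simp: C_weighted_def)

lemma set_integrable_continuous_bound:
  fixes f :: "real \<Rightarrow> real"
  assumes "continuous_on {0..} f" and "set_integrable lborel {0..} g"
    and "\<And>t. t \<ge> 0 \<Longrightarrow> \<bar>f t\<bar> \<le> g t"
  shows "set_integrable lborel {0..} f"
proof (rule set_integrable_bound[OF assms(2)])
  show "set_borel_measurable lborel {0..} f"
    using borel_measurable_continuous_on_indicator[OF _ assms(1)] by (simp add: set_borel_measurable_def)
qed (use assms(3) in force)

lemma C_weighted_comb:
  fixes f g :: "real \<Rightarrow> real^'n" and U V :: "real^'n^'m"
  assumes f: "f \<in> C_weighted c" and g: "g \<in> C_weighted c"
  shows "(\<lambda>t. U *v f t + V *v g t) \<in> C_weighted c"
proof -
  let ?w = "\<lambda>t. exp (- (2 * c) * t)"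
  obtain K where K: "K > 0" "\<And>v. norm (U *v v) \<le> norm v * K"
    using bounded_linear.pos_bounded[OF matrix_vector_mul_bounded_linear[of U]] by blast
  obtain L where L: "L > 0" "\<And>v. norm (V *v v) \<le> norm v * L"
    using bounded_linear.pos_bounded[OF matrix_vector_mul_bounded_linear[of V]] by blast
  have cont: "continuous_on {0..} (\<lambda>t. U *v f t + V *v g t)"
    by (intro continuous_on_add bounded_linear.continuous_on[OF matrix_vector_mul_bounded_linear]
        C_weightedD(1)[OF f] C_weightedD(1)[OF g])
  have "set_integrable lborel {0..} (\<lambda>t. ?w t * (norm (U *v f t + V *v g t))\<^sup>2)"
  proof (rule set_integrable_continuous_bound)
    show "continuous_on {0..} (\<lambda>t. ?w t * (norm (U *v f t + V *v g t))\<^sup>2)"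
      by (intro continuous_intros cont)
    show "set_integrable lborel {0..} (\<lambda>t. (2 * K\<^sup>2) * (?w t * (norm (f t))\<^sup>2) + (2 * L\<^sup>2) * (?w t * (norm (g t))\<^sup>2))"
      by (intro set_integral_add(1) set_integrable_mult_right C_weightedD(2)[OF f] C_weightedD(2)[OF g])
    fix t
    have "(norm (U *v f t + V *v g t))\<^sup>2 \<le> (norm (f t) * K + norm (g t) * L)\<^sup>2"
      by (intro power_mono norm_triangle_le add_mono K L) auto
    also have "\<dots> \<le> 2 * K\<^sup>2 * (norm (f t))\<^sup>2 + 2 * L\<^sup>2 * (norm (g t))\<^sup>2"
      using sum_squares_bound[of "norm (f t) * K" "norm (g t) * L"]
      by (simp add: power2_sum power_mult_distrib algebra_simps)
    finally have "?w t * (norm (U *v f t + V *v g t))\<^sup>2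
        \<le> ?w t * (2 * K\<^sup>2 * (norm (f t))\<^sup>2 + 2 * L\<^sup>2 * (norm (g t))\<^sup>2)"
      by (rule mult_left_mono) simp
    then show "\<bar>?w t * (norm (U *v f t + V *v g t))\<^sup>2\<bar>
        \<le> (2 * K\<^sup>2) * (?w t * (norm (f t))\<^sup>2) + (2 * L\<^sup>2) * (?w t * (norm (g t))\<^sup>2)"
      by (simp add: distrib_left mult.left_commute abs_mult)
  qed
  then show ?thesis using cont by (simp add: C_weighted_def)
qed

text \<open>\<open>exp (-\<rho> t) (X \<bullet> z)\<close> is nonincreasing, starts at \<open>0\<close> and is integrable, hence vanishes; its
  derivative is \<open>- exp (-\<rho> t) (z \<bullet> S z)\<close>.\<close>

lemma hamiltonian_homogeneous:
  fixes X z :: "real \<Rightarrow> real^'n" and M S :: "real^'n^'n"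
  assumes X: "X \<in> C_weighted (\<rho> / 2)" and z: "z \<in> C_weighted (\<rho> / 2)" and X0: "X 0 = 0"
    and X': "\<And>t. t \<ge> 0 \<Longrightarrow> (X has_vector_derivative (M *v X t - S *v z t)) (at t within {0..})"
    and z': "\<And>t. t \<ge> 0 \<Longrightarrow> (z has_vector_derivative (\<rho> *\<^sub>R z t - transpose M *v z t)) (at t within {0..})"
    and S: "\<And>v. 0 \<le> v \<bullet> (S *v v)" and S0: "\<And>v. v \<bullet> (S *v v) = 0 \<Longrightarrow> S *v v = 0"
    and t: "t \<ge> 0"
  shows "X t = 0" "z t \<bullet> (S *v z t) = 0"
proof -
  define g where "g t = exp (- \<rho> * t) * (X t \<bullet> z t)" for t
  define g' where "g' t = - exp (- \<rho> * t) * (z t \<bullet> (S *v z t))" for t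
  have g': "(g has_real_derivative g' t) (at t within {0..})" if "t \<ge> 0" for t
  proof -
    \<comment> \<open>The terms with \<open>M\<close> cancel, which leaves the discount and the
      quadratic form of \<open>S\<close>.\<close>
    have "X t \<bullet> (transpose M *v z t) = (M *v X t) \<bullet> z t"
      by (metis dot_lmul_matrix inner_commute transpose_matrix_vector)
    then have "((\<lambda>t. X t \<bullet> z t) has_real_derivative (\<rho> * (X t \<bullet> z t) - z t \<bullet> (S *v z t))) (at t within {0..})"
      using bounded_bilinear.has_vector_derivative[OF bounded_bilinear_inner X'[OF that] z'[OF that]]
      by (simp add: has_real_derivative_iff_has_vector_derivative inner_diff inner_commute
        del: transpose_matrix_vector)
    then show ?thesis unfolding g_def g'_def
      by (auto intro!: derivative_eq_intros simp: algebra_simps)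
  qed
  have mono: "g b \<le> g a" if "0 \<le> a" "a \<le> b" for a b
    using that g' by (intro nonincreasing_if_derivative_nonpos[of a b g g'] DERIV_subset[OF g'])
      (auto simp: g'_def S)
  have cg: "continuous_on {0..} g"
    using g' by (intro DERIV_continuous_on) auto
  have int: "set_integrable lborel {0..} g"
  proof (rule set_integrable_continuous_bound[OF cg])
    show "set_integrable lborel {0..} (\<lambda>t. exp (- (2 * (\<rho> / 2)) * t) * (norm (X t))\<^sup>2
      + exp (- (2 * (\<rho> / 2)) * t) * (norm (z t))\<^sup>2)"
      by (intro set_integral_add(1) C_weightedD[OF X] C_weightedD[OF z])
    fix t
    have "\<bar>X t \<bullet> z t\<bar> \<le> norm (X t) * norm (z t)" by (rule Cauchy_Schwarz_ineq2)
    also have "\<dots> \<le> (norm (X t))\<^sup>2 + (norm (z t))\<^sup>2"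
      using sum_squares_bound[of "norm (X t)" "norm (z t)"] mult_nonneg_nonneg[OF norm_ge_zero[of "X t"] norm_ge_zero[of "z t"]]
      by linarith
    finally show "\<bar>g t\<bar> \<le> exp (- (2 * (\<rho> / 2)) * t) * (norm (X t))\<^sup>2
      + exp (- (2 * (\<rho> / 2)) * t) * (norm (z t))\<^sup>2"
      unfolding g_def by (simp add: abs_mult flip: distrib_left)
  qed
  have g0: "g t = 0" if t: "t \<ge> 0" for t
  proof (rule ccontr)
    assume "g t \<noteq> 0"
    moreover have "g t \<le> 0" using mono[of 0 t] t by (simp add: g_def X0)
    ultimately have neg: "g t < 0" by simp
    \<comment> \<open>A negative value at \<open>t\<close> would persist, since \<open>g\<close>
      stays below it from then on; a nonzero constant would then be integrable over a
      half-line.\<close>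
    have "set_integrable lborel {t..} (\<lambda>_. g t)"
    proof (rule set_integrable_bound)
      show "set_integrable lborel {t..} g" by (rule set_integrable_subset[OF int]) (use t in auto)
      show "AE x in lborel. x \<in> {t..} \<longrightarrow> norm (g t) \<le> norm (g x)"
        using mono[OF t] neg by force
    qed (simp add: set_borel_measurable_def)
    then have "integrable lborel (\<lambda>x. indicator {t..} x * g t)" by (simp add: set_integrable_def)
    then have "integrable lborel (indicator {t..} :: real \<Rightarrow> real)" using neg by simp
    then have fin: "emeasure lborel {t..} < \<infinity>" by (simp add: integrable_indicator_iff)
    then obtain r where r: "emeasure lborel {t..} = ennreal r" "r \<ge> 0"
      by (cases "emeasure lborel {t..}") auto
    have "emeasure lborel {t..t + (r + 1)} \<le> emeasure lborel {t..}" by (intro emeasure_mono) auto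
    then show False using r by simp
  qed
  \<comment> \<open>The derivative is taken from the right, which also covers time 0.\<close>
  have "g' t = 0" if "t \<ge> 0" for t
  proof (rule vector_derivative_unique_within)
    show "(g has_vector_derivative g' t) (at t within {t..})"
      using g'[OF that] that
      by (auto simp: has_real_derivative_iff_has_vector_derivative intro: has_vector_derivative_within_subset)
    show "(g has_vector_derivative 0) (at t within {t..})"
      by (rule has_vector_derivative_transform[of t "{t..}" g "\<lambda>_. 0"]) (use that g0 in auto)
    show "at t within {t..} \<noteq> bot"
      by (simp add: at_within_Ici_at_right)
  qed
  then have zS: "z t \<bullet> (S *v z t) = 0" if "t \<ge> 0" for t using that by (simp add: g'_def)
  then show "z t \<bullet> (S *v z t) = 0" using t .
  show "X t = 0"
  proof (rule linear_ode_zero[where X = X and M = M])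
    show "(X has_vector_derivative M *v X t) (at t within {0..})" if "t \<ge> 0" for t
      using X'[OF that] S0[OF zS[OF that]] by simp
  qed (use X0 t in auto)
qed


section \<open>Matrix algebra and the two Riccati equations\<close>

lemma matrix_ring_distribs:
  fixes A B :: "real^'n^'m" and C D :: "real^'k^'n"
  shows "(A + B) ** C = A ** C + B ** C" "(A - B) ** C = A ** C - B ** C"
    "A ** (C + D) = A ** C + A ** D" "A ** (C - D) = A ** C - A ** D"
    "(r *\<^sub>R A) ** C = r *\<^sub>R (A ** C)" "A ** (r *\<^sub>R C) = r *\<^sub>R (A ** C)"
  by (simp_all add: matrix_matrix_mult_def vec_eq_iff sum.distrib sum_subtractf sum_distrib_left
      distrib_left distrib_right left_diff_distrib right_diff_distrib mult.assoc mult.left_commute)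

lemma transpose_diff: "transpose (A - B) = transpose A - transpose (B :: real^'n^'m)"
  by (simp add: transpose_def vec_eq_iff)

lemma transpose_add: "transpose (A + B) = transpose A + transpose (B :: real^'n^'m)"
  by (simp add: transpose_def vec_eq_iff)

lemma pos_def_invertible:
  assumes "pos_def R"
  shows "invertible R"
proof -
  have "x = 0" if "R *v x = 0" for x using assms that by (auto simp: pos_def_def)
  then show ?thesis by (simp add: invertible_left_inverse matrix_left_invertible_ker)
qed

lemma pos_def_matrix_inv:
  assumes R: "pos_def R"
  shows "pos_def (matrix_inv R)"
proof -
  have inv: "R ** matrix_inv R = mat 1" "matrix_inv R ** R = mat 1"
    using someI_ex[OF pos_def_invertible[OF R, unfolded invertible_def]] by (auto simp: matrix_inv_def)
  have sym: "transpose (matrix_inv R) = matrix_inv R"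
  proof -
    have "transpose (matrix_inv R) ** R = mat 1"
      using inv(1) R by (metis matrix_transpose_mul pos_def_def transpose_mat)
    then show ?thesis by (metis inv(1) matrix_mul_assoc matrix_mul_lid matrix_mul_rid)
  qed
  moreover have "0 < z \<bullet> (matrix_inv R *v z)" if "z \<noteq> 0" for z
  proof -
    define w where "w = matrix_inv R *v z"
    have z: "z = R *v w" by (simp add: w_def matrix_vector_mul_assoc inv)
    then have "w \<noteq> 0" using that by auto
    then have "0 < w \<bullet> (R *v w)" using R by (simp add: pos_def_def)
    then show ?thesis unfolding z[symmetric] w_def[symmetric] by (simp add: inner_commute)
  qed
  ultimately show ?thesis by (simp add: pos_def_def)
qed

text \<open>Positive definiteness of the inverse of \<open>R\<close> turns v \<bullet> S v = 0 into
  the vanishing of \<open>transpose B *v v\<close>. The last conclusion is stated for the feedback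
  gain, since this is how a costate acts on the control.\<close>

lemma quadratic_weight:
  fixes B :: "real^'r^'n"
  assumes R: "pos_def R"
  defines "S \<equiv> B ** matrix_inv R ** transpose B"
  shows "transpose S = S" "0 \<le> v \<bullet> (S *v v)"
    "v \<bullet> (S *v v) = 0 \<Longrightarrow> (matrix_inv R ** transpose B) *v v = 0"
proof -
  have Ri: "pos_def (matrix_inv R)" by (rule pos_def_matrix_inv[OF R])
  show "transpose S = S"
    using Ri by (simp add: S_def matrix_transpose_mul pos_def_def matrix_mul_assoc)
  have eq: "v \<bullet> (S *v v) = (transpose B *v v) \<bullet> (matrix_inv R *v (transpose B *v v))"
    unfolding S_def by (metis inner_matrix_transpose matrix_vector_mul_assoc)
  show "0 \<le> v \<bullet> (S *v v)"
    unfolding eq using Ri by (cases "transpose B *v v = 0") (auto simp: pos_def_def less_imp_le simp del: transpose_matrix_vector)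
  assume "v \<bullet> (S *v v) = 0"
  then have "transpose B *v v = 0" using Ri unfolding eq pos_def_def by (metis less_irrefl)
  then show "(matrix_inv R ** transpose B) *v v = 0"
    by (metis matrix_vector_mul_assoc matrix_vector_mult_0_right)
qed

lemmas matrix_ring_simps = matrix_ring_distribs
  matrix_mul_assoc transpose_add transpose_diff matrix_transpose_mul

lemma maximal_eq_stabilizing:
  fixes B :: "real^'r^'n"
  assumes R: "pos_def R" and P: "maximal_riccati_solution \<rho> A B R Q P"
    and Ps: "stabilizing_riccati_solution \<rho> A B R Q Ps"
  shows "P = Ps"
proof -
  define S where "S = B ** matrix_inv R ** transpose B"
  note S = quadratic_weight[OF R, where B = B, folded S_def]
  define E where "E = P - Ps"
  define F where "F = A - S ** Ps - (\<rho> / 2) *\<^sub>R mat 1"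
  have ric: "transpose X = X \<and> \<rho> *\<^sub>R X = transpose A ** X + X ** A - X ** S ** X + Q"
    if "riccati_solution \<rho> A B R Q X" for X
    using that by (simp add: riccati_solution_def S_def matrix_mul_assoc)
  have rP: "transpose P = P" "\<rho> *\<^sub>R P = transpose A ** P + P ** A - P ** S ** P + Q"
    and rPs: "transpose Ps = Ps" "\<rho> *\<^sub>R Ps = transpose A ** Ps + Ps ** A - Ps ** S ** Ps + Q"
    using P Ps ric by (auto simp: maximal_riccati_solution_def stabilizing_riccati_solution_def)
  have E: "pos_semidef E"
    using P Ps by (auto simp: E_def maximal_riccati_solution_def stabilizing_riccati_solution_def)
  have F: "hurwitz F"
    using Ps by (simp add: F_def S_def stabilizing_riccati_solution_def)
  \<comment> \<open>Subtracting the two Riccati equations removes \<open>Q\<close>, the shift by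
    \<rho>/2 in \<open>F\<close> accounts for the discount term, and the quadratic terms combine to
    a square in \<open>E\<close>.\<close>
  have FE: "transpose F ** E + E ** F = E ** S ** E"
  proof -
    have "transpose F ** E + E ** F = transpose A ** E + E ** A - Ps ** S ** E - E ** S ** Ps - \<rho> *\<^sub>R E"
      by (simp add: F_def matrix_ring_simps S(1) rPs(1) transpose_scalar transpose_mat algebra_simps flip: scaleR_add_left)
    also have "\<rho> *\<^sub>R E = transpose A ** E + E ** A - P ** S ** P + Ps ** S ** Ps"
      unfolding E_def scaleR_diff_right rP(2) rPs(2) by (simp add: matrix_ring_simps)
    finally show ?thesis by (simp add: E_def matrix_ring_simps)
  qed
  have "E = 0"
  proof (rule lyapunov_semidef_eq_0[OF F E])
    fix u
    have "u \<bullet> ((E ** S ** E) *v u) = (E *v u) \<bullet> (S *v (E *v u))"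
      using E by (metis inner_matrix_transpose matrix_vector_mul_assoc pos_semidef_def)
    then show "0 \<le> u \<bullet> ((transpose F ** E + E ** F) *v u)" using S(2) by (simp add: FE)
  qed
  then show ?thesis by (simp add: E_def)
qed

text \<open>The term K S K^T and \<open>Xi \<Gamma> Q\<close> are symmetric whatever
  \<open>K\<close> is. Subtracting the transposed equation therefore leaves a linear Lyapunov
  equation for K - K^T, whose matrix is Hurwitz because \<open>Ps\<close> is stabilizing.\<close>

lemma riccati_K_symmetric:
  fixes B :: "real^'r^'n"
  assumes R: "pos_def R" and Q: "transpose Q = Q"
    and Ps: "stabilizing_riccati_solution \<rho> A B R Q Ps"
    and Abar: "Abar = A - B ** matrix_inv R ** transpose B ** Ps"
    and K: "\<rho> *\<^sub>R K = K ** Abar + transpose Abar ** K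
      - K ** B ** matrix_inv R ** transpose B ** transpose K - Xi \<Gamma> Q"
  shows "transpose K = K"
proof -
  define S where "S = B ** matrix_inv R ** transpose B"
  note S = quadratic_weight[OF R, where B = B, folded S_def]
  define Z where "Z = K - transpose K"
  define F where "F = Abar - (\<rho> / 2) *\<^sub>R mat 1"
  have F: "hurwitz F" using Ps by (simp add: F_def Abar stabilizing_riccati_solution_def)
  have Xi: "transpose (Xi \<Gamma> Q) = Xi \<Gamma> Q"
    by (simp add: Xi_def matrix_ring_simps Q)
  have K1: "\<rho> *\<^sub>R K = K ** Abar + transpose Abar ** K - K ** S ** transpose K - Xi \<Gamma> Q"
    using K by (simp add: S_def matrix_mul_assoc)
  have K2: "\<rho> *\<^sub>R transpose K = transpose Abar ** transpose K + transpose K ** Abar - K ** S ** transpose K - Xi \<Gamma> Q"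
    using arg_cong[OF K1, of transpose] S(1) Xi by (simp add: matrix_ring_simps transpose_scalar)
  have "transpose F ** Z + Z ** F = transpose Abar ** Z + Z ** Abar - \<rho> *\<^sub>R Z"
    by (simp add: F_def matrix_ring_simps transpose_scalar transpose_mat algebra_simps flip: scaleR_add_left)
  also have "\<dots> = 0"
    unfolding Z_def scaleR_diff_right K1 K2 by (simp add: matrix_ring_simps)
  finally have "Z = 0" by (rule lyapunov_kernel[OF F])
  then show ?thesis by (simp add: Z_def)
qed

lemma feedback_offsets_equal:
  fixes B :: "real^'r^'n" and s xbar xdag \<phi> :: "real \<Rightarrow> real^'n"
  assumes R: "pos_def R" and Q: "transpose Q = Q"
    and Pm: "riccati_solution \<rho> A B R (Q - Xi \<Gamma> Q) Pm"
    and s: "s \<in> C_weighted (\<rho> / 2)"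
    and s': "\<And>t. t \<ge> 0 \<Longrightarrow> (s has_vector_derivative
        (\<rho> *\<^sub>R s t - transpose (A - B ** matrix_inv R ** transpose B ** Pm) *v s t + eta_bar \<Gamma> Q \<eta> t))
      (at t within {0..})"
    and xbar: "xbar \<in> C_weighted (\<rho> / 2)"
    and xbar': "\<And>t. t \<ge> 0 \<Longrightarrow> (xbar has_vector_derivative
        (A *v xbar t - (B ** matrix_inv R ** transpose B) *v (Pm *v xbar t + s t))) (at t within {0..})"
    and Ps: "stabilizing_riccati_solution \<rho> A B R Q Ps"
    and Abar: "Abar = A - B ** matrix_inv R ** transpose B ** Ps"
    and K: "\<rho> *\<^sub>R K = K ** Abar + transpose Abar ** K
      - K ** B ** matrix_inv R ** transpose B ** transpose K - Xi \<Gamma> Q"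
    and xdag: "xdag \<in> C_weighted (\<rho> / 2)"
    and xdag': "\<And>t. t \<ge> 0 \<Longrightarrow> (xdag has_vector_derivative
        (Abar *v xdag t - (B ** matrix_inv R ** transpose B) *v (K *v xdag t + \<phi> t))) (at t within {0..})"
    and phi: "\<phi> \<in> C_weighted (\<rho> / 2)"
    and phi': "\<And>t. t \<ge> 0 \<Longrightarrow> (\<phi> has_vector_derivative
        (- (transpose (A - B ** matrix_inv R ** transpose B ** (Ps + K) - \<rho> *\<^sub>R mat 1) *v \<phi> t)
          + eta_bar \<Gamma> Q \<eta> t)) (at t within {0..})"
    and init: "xbar 0 = xdag 0" and t: "t \<ge> 0"
  shows "(matrix_inv R ** transpose B) *v ((Pm - Ps) *v xbar t + s t)
    = (matrix_inv R ** transpose B) *v (K *v xdag t + \<phi> t)"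
proof -
  define S where "S = B ** matrix_inv R ** transpose B"
  note S = quadratic_weight[OF R, where B = B, folded S_def]
  have Kt: "transpose K = K" by (rule riccati_K_symmetric[OF R Q Ps Abar K])
  define L where "L = Ps + K"
  define D where "D = Pm - L"
  define M where "M = A - S ** Pm"
  have rPs: "transpose Ps = Ps" "\<rho> *\<^sub>R Ps = transpose A ** Ps + Ps ** A - Ps ** S ** Ps + Q"
    using Ps by (auto simp: stabilizing_riccati_solution_def riccati_solution_def S_def matrix_mul_assoc)
  have rPm: "transpose Pm = Pm" "\<rho> *\<^sub>R Pm = transpose A ** Pm + Pm ** A - Pm ** S ** Pm + Q - Xi \<Gamma> Q"
    using Pm by (auto simp: riccati_solution_def S_def matrix_mul_assoc)
  have Lt: "transpose L = L" by (simp add: L_def transpose_add rPs Kt)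
  have K1: "\<rho> *\<^sub>R K = K ** Abar + transpose Abar ** K - K ** S ** K - Xi \<Gamma> Q"
    using K by (simp add: S_def matrix_mul_assoc Kt)
  have A1: "Abar = A - S ** Ps" by (simp add: Abar S_def)
  have rL: "\<rho> *\<^sub>R L = transpose A ** L + L ** A - L ** S ** L + Q - Xi \<Gamma> Q"
    unfolding L_def scaleR_add_right rPs(2) K1 by (simp add: A1 matrix_ring_simps rPs(1) S(1))
  \<comment> \<open>The difference of two Riccati equations factors with one closed loop on either
    side. It converts the motion of D xdag along the loop of \<open>L\<close> into the adjoint
    equation of the loop of \<open>Pm\<close>.\<close>
  have DM: "D ** (A - S ** L) = \<rho> *\<^sub>R D - transpose M ** D"
    unfolding D_def scaleR_diff_right rPm(2) rL by (simp add: M_def matrix_ring_simps rPm(1) S(1))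
  define X where "X t = xbar t - xdag t" for t
  define z where "z t = s t - \<phi> t + D *v xdag t" for t
  have neg: "- mat 1 *v v = - v" for v :: "real^'n"
    using matrix_vector_mult_diff_rdistrib[of 0 "mat 1" v] by simp
  have Xw: "X \<in> C_weighted (\<rho> / 2)"
    using C_weighted_comb[OF xbar xdag, of "mat 1" "- mat 1"] by (simp add: X_def[abs_def] neg)
  have zw: "z \<in> C_weighted (\<rho> / 2)"
    using C_weighted_comb[OF C_weighted_comb[OF s phi, of "mat 1" "- mat 1"] xdag, of "mat 1" D]
    by (simp add: z_def[abs_def] neg)
  have X': "(X has_vector_derivative (M *v X t - S *v z t)) (at t within {0..})" if "t \<ge> 0" for t
  proof -
    have "A *v xbar t - S *v (Pm *v xbar t + s t) - (Abar *v xdag t - S *v (K *v xdag t + \<phi> t))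
        = M *v X t - S *v z t"
      by (simp add: A1 M_def X_def z_def D_def L_def matrix_vector_mult_diff_distrib matrix_vector_right_distrib
          matrix_vector_mult_diff_rdistrib matrix_vector_mult_add_rdistrib flip: matrix_vector_mul_assoc)
    then show ?thesis
      using has_vector_derivative_diff[OF xbar'[OF that] xdag'[OF that]]
      by (simp add: X_def[abs_def] S_def)
  qed
  have z': "(z has_vector_derivative (\<rho> *\<^sub>R z t - transpose M *v z t)) (at t within {0..})" if "t \<ge> 0" for t
  proof -
    \<comment> \<open>Passing from the closed loop of \<open>L\<close> to that of \<open>Pm\<close>
      costs exactly D S, which cancels against the term that \<phi> contributes to the derivative of
      D xdag.\<close>
    have 1: "transpose (A - S ** L - \<rho> *\<^sub>R mat 1) = transpose M + D ** S - \<rho> *\<^sub>R mat 1"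
      by (simp add: M_def D_def matrix_ring_simps transpose_scalar transpose_mat S(1) rPm(1) Lt)
    have 2: "Abar *v xdag t - S *v (K *v xdag t + \<phi> t) = (A - S ** L) *v xdag t - S *v \<phi> t"
      by (simp add: A1 L_def matrix_vector_right_distrib matrix_vector_mult_diff_rdistrib matrix_ring_distribs
        matrix_vector_mult_add_rdistrib flip: matrix_vector_mul_assoc)
    have 3: "D *v ((A - S ** L) *v xdag t) = \<rho> *\<^sub>R (D *v xdag t) - transpose M *v (D *v xdag t)"
      unfolding matrix_vector_mul_assoc DM
      by (simp only: matrix_vector_mult_diff_rdistrib scaleR_matrix_vector_assoc[symmetric] matrix_vector_mul_assoc)
    have s1: "(s has_vector_derivative (\<rho> *\<^sub>R s t - transpose M *v s t + eta_bar \<Gamma> Q \<eta> t)) (at t within {0..})"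
      using s'[OF that] by (simp add: M_def S_def)
    have p1: "(\<phi> has_vector_derivative (- ((transpose M + D ** S - \<rho> *\<^sub>R mat 1) *v \<phi> t) + eta_bar \<Gamma> Q \<eta> t)) (at t within {0..})"
      using phi'[OF that] unfolding 1[symmetric] by (simp add: L_def S_def)
    have x1: "(xdag has_vector_derivative ((A - S ** L) *v xdag t - S *v \<phi> t)) (at t within {0..})"
      using xdag'[OF that] unfolding S_def[symmetric] 2 .
    have "(z has_vector_derivative (\<rho> *\<^sub>R s t - transpose M *v s t + eta_bar \<Gamma> Q \<eta> t
        - (- ((transpose M + D ** S - \<rho> *\<^sub>R mat 1) *v \<phi> t) + eta_bar \<Gamma> Q \<eta> t)
        + D *v ((A - S ** L) *v xdag t - S *v \<phi> t))) (at t within {0..})"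
      unfolding z_def[abs_def]
      by (intro has_vector_derivative_add has_vector_derivative_diff s1 p1
        bounded_linear.has_vector_derivative[OF matrix_vector_mul_bounded_linear x1])
    moreover have "\<rho> *\<^sub>R s t - transpose M *v s t + eta_bar \<Gamma> Q \<eta> t
        - (- ((transpose M + D ** S - \<rho> *\<^sub>R mat 1) *v \<phi> t) + eta_bar \<Gamma> Q \<eta> t)
        + D *v ((A - S ** L) *v xdag t - S *v \<phi> t) = \<rho> *\<^sub>R z t - transpose M *v z t"
      unfolding matrix_vector_mult_diff_distrib[of D] 3 z_def
      by (simp add: matrix_vector_mult_diff_distrib matrix_vector_right_distrib matrix_vector_mult_diff_rdistrib
          matrix_vector_mult_add_rdistrib scaleR_matrix_vector_assoc[symmetric] scaleR_right_distrib
          scaleR_right_diff_distrib del: transpose_matrix_vector flip: matrix_vector_mul_assoc)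
    ultimately show ?thesis by simp
  qed
  have S0: "S *v v = 0" if "v \<bullet> (S *v v) = 0" for v
  proof -
    have "S *v v = B *v ((matrix_inv R ** transpose B) *v v)"
      by (simp add: S_def matrix_vector_mul_assoc matrix_mul_assoc)
    then show ?thesis by (simp only: S(3)[OF that] matrix_vector_mult_0_right)
  qed
  note H = hamiltonian_homogeneous[OF Xw zw _ X' z' S(2) S0 t]
  have "X t = 0" by (rule H(1)) (auto simp: X_def init)
  then have x: "xbar t = xdag t" by (simp add: X_def)
  have "(matrix_inv R ** transpose B) *v z t = 0"
    by (rule S(3), rule H(2)) (auto simp: X_def init)
  \<comment> \<open>Once the states agree, the two offsets differ exactly by \<open>z\<close>, which
    the gain annihilates.\<close>
  moreover have "((Pm - Ps) *v xbar t + s t) = (K *v xdag t + \<phi> t) + z t"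
    by (simp add: x z_def D_def L_def matrix_vector_mult_diff_rdistrib matrix_vector_mult_add_rdistrib)
  ultimately show ?thesis by (simp only: matrix_vector_right_distrib[of _ _ "z t"] add_0_right)
qed

section \<open>Elementary stochastic integrals\<close>

locale brownian = prob_space M for M :: "'w measure" +
  fixes W :: "real \<Rightarrow> 'w \<Rightarrow> real"
  assumes bm: "brownian_motion M W"
begin

lemma W_measurable: "0 \<le> t \<Longrightarrow> W t \<in> borel_measurable M"
  using bm by (auto simp: brownian_motion_def)

lemma increment_measurable: "0 \<le> s \<Longrightarrow> 0 \<le> t \<Longrightarrow> (\<lambda>\<omega>. W t \<omega> - W s \<omega>) \<in> borel_measurable M"
  by (intro borel_measurable_diff W_measurable)

lemma increment_moments:
  assumes "0 \<le> s" "s \<le> t"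
  shows "integrable M (\<lambda>\<omega>. W t \<omega> - W s \<omega>)" "expectation (\<lambda>\<omega>. W t \<omega> - W s \<omega>) = 0"
    "integrable M (\<lambda>\<omega>. (W t \<omega> - W s \<omega>)\<^sup>2)" "expectation (\<lambda>\<omega>. (W t \<omega> - W s \<omega>)\<^sup>2) = t - s"
proof -
  have "integrable M (\<lambda>\<omega>. W t \<omega> - W s \<omega>) \<and> expectation (\<lambda>\<omega>. W t \<omega> - W s \<omega>) = 0 \<and>
    integrable M (\<lambda>\<omega>. (W t \<omega> - W s \<omega>)\<^sup>2) \<and> expectation (\<lambda>\<omega>. (W t \<omega> - W s \<omega>)\<^sup>2) = t - s"
  proof (cases "s = t")
    case False
    then have st: "s < t" using assms by simp
    have D: "distributed M lborel (\<lambda>\<omega>. W t \<omega> - W s \<omega>) (normal_density 0 (sqrt (t - s)))"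
      using bm st assms by (auto simp: brownian_motion_def)
    have p: "0 < sqrt (t - s)" using st by simp
    have "integrable M (\<lambda>\<omega>. (W t \<omega> - W s \<omega>) ^ k)" for k
      using distributed_integrable[OF D, of "\<lambda>x. x ^ k"] integrable_normal_moment[OF p, of 0 k] by simp
    from this[of 1] this[of 2] show ?thesis
      using normal_distributed_expectation[OF p D] normal_distributed_variance[OF p D] st by simp
  qed simp
  then show "integrable M (\<lambda>\<omega>. W t \<omega> - W s \<omega>)" "expectation (\<lambda>\<omega>. W t \<omega> - W s \<omega>) = 0"
    "integrable M (\<lambda>\<omega>. (W t \<omega> - W s \<omega>)\<^sup>2)" "expectation (\<lambda>\<omega>. (W t \<omega> - W s \<omega>)\<^sup>2) = t - s"
    by auto
qed

text \<open>The first \<open>k\<close> increments and the increment \<open>j\<close> are disjoint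
  blocks of an independent family, so the expectation of the product splits and the mean 0 of
  \<open>D j\<close> makes it vanish. A general function \<open>f\<close> of the past is allowed
  because it will carry the stopping indicator of the maximal inequality.\<close>

lemma past_increment_orthogonal:
  fixes \<tau> :: "nat \<Rightarrow> real"
  defines "D \<equiv> \<lambda>k \<omega>. W (\<tau> (Suc k)) \<omega> - W (\<tau> k) \<omega>"
  assumes \<tau>: "0 \<le> \<tau> 0" "mono \<tau>" and kj: "k \<le> j"
    and f: "f \<in> borel_measurable (PiM {..<k} (\<lambda>_. borel))"
    and int: "integrable M (\<lambda>\<omega>. f (\<lambda>i\<in>{..<k}. D i \<omega>) :: real)"
  shows "integrable M (\<lambda>\<omega>. f (\<lambda>i\<in>{..<k}. D i \<omega>) * D j \<omega>)"
    "expectation (\<lambda>\<omega>. f (\<lambda>i\<in>{..<k}. D i \<omega>) * D j \<omega>) = 0"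
proof -
  have "indep_vars (\<lambda>_. borel) D {..<Suc j}"
    using bm \<tau> by (auto simp: brownian_motion_def D_def)
  from indep_var_restrict[OF this, of "{..<k}" "{j}"]
  have "indep_var (PiM {..<k} (\<lambda>_. borel)) (\<lambda>\<omega>. \<lambda>i\<in>{..<k}. D i \<omega>) (PiM {j} (\<lambda>_. borel)) (\<lambda>\<omega>. \<lambda>i\<in>{j}. D i \<omega>)"
    using kj by auto
  from indep_var_compose[OF this f, of "\<lambda>g. g j" borel]
  have ind: "indep_var borel (\<lambda>\<omega>. f (\<lambda>i\<in>{..<k}. D i \<omega>)) borel (D j)"
    by (simp add: comp_def)
  have "0 \<le> \<tau> j" using \<tau> by (metis le0 monoD order_trans)
  then have m: "integrable M (D j)" "expectation (D j) = 0"
    using increment_moments[of "\<tau> j" "\<tau> (Suc j)"] \<tau> by (auto simp: D_def monoD)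
  show "integrable M (\<lambda>\<omega>. f (\<lambda>i\<in>{..<k}. D i \<omega>) * D j \<omega>)"
    by (rule indep_var_integrable[OF ind int m(1)])
  show "expectation (\<lambda>\<omega>. f (\<lambda>i\<in>{..<k}. D i \<omega>) * D j \<omega>) = 0"
    using indep_var_lebesgue_integral[OF ind int m(1)] m(2) by simp
qed

text \<open>\<open>W 0\<close> vanishes only almost surely, so it is subtracted throughout rather
  than replaced by 0.\<close>

lemma W_covariance:
  assumes "0 \<le> s" "0 \<le> t"
  shows "integrable M (\<lambda>\<omega>. (W s \<omega> - W 0 \<omega>) * (W t \<omega> - W 0 \<omega>))"
    "expectation (\<lambda>\<omega>. (W s \<omega> - W 0 \<omega>) * (W t \<omega> - W 0 \<omega>)) = min s t"
proof -
  have *: "integrable M (\<lambda>\<omega>. (W s \<omega> - W 0 \<omega>) * (W t \<omega> - W 0 \<omega>)) \<and>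
    expectation (\<lambda>\<omega>. (W s \<omega> - W 0 \<omega>) * (W t \<omega> - W 0 \<omega>)) = s" if "0 \<le> s" "s \<le> t" for s t
  proof -
    \<comment> \<open>The times 0, s, t, t, and so on: the first two increments are those over [0,s]
      and [s,t].\<close>
    define \<tau> where "\<tau> i = (if i = 0 then 0 else if i = Suc 0 then s else t)" for i :: nat
    have \<tau>: "0 \<le> \<tau> 0" "mono \<tau>" using that by (auto simp: \<tau>_def intro!: monoI)
    have f: "(\<lambda>g. g 0) \<in> borel_measurable (PiM {..<Suc 0} (\<lambda>_. borel :: real measure))"
      by (rule measurable_component_singleton) simp
    have 1: "integrable M (\<lambda>\<omega>. (W s \<omega> - W 0 \<omega>) * (W t \<omega> - W s \<omega>))"
      "expectation (\<lambda>\<omega>. (W s \<omega> - W 0 \<omega>) * (W t \<omega> - W s \<omega>)) = 0"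
      using past_increment_orthogonal[OF \<tau> _ f, of "Suc 0"] increment_moments(1)[OF _ that(1)]
      by (simp_all add: \<tau>_def)
    have "(\<lambda>\<omega>. (W s \<omega> - W 0 \<omega>) * (W t \<omega> - W 0 \<omega>)) =
      (\<lambda>\<omega>. (W s \<omega> - W 0 \<omega>)\<^sup>2 + (W s \<omega> - W 0 \<omega>) * (W t \<omega> - W s \<omega>))"
      by (auto simp: power2_eq_square algebra_simps)
    then show ?thesis using 1 increment_moments(3,4)[OF _ that(1)] by simp
  qed
  then show "integrable M (\<lambda>\<omega>. (W s \<omega> - W 0 \<omega>) * (W t \<omega> - W 0 \<omega>))"
    "expectation (\<lambda>\<omega>. (W s \<omega> - W 0 \<omega>) * (W t \<omega> - W 0 \<omega>)) = min s t"
    using *[of s t] *[of t s] assms by (cases "s \<le> t"; simp add: mult.commute)+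
qed

section \<open>Step integrands, the Ito isometry and the maximal inequality\<close>

lemma indicator_Ioc_diff:
  fixes a b r :: real
  assumes "0 \<le> a" "a \<le> b"
  shows "indicator {a<..b} r = (indicator {0<..b} r - indicator {0<..a} r :: real)"
  using assms by (auto simp: indicator_def)

text \<open>The covariance min s t is the integral of the product of the indicators of (0,s] and
  (0,t]. Both sides are additive in each interval, so the identity passes to arbitrary intervals,
  overlapping or not, without distinguishing cases.\<close>

lemma increment_covariance:
  assumes "0 \<le> a" "a \<le> b" "0 \<le> c" "c \<le> d"
  shows "integrable M (\<lambda>\<omega>. (W b \<omega> - W a \<omega>) * (W d \<omega> - W c \<omega>))"
    "integrable lborel (\<lambda>r. indicator {a<..b} r * indicator {c<..d} r :: real)"
    "expectation (\<lambda>\<omega>. (W b \<omega> - W a \<omega>) * (W d \<omega> - W c \<omega>))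
      = (\<integral>r. indicator {a<..b} r * indicator {c<..d} r \<partial>lborel)"
proof -
  let ?V = "\<lambda>s t \<omega>. (W s \<omega> - W 0 \<omega>) * (W t \<omega> - W 0 \<omega>)"
  let ?J = "\<lambda>s t r. indicator {0<..s} r * indicator {0<..t} r :: real"
  have J: "integrable lborel (?J s t)" "(\<integral>r. ?J s t r \<partial>lborel) = min s t" if "0 \<le> s" "0 \<le> t" for s t
  proof -
    have "?J s t = indicator {0<..min s t}" by (auto simp: indicator_def fun_eq_iff)
    then show "integrable lborel (?J s t)" "(\<integral>r. ?J s t r \<partial>lborel) = min s t"
      using that by (simp_all add: measure_def)
  qed
  have b: "0 \<le> b" "0 \<le> d" using assms by auto
  note V = W_covariance[OF b] W_covariance[OF b(1) assms(3)] W_covariance[OF assms(1) b(2)]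
    W_covariance[OF assms(1) assms(3)]
  note J' = J[OF b] J[OF b(1) assms(3)] J[OF assms(1) b(2)] J[OF assms(1) assms(3)]
  have 1: "(\<lambda>\<omega>. (W b \<omega> - W a \<omega>) * (W d \<omega> - W c \<omega>)) = (\<lambda>\<omega>. ?V b d \<omega> - ?V b c \<omega> - ?V a d \<omega> + ?V a c \<omega>)"
    by (auto simp: algebra_simps)
  have 2: "(\<lambda>r. indicator {a<..b} r * indicator {c<..d} r) = (\<lambda>r. ?J b d r - ?J b c r - ?J a d r + ?J a c r)"
    unfolding indicator_Ioc_diff[OF assms(1,2)] indicator_Ioc_diff[OF assms(3,4)]
    by (auto simp: algebra_simps)
  show "integrable M (\<lambda>\<omega>. (W b \<omega> - W a \<omega>) * (W d \<omega> - W c \<omega>))" unfolding 1 using V by simp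
  show "integrable lborel (\<lambda>r. indicator {a<..b} r * indicator {c<..d} r :: real)" unfolding 2 using J' by simp
  show "expectation (\<lambda>\<omega>. (W b \<omega> - W a \<omega>) * (W d \<omega> - W c \<omega>))
      = (\<integral>r. indicator {a<..b} r * indicator {c<..d} r \<partial>lborel)"
    unfolding 1 2 using V J' by simp
qed

text \<open>\<open>elementary Z f\<close>: the random variable \<open>Z\<close> is \<open>\<integral> f dW\<close> for the step function \<open>f\<close>.\<close>

inductive elementary :: "('w \<Rightarrow> 'b::euclidean_space) \<Rightarrow> (real \<Rightarrow> 'b) \<Rightarrow> bool" where
  zero: "elementary (\<lambda>\<omega>. 0) (\<lambda>r. 0)"
| step: "elementary Z f \<Longrightarrow> 0 \<le> a \<Longrightarrow> a \<le> b \<Longrightarrow>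
    elementary (\<lambda>\<omega>. Z \<omega> + (W b \<omega> - W a \<omega>) *\<^sub>R c) (\<lambda>r. f r + indicator {a<..b} r *\<^sub>R c)"

lemma elementary_measurable:
  assumes "elementary Z f"
  shows "Z \<in> borel_measurable M" "f \<in> borel_measurable borel"
  using assms by (induction) (auto intro!: borel_measurable_add borel_measurable_scaleR increment_measurable)

lemma elementary_add:
  assumes "elementary Z f" "elementary Z' f'"
  shows "elementary (\<lambda>\<omega>. Z \<omega> + Z' \<omega>) (\<lambda>r. f r + f' r)"
  using assms(2,1) by induction (auto simp: add.assoc[symmetric] intro: step)

lemma elementary_uminus:
  assumes "elementary Z f"
  shows "elementary (\<lambda>\<omega>. - Z \<omega>) (\<lambda>r. - f r)"
  using assms
proof induction
  case (step Z f a b c)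
  then show ?case using elementary.step[OF step(4) step(2,3), of "- c"] by (simp add: algebra_simps)
qed (simp add: zero)

lemma elementary_diff:
  assumes "elementary Z f" "elementary Z' f'"
  shows "elementary (\<lambda>\<omega>. Z \<omega> - Z' \<omega>) (\<lambda>r. f r - f' r)"
  using elementary_add[OF assms(1) elementary_uminus[OF assms(2)]] by simp

lemma elementary_increment:
  assumes "0 \<le> a" "a \<le> b"
  shows "elementary (\<lambda>\<omega>. (W b \<omega> - W a \<omega>) *\<^sub>R c) (\<lambda>r. indicator {a<..b} r *\<^sub>R c)"
  using step[OF zero assms] by simp

lemma elementary_sum:
  assumes "\<And>i. i \<in> I \<Longrightarrow> elementary (Z i) (f i)"
  shows "elementary (\<lambda>\<omega>. \<Sum>i\<in>I. Z i \<omega>) (\<lambda>r. \<Sum>i\<in>I. f i r)"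
  using assms by (induction I rule: infinite_finite_induct) (auto intro: zero elementary_add)

text \<open>The intervals of a step function may overlap, so the isometry is proved by expanding a
  square; this is the mixed term against one further increment.\<close>

lemma elementary_cross:
  assumes "elementary Z f" "0 \<le> a" "a \<le> b"
  shows "integrable M (\<lambda>\<omega>. (W b \<omega> - W a \<omega>) * (Z \<omega> \<bullet> c)) \<and>
    integrable lborel (\<lambda>r. indicator {a<..b} r * (f r \<bullet> c)) \<and>
    expectation (\<lambda>\<omega>. (W b \<omega> - W a \<omega>) * (Z \<omega> \<bullet> c)) = (\<integral>r. indicator {a<..b} r * (f r \<bullet> c) \<partial>lborel)"
  using assms(1)
proof induction
  case (step Z f a' b' c')
  note C = increment_covariance[OF assms(2,3) step(2,3)]
  have 1: "(\<lambda>\<omega>. (W b \<omega> - W a \<omega>) * ((Z \<omega> + (W b' \<omega> - W a' \<omega>) *\<^sub>R c') \<bullet> c)) =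
    (\<lambda>\<omega>. (W b \<omega> - W a \<omega>) * (Z \<omega> \<bullet> c) + ((W b \<omega> - W a \<omega>) * (W b' \<omega> - W a' \<omega>)) * (c' \<bullet> c))"
    by (simp add: inner_add_left inner_diff_left algebra_simps)
  have 2: "(\<lambda>r. indicator {a<..b} r * ((f r + indicator {a'<..b'} r *\<^sub>R c') \<bullet> c)) =
    (\<lambda>r. indicator {a<..b} r * (f r \<bullet> c) + (indicator {a<..b} r * indicator {a'<..b'} r) * (c' \<bullet> c))"
    by (simp add: inner_add_left algebra_simps)
  show ?case unfolding 1 2 using C step.IH by simp
qed simp

lemma elementary_isometry:
  assumes "elementary Z f"
  shows "integrable M (\<lambda>\<omega>. (norm (Z \<omega>))\<^sup>2) \<and> integrable lborel (\<lambda>r. (norm (f r))\<^sup>2) \<and>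
    expectation (\<lambda>\<omega>. (norm (Z \<omega>))\<^sup>2) = (\<integral>r. (norm (f r))\<^sup>2 \<partial>lborel)"
  using assms
proof induction
  case (step Z f a b c)
  note X = elementary_cross[OF step(1,2,3), of c]
  note C = increment_covariance[OF step(2,3) step(2,3)]
  have 1: "(\<lambda>\<omega>. (norm (Z \<omega> + (W b \<omega> - W a \<omega>) *\<^sub>R c))\<^sup>2) =
    (\<lambda>\<omega>. (norm (Z \<omega>))\<^sup>2 + 2 * ((W b \<omega> - W a \<omega>) * (Z \<omega> \<bullet> c)) +
      ((W b \<omega> - W a \<omega>) * (W b \<omega> - W a \<omega>)) * (c \<bullet> c))"
    unfolding power2_norm_eq_inner by (simp add: inner_add inner_commute algebra_simps)
  have 2: "(\<lambda>r. (norm (f r + indicator {a<..b} r *\<^sub>R c))\<^sup>2) =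
    (\<lambda>r. (norm (f r))\<^sup>2 + 2 * (indicator {a<..b} r * (f r \<bullet> c)) +
      (indicator {a<..b} r * indicator {a<..b} r) * (c \<bullet> c))"
    unfolding power2_norm_eq_inner by (simp add: inner_add inner_commute algebra_simps)
  show ?case unfolding 1 2 using X C step.IH by simp
qed simp

lemma elementary_isometry_nn:
  assumes "elementary Z f"
  shows "(\<integral>\<^sup>+\<omega>. ennreal ((norm (Z \<omega>))\<^sup>2) \<partial>M) = (\<integral>\<^sup>+r. ennreal ((norm (f r))\<^sup>2) \<partial>lborel)"
  using elementary_isometry[OF assms] by (simp add: nn_integral_eq_integral)

text \<open>Kolmogorov's maximal inequality, by decomposing according to the first index \<open>k\<close> at which
  the partial sum reaches \<open>l\<close>.\<close>

lemma maximal_inequality: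
  fixes \<tau> :: "nat \<Rightarrow> real" and a :: "nat \<Rightarrow> 'b::euclidean_space"
  defines "S \<equiv> \<lambda>k \<omega>. \<Sum>j<k. (W (\<tau> (Suc j)) \<omega> - W (\<tau> j) \<omega>) *\<^sub>R a j"
  assumes \<tau>: "0 \<le> \<tau> 0" "mono \<tau>" and l: "l > 0"
  shows "{\<omega> \<in> space M. \<exists>k\<le>m. l \<le> norm (S k \<omega>)} \<in> sets M"
    "l\<^sup>2 * prob {\<omega> \<in> space M. \<exists>k\<le>m. l \<le> norm (S k \<omega>)} \<le> expectation (\<lambda>\<omega>. (norm (S m \<omega>))\<^sup>2)"
proof -
  define D where "D k \<omega> = W (\<tau> (Suc k)) \<omega> - W (\<tau> k) \<omega>" for k \<omega>
  define T where "T k g = (\<Sum>j<k. g j *\<^sub>R a j)" for k and g :: "nat \<Rightarrow> real"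
  \<comment> \<open>The indicator that \<open>k\<close> is the first index at which the norm reaches
    \<open>l\<close>, written as a function of the increments since the orthogonality needs
    dependence on the first \<open>k\<close> of them only.\<close>
  define ch where "ch k g = (if l \<le> norm (T k g) \<and> (\<forall>i<k. norm (T i g) < l) then 1 else (0::real))" for k g
  have \<tau>0: "0 \<le> \<tau> j" for j using \<tau> by (metis le0 monoD order_trans)
  have ST: "S k \<omega> = T k (\<lambda>i. D i \<omega>)" for k \<omega> by (simp add: S_def T_def D_def)
  have Tr: "T i (\<lambda>i\<in>{..<k}. g i) = T i g" if "i \<le> k" for i k g
    using that unfolding T_def by (intro sum.cong) auto
  have chr: "ch k (\<lambda>i\<in>{..<k}. g i) = ch k g" for k g
    unfolding ch_def by (simp add: Tr less_imp_le)
  have el: "elementary (S k) (\<lambda>r. \<Sum>j<k. indicator {\<tau> j<..\<tau> (Suc j)} r *\<^sub>R a j)" for k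
    unfolding S_def by (intro elementary_sum elementary_increment \<tau>0 monoD[OF \<tau>(2)]) auto
  have Sm[measurable]: "S k \<in> borel_measurable M" for k by (rule elementary_measurable[OF el])
  have S2: "integrable M (\<lambda>\<omega>. (norm (S k \<omega>))\<^sup>2)" for k using elementary_isometry[OF el] by blast
  show E: "{\<omega> \<in> space M. \<exists>k\<le>m. l \<le> norm (S k \<omega>)} \<in> sets M" by measurable
  define ch' where "ch' k \<omega> = ch k (\<lambda>i. D i \<omega>)" for k \<omega>
  have ch'_eq: "ch' k \<omega> = (if l \<le> norm (S k \<omega>) \<and> (\<forall>i<k. norm (S i \<omega>) < l) then 1 else 0)" for k \<omega>
    by (simp add: ch'_def ch_def ST)
  have chm[measurable]: "ch' k \<in> borel_measurable M" for k unfolding ch'_eq[abs_def] by measurable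
  have ch01: "0 \<le> ch' k \<omega>" "ch' k \<omega> \<le> 1" for k \<omega> by (auto simp: ch'_eq)
  have int: "integrable M (\<lambda>\<omega>. ch' k \<omega> * (norm (S m \<omega>))\<^sup>2)" for k m
    by (rule Bochner_Integration.integrable_bound[OF S2[of m]])
      (auto intro!: AE_I2 mult_left_le_one_le simp: ch01 abs_mult)
  \<comment> \<open>S m - S k is built from the increments with index at least \<open>k\<close>,
    while \<open>ch' k\<close> and S k are determined by the earlier ones.\<close>
  have cross: "integrable M (\<lambda>\<omega>. ch' k \<omega> * (S k \<omega> \<bullet> (S m \<omega> - S k \<omega>)))"
    "expectation (\<lambda>\<omega>. ch' k \<omega> * (S k \<omega> \<bullet> (S m \<omega> - S k \<omega>))) = 0" if km: "k \<le> m" for k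
  proof -
    have j: "integrable M (\<lambda>\<omega>. ch' k \<omega> * (S k \<omega> \<bullet> a j) * D j \<omega>)"
      "expectation (\<lambda>\<omega>. ch' k \<omega> * (S k \<omega> \<bullet> a j) * D j \<omega>) = 0" if j: "j \<in> {k..<m}" for j
    proof -
      define f where "f g = ch k g * (T k g \<bullet> a j)" for g
      have Tm: "T i \<in> borel_measurable (PiM {..<k} (\<lambda>_. borel))" if "i \<le> k" for i
        unfolding T_def
        by (intro borel_measurable_sum borel_measurable_scaleR measurable_component_singleton)
          (use that in auto)
      have chk: "ch k = (\<lambda>g. indicator {l..} (norm (T k g)) * (\<Prod>i<k. indicator {..<l} (norm (T i g))))"
        by (auto simp: ch_def fun_eq_iff indicator_def)
      have ind: "(\<lambda>g. indicator A (norm (T i g)) :: real) \<in> borel_measurable (PiM {..<k} (\<lambda>_. borel))"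
        if "i \<le> k" "A \<in> sets borel" for i A
        by (rule measurable_compose[OF measurable_compose[OF Tm[OF that(1)] borel_measurable_norm]])
          (use that(2) in \<open>rule borel_measurable_indicator\<close>)
      have "ch k \<in> borel_measurable (PiM {..<k} (\<lambda>_. borel))"
        unfolding chk by (intro borel_measurable_times borel_measurable_prod ind) auto
      then have f: "f \<in> borel_measurable (PiM {..<k} (\<lambda>_. borel))"
        unfolding f_def by (intro borel_measurable_times borel_measurable_inner Tm) auto
      have fe: "f (\<lambda>i\<in>{..<k}. D i \<omega>) = ch' k \<omega> * (S k \<omega> \<bullet> a j)" for \<omega>
        by (simp add: f_def chr Tr ST ch'_def)
      have "integrable M (\<lambda>\<omega>. 1 + (norm (S k \<omega>))\<^sup>2)" using S2 by simp
      then have "integrable M (\<lambda>\<omega>. norm (a j) * (1 + (norm (S k \<omega>))\<^sup>2))" by simp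
      then have fi: "integrable M (\<lambda>\<omega>. f (\<lambda>i\<in>{..<k}. D i \<omega>))"
        unfolding fe
      proof (rule Bochner_Integration.integrable_bound)
        have "norm (ch' k \<omega> * (S k \<omega> \<bullet> a j)) \<le> norm (a j) * (1 + (norm (S k \<omega>))\<^sup>2)" for \<omega>
        proof -
          have "norm (ch' k \<omega> * (S k \<omega> \<bullet> a j)) \<le> 1 * (norm (S k \<omega>) * norm (a j))"
            unfolding real_norm_def abs_mult by (intro mult_mono Cauchy_Schwarz_ineq2) (use ch01 in auto)
          also have "norm (S k \<omega>) \<le> 1 + (norm (S k \<omega>))\<^sup>2"
            using sum_squares_bound[of 1 "norm (S k \<omega>)"] norm_ge_zero[of "S k \<omega>"]
            unfolding one_power2 mult_1_right by linarith
          finally show ?thesis by (simp add: mult.commute mult_right_mono)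
        qed
        then show "AE \<omega> in M. norm (ch' k \<omega> * (S k \<omega> \<bullet> a j)) \<le> norm (norm (a j) * (1 + (norm (S k \<omega>))\<^sup>2))"
          by (auto intro!: AE_I2 elim: order_trans)
      qed measurable
      show "integrable M (\<lambda>\<omega>. ch' k \<omega> * (S k \<omega> \<bullet> a j) * D j \<omega>)"
        "expectation (\<lambda>\<omega>. ch' k \<omega> * (S k \<omega> \<bullet> a j) * D j \<omega>) = 0"
        using past_increment_orthogonal[OF \<tau> _ f, of j] fi j unfolding D_def[symmetric] fe by auto
    qed
    have eq: "(\<lambda>\<omega>. ch' k \<omega> * (S k \<omega> \<bullet> (S m \<omega> - S k \<omega>))) = (\<lambda>\<omega>. \<Sum>j\<in>{k..<m}. ch' k \<omega> * (S k \<omega> \<bullet> a j) * D j \<omega>)"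
    proof
      fix \<omega>
      have "S m \<omega> - S k \<omega> = (\<Sum>j\<in>{k..<m}. D j \<omega> *\<^sub>R a j)"
        using sum_diff_nat_ivl[of 0 k m "\<lambda>j. D j \<omega> *\<^sub>R a j"] km by (simp add: S_def D_def atLeast0LessThan)
      then show "ch' k \<omega> * (S k \<omega> \<bullet> (S m \<omega> - S k \<omega>)) = (\<Sum>j\<in>{k..<m}. ch' k \<omega> * (S k \<omega> \<bullet> a j) * D j \<omega>)"
        by (simp add: inner_sum_right sum_distrib_left mult_ac)
    qed
    show "integrable M (\<lambda>\<omega>. ch' k \<omega> * (S k \<omega> \<bullet> (S m \<omega> - S k \<omega>)))"
      unfolding eq by (rule Bochner_Integration.integrable_sum) (rule j)
    show "expectation (\<lambda>\<omega>. ch' k \<omega> * (S k \<omega> \<bullet> (S m \<omega> - S k \<omega>))) = 0"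
      unfolding eq by (subst Bochner_Integration.integral_sum) (auto simp: j)
  qed
  have low: "expectation (\<lambda>\<omega>. l\<^sup>2 * ch' k \<omega>) \<le> expectation (\<lambda>\<omega>. ch' k \<omega> * (norm (S m \<omega>))\<^sup>2)" if km: "k \<le> m" for k
  proof -
    have "expectation (\<lambda>\<omega>. l\<^sup>2 * ch' k \<omega>)
      \<le> expectation (\<lambda>\<omega>. ch' k \<omega> * (norm (S m \<omega>))\<^sup>2 - 2 * (ch' k \<omega> * (S k \<omega> \<bullet> (S m \<omega> - S k \<omega>))))"
    proof (rule integral_mono)
      show "integrable M (\<lambda>\<omega>. l\<^sup>2 * ch' k \<omega>)"
        by (intro integrable_mult_right integrable_const_bound[of _ 1]) (auto simp: ch01)
      show "integrable M (\<lambda>\<omega>. ch' k \<omega> * (norm (S m \<omega>))\<^sup>2 - 2 * (ch' k \<omega> * (S k \<omega> \<bullet> (S m \<omega> - S k \<omega>))))"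
        using int cross(1)[OF km] by simp
      fix \<omega>
      \<comment> \<open>Where \<open>ch' k\<close> is 1, the norm of S k is at least
        \<open>l\<close>; expanding the square of S m around S k leaves a cross term of mean
        0.\<close>
      have "(norm (S m \<omega>))\<^sup>2 - 2 * (S k \<omega> \<bullet> (S m \<omega> - S k \<omega>)) = (norm (S k \<omega>))\<^sup>2 + (norm (S m \<omega> - S k \<omega>))\<^sup>2"
        unfolding power2_norm_eq_inner by (simp add: inner_diff inner_commute algebra_simps)
      then have "ch' k \<omega> * (norm (S m \<omega>))\<^sup>2 - 2 * (ch' k \<omega> * (S k \<omega> \<bullet> (S m \<omega> - S k \<omega>)))
        = ch' k \<omega> * ((norm (S k \<omega>))\<^sup>2 + (norm (S m \<omega> - S k \<omega>))\<^sup>2)"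
        by (metis mult.left_commute right_diff_distrib)
      also have "\<dots> \<ge> l\<^sup>2 * ch' k \<omega>"
        using l by (auto simp: ch'_eq intro!: add_increasing2 power_mono)
      finally show "l\<^sup>2 * ch' k \<omega> \<le> ch' k \<omega> * (norm (S m \<omega>))\<^sup>2 - 2 * (ch' k \<omega> * (S k \<omega> \<bullet> (S m \<omega> - S k \<omega>)))" .
    qed
    also have "\<dots> = expectation (\<lambda>\<omega>. ch' k \<omega> * (norm (S m \<omega>))\<^sup>2)"
      using int cross[OF km] by simp
    finally show ?thesis .
  qed
  have one: "(\<Sum>k\<le>m. ch' k \<omega>) = indicator {\<omega> \<in> space M. \<exists>k\<le>m. l \<le> norm (S k \<omega>)} \<omega>" if "\<omega> \<in> space M" for \<omega>
  proof (cases "\<exists>k\<le>m. l \<le> norm (S k \<omega>)")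
    case True
    then obtain k' where k': "k' \<le> m" "l \<le> norm (S k' \<omega>)" by blast
    then obtain k where k1: "l \<le> norm (S k \<omega>)" "\<forall>i<k. \<not> l \<le> norm (S i \<omega>)"
      using exists_least_iff[of "\<lambda>k. l \<le> norm (S k \<omega>)"] by blast
    then have "k \<le> m" using k' by (meson le_trans not_le)
    note k = k1 this
    have "ch' i \<omega> = (if i = k then 1 else 0)" for i
      unfolding ch'_eq using k(1,2) by (metis linorder_neqE_nat not_le)
    then show ?thesis using True that k by simp
  qed (auto simp: ch'_eq)
  have "l\<^sup>2 * prob {\<omega> \<in> space M. \<exists>k\<le>m. l \<le> norm (S k \<omega>)} = expectation (\<lambda>\<omega>. l\<^sup>2 * (\<Sum>k\<le>m. ch' k \<omega>))"
    using E by (subst Bochner_Integration.integral_cong[OF refl arg_cong[OF one]]) (auto)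
  also have "\<dots> = (\<Sum>k\<le>m. expectation (\<lambda>\<omega>. l\<^sup>2 * ch' k \<omega>))"
    unfolding sum_distrib_left
    by (intro Bochner_Integration.integral_sum integrable_mult_right integrable_const_bound[of _ 1]) (auto simp: ch01)
  also have "\<dots> \<le> (\<Sum>k\<le>m. expectation (\<lambda>\<omega>. ch' k \<omega> * (norm (S m \<omega>))\<^sup>2))"
    by (intro sum_mono low) simp
  also have "\<dots> = expectation (\<lambda>\<omega>. (\<Sum>k\<le>m. ch' k \<omega>) * (norm (S m \<omega>))\<^sup>2)"
    unfolding sum_distrib_right by (intro Bochner_Integration.integral_sum[symmetric] int)
  also have "\<dots> \<le> expectation (\<lambda>\<omega>. (norm (S m \<omega>))\<^sup>2)"
  proof (rule integral_mono[OF _ S2])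
    show "integrable M (\<lambda>\<omega>. (\<Sum>k\<le>m. ch' k \<omega>) * (norm (S m \<omega>))\<^sup>2)"
      unfolding sum_distrib_right by (intro Bochner_Integration.integrable_sum int)
    show "(\<Sum>k\<le>m. ch' k \<omega>) * (norm (S m \<omega>))\<^sup>2 \<le> (norm (S m \<omega>))\<^sup>2" if "\<omega> \<in> space M" for \<omega>
      unfolding one[OF that] by (simp add: indicator_def)
  qed
  finally show "l\<^sup>2 * prob {\<omega> \<in> space M. \<exists>k\<le>m. l \<le> norm (S k \<omega>)} \<le> expectation (\<lambda>\<omega>. (norm (S m \<omega>))\<^sup>2)" .
qed

end

section \<open>Continuous versions of Wiener integrals\<close>

text \<open>For r > 0, the index k such that r lies in (k h, (k + 1) h]. The cells are open on the
  left like the intervals of the step integrands; rounding r down to k h turns an integrand into its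
  left-point step function.\<close>

definition cell :: "real \<Rightarrow> real \<Rightarrow> nat" where
  "cell h r = nat (\<lceil>r / h\<rceil> - 1)"

lemma cell_bounds:
  assumes "h > 0" "r > 0"
  shows "real (cell h r) * h < r" "r \<le> (real (cell h r) + 1) * h"
proof -
  have "\<lceil>r / h\<rceil> \<ge> 1" using assms by simp
  then have c: "real (cell h r) = of_int \<lceil>r / h\<rceil> - 1" by (simp add: cell_def)
  have "of_int \<lceil>r / h\<rceil> - 1 < r / h" by linarith
  then show "real (cell h r) * h < r" using assms c by (simp add: pos_less_divide_eq)
  have "r / h * h \<le> of_int \<lceil>r / h\<rceil> * h" by (intro mult_right_mono) (use assms in auto)
  then show "r \<le> (real (cell h r) + 1) * h" using assms c by simp
qed

lemma cell_unique:
  assumes h: "h > 0" and k: "real k * h < r" "r \<le> (real k + 1) * h"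
  shows "cell h r = k"
proof -
  have "0 \<le> real k * h" using h by simp
  then have r: "r > 0" using k by linarith
  note c = cell_bounds[OF h r]
  have "real k * h < (real (cell h r) + 1) * h" "real (cell h r) * h < (real k + 1) * h"
    using k c by linarith+
  then have "real k < real (cell h r) + 1" "real (cell h r) < real k + 1"
    using h by auto
  then show ?thesis by linarith
qed

text \<open>At most one cell contains a given \<open>r\<close>. Cutting the end points at
  \<open>t\<close> lets a full mesh be used for times between grid points.\<close>

lemma cell_sum:
  fixes c :: "nat \<Rightarrow> 'b::real_vector"
  assumes h: "h > 0" and t: "0 \<le> t" "t \<le> real K * h"
  shows "(\<Sum>k<K. indicator {min t (real k * h)<..min t (real (Suc k) * h)} r *\<^sub>R c k)
    = indicator {0<..t} r *\<^sub>R c (cell h r)"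
proof (cases "r \<in> {0<..t}")
  case True
  then have r: "r > 0" "r \<le> t" by auto
  note b = cell_bounds[OF h r(1)]
  have "real (cell h r) * h < real K * h" using b r t by linarith
  then have K: "cell h r < K" using h by simp
  have "indicator {min t (real k * h)<..min t (real (Suc k) * h)} r = (if k = cell h r then 1 else 0 :: real)" for k
  proof (cases "k = cell h r")
    case False
    then have "\<not> (real k * h < r \<and> r \<le> (real k + 1) * h)" using cell_unique[OF h] by metis
    then show ?thesis using False r by (auto simp: indicator_def min_def add.commute split: if_splits)
  qed (use b r in \<open>auto simp: indicator_def min_def add.commute\<close>)
  then show ?thesis using True K by (simp add: if_distrib[of "\<lambda>x. x *\<^sub>R _"] cong: if_cong)
next
  case False
  have "indicator {min t (real k * h)<..min t (real (Suc k) * h)} r = (0 :: real)" for k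
  proof -
    have "0 \<le> min t (real k * h)" using h t by simp
    then show ?thesis using False by (auto simp: indicator_def)
  qed
  then show ?thesis using False by simp
qed

text \<open>Meshes with an integer ratio are nested. This is what makes the telescoping over the
  levels exact.\<close>

lemma cell_refine:
  assumes h: "h > 0" and r: "r > 0" and n: "n > 0"
  shows "cell h r div n = cell (real n * h) r"
proof -
  define i where "i = cell h r"
  note b = cell_bounds[OF h r, folded i_def]
  have "real (i div n) * real n \<le> real i"
    by (metis div_times_less_eq_dividend of_nat_le_iff of_nat_mult)
  then have 1: "real (i div n) * (real n * h) \<le> real i * h"
    using h by (simp add: mult_right_mono flip: mult.assoc)
  have "i + 1 \<le> (i div n + 1) * n"
    using n by (metis Suc_eq_plus1 Suc_leI dividend_less_div_times mult.commute mult_Suc_right add.commute mult_Suc)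
  then have "real (i + 1) \<le> real ((i div n + 1) * n)" by (rule of_nat_mono)
  then have "(real i + 1) * h \<le> (real (i div n) + 1) * real n * h"
    using h by (intro mult_right_mono) (auto simp: algebra_simps)
  then have 2: "r \<le> (real (i div n) + 1) * (real n * h)" using b by (simp add: mult.assoc)
  have "real (i div n) * (real n * h) < r" using 1 b(1) by linarith
  from cell_unique[OF _ this 2] show ?thesis using h n by (simp add: i_def)
qed

lemma nn_integral_norm_sq_triangle:
  fixes X Y Z :: "'a \<Rightarrow> 'b::euclidean_space"
  assumes [measurable]: "X \<in> borel_measurable M" "Y \<in> borel_measurable M" "Z \<in> borel_measurable M"
  shows "(\<integral>\<^sup>+x. ennreal ((norm (X x - Z x))\<^sup>2) \<partial>M)
    \<le> 2 * (\<integral>\<^sup>+x. ennreal ((norm (X x - Y x))\<^sup>2) \<partial>M) + 2 * (\<integral>\<^sup>+x. ennreal ((norm (Y x - Z x))\<^sup>2) \<partial>M)"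
proof -
  have "(\<integral>\<^sup>+x. ennreal ((norm (X x - Z x))\<^sup>2) \<partial>M)
    \<le> (\<integral>\<^sup>+x. 2 * ennreal ((norm (X x - Y x))\<^sup>2) + 2 * ennreal ((norm (Y x - Z x))\<^sup>2) \<partial>M)"
  proof (rule nn_integral_mono)
    fix x
    have "(norm (X x - Z x))\<^sup>2 \<le> (norm (X x - Y x) + norm (Y x - Z x))\<^sup>2"
      by (intro power_mono norm_diff_triangle_ineq[of "X x" "Y x" "Y x" "Z x", simplified]
          norm_diff_triangle_le[OF order_refl order_refl]) auto
    also have "\<dots> \<le> 2 * (norm (X x - Y x))\<^sup>2 + 2 * (norm (Y x - Z x))\<^sup>2"
      using sum_squares_bound[of "norm (X x - Y x)" "norm (Y x - Z x)"] by (simp add: power2_sum)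
    finally show "ennreal ((norm (X x - Z x))\<^sup>2) \<le> 2 * ennreal ((norm (X x - Y x))\<^sup>2) + 2 * ennreal ((norm (Y x - Z x))\<^sup>2)"
      by (simp add: ennreal_mult[symmetric] ennreal_plus[symmetric] ennreal_leI
        flip: ennreal_numeral del: ennreal_plus)
  qed
  also have "\<dots> = 2 * (\<integral>\<^sup>+x. ennreal ((norm (X x - Y x))\<^sup>2) \<partial>M) + 2 * (\<integral>\<^sup>+x. ennreal ((norm (Y x - Z x))\<^sup>2) \<partial>M)"
    by (simp add: nn_integral_add nn_integral_cmult)
  finally show ?thesis .
qed

lemma (in brownian) elementary_norm_sq_le:
  assumes el: "elementary Z f" and t: "0 \<le> t" and c: "\<And>r. r \<in> {0<..t} \<Longrightarrow> norm (f r) \<le> c"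
    and 0: "\<And>r. r \<notin> {0<..t} \<Longrightarrow> f r = 0"
  shows "(\<integral>\<^sup>+\<omega>. ennreal ((norm (Z \<omega>))\<^sup>2) \<partial>M) \<le> ennreal (t * c\<^sup>2)"
proof -
  have "(\<integral>\<^sup>+r. ennreal ((norm (f r))\<^sup>2) \<partial>lborel) \<le> (\<integral>\<^sup>+r. ennreal (c\<^sup>2) * indicator {0<..t} r \<partial>lborel)"
    by (intro nn_integral_mono) (auto simp: indicator_def 0 intro!: ennreal_leI power_mono c)
  also have "\<dots> = ennreal (t * c\<^sup>2)"
    using t by (subst nn_integral_cmult_indicator) (simp_all add: ennreal_mult mult.commute)
  finally show ?thesis using elementary_isometry_nn[OF el] by simp
qed

lemma continuous_on_halfline:
  fixes f :: "real \<Rightarrow> 'b::topological_space"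
  assumes "\<And>T::nat. continuous_on {0..real T} f"
  shows "continuous_on {0..} f"
  unfolding continuous_on_eq_continuous_within
proof
  fix x :: real assume x: "x \<in> {0..}"
  obtain T :: nat where T: "x < real T" using reals_Archimedean2 by blast
  have "at x within {0..} = at x within {0..real T}"
    by (rule at_within_nhd[of _ "{..<real T}"]) (use T in auto)
  then show "continuous (at x within {0..}) f"
    using assms[of T] x T by (simp add: continuous_on_eq_continuous_within)
qed

text \<open>Continuity of an integrand prescribes no rate, so the depth \<open>L m\<close> is
  adapted to \<sigma>: across the mesh width 2^-L m it varies by at most 2^-m. The time range grows
  with \<open>m\<close>, so that every fixed time is eventually covered.\<close>

locale dyadic_mesh = brownian M W for M :: "'w measure" and W +
  fixes \<sigma> :: "real \<Rightarrow> 'b::euclidean_space" and L :: "nat \<Rightarrow> nat"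
  assumes L_mono: "mono L"
    and L_mod: "\<And>m r r'. 0 \<le> r \<Longrightarrow> r \<le> real m + 1 \<Longrightarrow> 0 \<le> r' \<Longrightarrow> r' \<le> real m + 1 \<Longrightarrow>
      \<bar>r - r'\<bar> \<le> (1/2) ^ L m \<Longrightarrow> norm (\<sigma> r - \<sigma> r') \<le> (1/2) ^ m"
begin

definition h :: "nat \<Rightarrow> real" where "h m = (1/2) ^ L m"

text \<open>The coefficients of the difference of the step approximations of levels \<open>m\<close> and \<open>m - 1\<close>, so that
  the sum over the levels telescopes.\<close>

definition coef :: "nat \<Rightarrow> nat \<Rightarrow> 'b" where
  "coef m k = (if m = 0 then \<sigma> (real k * h 0)
    else \<sigma> (real k * h m) - \<sigma> (real (k div 2 ^ (L m - L (m - 1))) * h (m - 1)))"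

definition level :: "nat \<Rightarrow> nat \<Rightarrow> (real \<Rightarrow> real) \<Rightarrow> real \<Rightarrow> 'b" where
  "level m K w t = (\<Sum>k<K. (w (min t (real (Suc k) * h m)) - w (min t (real k * h m))) *\<^sub>R coef m k)"

abbreviation cells :: "nat \<Rightarrow> real \<Rightarrow> nat" where "cells m T \<equiv> (nat \<lceil>T\<rceil> + 1) * 2 ^ L m"

text \<open>Here the number of cells follows \<open>t\<close>, which gives one process on the whole
  half-line. Any number of cells reaching beyond \<open>t\<close> yields the same value, so a fixed
  number can be used on a bounded interval when continuity is shown.\<close>

definition lev :: "nat \<Rightarrow> (real \<Rightarrow> real) \<Rightarrow> real \<Rightarrow> 'b" where
  "lev m w t = level m (cells m t) w t"

text \<open>The level at its grid points: a weighted sum of independent increments, to which the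
  maximal inequality applies.\<close>

definition grid :: "nat \<Rightarrow> (real \<Rightarrow> real) \<Rightarrow> nat \<Rightarrow> 'b" where
  "grid m w k = (\<Sum>j<k. (w (real (Suc j) * h m) - w (real j * h m)) *\<^sub>R coef m j)"

lemma h_pos: "h m > 0" by (simp add: h_def)

lemma h_step: "h m = real (2 ^ (L (Suc m) - L m)) * h (Suc m)"
proof -
  have "L (Suc m) = (L (Suc m) - L m) + L m" using L_mono by (simp add: monoD)
  then have "h (Suc m) = (1/2) ^ (L (Suc m) - L m) * h m"
    unfolding h_def by (metis power_add)
  then show ?thesis by (simp add: power_divide)
qed

lemma cells_bound: "t < real (cells m t) * h m"
proof -
  have "real (cells m t) * h m = real (nat \<lceil>t\<rceil>) + 1"
    by (simp add: h_def power_divide field_simps)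
  then show ?thesis by linarith
qed

text \<open>Cells before \<open>t\<close> contribute in full, the cell containing \<open>t\<close>
  in part, and later ones not at all because both of their end points are cut to
  \<open>t\<close>.\<close>

lemma level_eq:
  assumes t: "0 \<le> t" and k: "real k * h m \<le> t" "t < real (Suc k) * h m" and K: "t < real K * h m"
  shows "level m K w t = grid m w k + (w t - w (real k * h m)) *\<^sub>R coef m k"
proof -
  have kK: "k < K"
  proof -
    have "real k * h m < real K * h m" using k K by linarith
    then show ?thesis using h_pos[of m] by simp
  qed
  let ?f = "\<lambda>j. (w (min t (real (Suc j) * h m)) - w (min t (real j * h m))) *\<^sub>R coef m j"
  have mono: "real i * h m \<le> real j * h m" if "i \<le> j" for i j
    using that h_pos[of m] by (simp add: mult_right_mono)
  have "?f j = 0" if "Suc k \<le> j" for j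
    using mono[OF that] mono[of "Suc k" "Suc j"] that k by (simp add: min_absorb1)
  then have "level m K w t = sum ?f {..<Suc k}"
    unfolding level_def by (intro sum.mono_neutral_right) (use kK in auto)
  also have "\<dots> = sum ?f {..<k} + ?f k" by simp
  also have "sum ?f {..<k} = grid m w k"
    unfolding grid_def
  proof (intro sum.cong refl)
    fix j assume "j \<in> {..<k}"
    then have "Suc j \<le> k" by simp
    from mono[OF this] mono[of j k] this k have "real (Suc j) * h m \<le> t" "real j * h m \<le> t" by auto
    then show "?f j = (w (real (Suc j) * h m) - w (real j * h m)) *\<^sub>R coef m j"
      by (simp add: min_absorb2 del: of_nat_Suc)
  qed
  also have "?f k = (w t - w (real k * h m)) *\<^sub>R coef m k"
    using k by (simp add: min_absorb1 min_absorb2 del: of_nat_Suc)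
  finally show ?thesis .
qed

lemma grid_index:
  assumes "0 \<le> t"
  obtains k where "real k * h m \<le> t" "t < real (Suc k) * h m"
proof
  let ?k = "nat \<lfloor>t / h m\<rfloor>"
  have "0 \<le> t / h m" using assms h_pos[of m] by simp
  then have "real ?k \<le> t / h m" "t / h m < real (Suc ?k)" by linarith+
  then show "real ?k * h m \<le> t" "t < real (Suc ?k) * h m"
    using h_pos[of m] by (simp_all add: pos_le_divide_eq pos_divide_less_eq del: of_nat_Suc)
qed

lemma lev_eq_level:
  assumes "0 \<le> t" "t < real K * h m"
  shows "lev m w t = level m K w t"
proof -
  obtain k where k: "real k * h m \<le> t" "t < real (Suc k) * h m" using grid_index[OF assms(1)] .
  show ?thesis
    unfolding lev_def level_eq[OF assms(1) k assms(2)] level_eq[OF assms(1) k cells_bound] ..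
qed

lemma coef_bound:
  assumes m: "m > 0" and k: "real k * h m \<le> real m"
  shows "norm (coef m k) \<le> 2 * (1/2) ^ m"
proof -
  obtain m' where m': "m = Suc m'" using m by (cases m) auto
  let ?n = "2 ^ (L m - L m') :: nat"
  have hm: "h m' = real ?n * h m" using h_step[of m'] m' by simp
  have le: "real (k div ?n) * h m' \<le> real k * h m"
  proof -
    have "real (k div ?n) * real ?n \<le> real k"
      by (metis div_times_less_eq_dividend of_nat_le_iff of_nat_mult)
    then show ?thesis unfolding hm using h_pos[of m] by (simp add: mult_right_mono flip: mult.assoc)
  qed
  have ge: "real k * h m - real (k div ?n) * h m' \<le> h m'"
  proof -
    have "k \<le> (k div ?n) * ?n + ?n"
      by (metis add_left_mono div_mult_mod_eq less_imp_le mod_less_divisor zero_less_numeral zero_less_power)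
    then have "real k \<le> real (k div ?n * ?n + ?n)" by (rule of_nat_mono)
    then have "real k * h m \<le> (real (k div ?n) * real ?n + real ?n) * h m"
      using h_pos[of m] by (intro mult_right_mono) auto
    then show ?thesis unfolding hm by (simp add: algebra_simps)
  qed
  \<comment> \<open>The fine grid point and the coarse one to its left are at most one coarse mesh
    width apart, so the modulus of level \<open>m'\<close> applies, and the bound on
    \<open>k\<close> keeps both in its range. The factor 2 in the claim is the loss of one
    level.\<close>
  have "norm (\<sigma> (real k * h m) - \<sigma> (real (k div ?n) * h m')) \<le> (1/2) ^ m'"
  proof (rule L_mod)
    show "0 \<le> real k * h m" "0 \<le> real (k div ?n) * h m'"
      using h_pos[of m] h_pos[of m'] by (auto intro: mult_nonneg_nonneg)
    show "real k * h m \<le> real m' + 1" using k m' by simp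
    then show "real (k div ?n) * h m' \<le> real m' + 1" using le by linarith
    show "\<bar>real k * h m - real (k div ?n) * h m'\<bar> \<le> (1/2) ^ L m'"
      using le ge unfolding h_def by linarith
  qed
  then show ?thesis using m m' by (simp add: coef_def)
qed

lemma coef_telescope:
  assumes "r > 0"
  shows "(\<Sum>m\<le>n. coef m (cell (h m) r)) = \<sigma> (real (cell (h n) r) * h n)"
proof (induction n)
  case (Suc n)
  have "cell (h (Suc n)) r div 2 ^ (L (Suc n) - L n) = cell (h n) r"
    using cell_refine[OF h_pos assms, of "2 ^ (L (Suc n) - L n)" "Suc n"] h_step[of n] by simp
  then show ?case using Suc by (simp add: coef_def)
qed (simp add: coef_def)

lemma lev_elementary:
  assumes t: "0 \<le> t"
  shows "elementary (\<lambda>\<omega>. lev m (\<lambda>s. W s \<omega>) t) (\<lambda>r. indicator {0<..t} r *\<^sub>R coef m (cell (h m) r))"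
proof -
  have "elementary (\<lambda>\<omega>. lev m (\<lambda>s. W s \<omega>) t) (\<lambda>r. \<Sum>k<cells m t.
      indicator {min t (real k * h m)<..min t (real (Suc k) * h m)} r *\<^sub>R coef m k)"
    unfolding lev_def level_def
  proof (intro elementary_sum elementary_increment)
    fix k
    show "0 \<le> min t (real k * h m)" using t h_pos[of m] by simp
    show "min t (real k * h m) \<le> min t (real (Suc k) * h m)"
      using h_pos[of m] by (intro min.mono mult_right_mono) auto
  qed
  then show ?thesis
    by (simp only: cell_sum[OF h_pos t less_imp_le[OF cells_bound]])
qed

lemma partial_elementary:
  assumes t: "0 \<le> t"
  shows "elementary (\<lambda>\<omega>. \<Sum>m\<le>n. lev m (\<lambda>s. W s \<omega>) t)
    (\<lambda>r. indicator {0<..t} r *\<^sub>R \<sigma> (real (cell (h n) r) * h n))"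
proof -
  have "elementary (\<lambda>\<omega>. \<Sum>m\<le>n. lev m (\<lambda>s. W s \<omega>) t)
    (\<lambda>r. \<Sum>m\<le>n. indicator {0<..t} r *\<^sub>R coef m (cell (h m) r))"
    by (intro elementary_sum lev_elementary t)
  also have "(\<lambda>r. \<Sum>m\<le>n. indicator {0<..t} r *\<^sub>R coef m (cell (h m) r))
    = (\<lambda>r. indicator {0<..t} r *\<^sub>R \<sigma> (real (cell (h n) r) * h n))"
    by (auto simp: fun_eq_iff indicator_def coef_telescope)
  finally show ?thesis .
qed

lemma step_close:
  assumes "0 < r" "r \<le> real n + 1"
  shows "norm (\<sigma> (real (cell (h n) r) * h n) - \<sigma> r) \<le> (1/2) ^ n"
proof (rule L_mod)
  note b = cell_bounds[OF h_pos[of n] assms(1)]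
  show "0 \<le> real (cell (h n) r) * h n" using h_pos[of n] by simp
  show "real (cell (h n) r) * h n \<le> real n + 1" using b assms by linarith
  show "\<bar>real (cell (h n) r) * h n - r\<bar> \<le> (1/2) ^ L n"
    using b by (simp add: algebra_simps h_def[symmetric])
qed (use assms in auto)

text \<open>The threshold has to be summable, for uniform convergence of the levels, and large
  against the standard deviation, which up to time m is at most of order sqrt m 2^-m. Any ratio
  strictly between 1/2 and 1 separates the two; with 3/4 the factor m can be estimated by 2^m and
  the probabilities still decay with ratio 8/9.\<close>

definition bad :: "nat \<Rightarrow> 'w set" where
  "bad m = {\<omega> \<in> space M. \<exists>k\<le>m * 2 ^ L m. (3/4) ^ m \<le> norm (grid m (\<lambda>s. W s \<omega>) k)}"

text \<open>The isometry bounds the second moment at time \<open>m\<close>, and the maximal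
  inequality extends this to all grid points before it.\<close>

lemma bad_prob:
  assumes m: "m > 0"
  shows "bad m \<in> sets M" "prob (bad m) \<le> 4 * (8/9) ^ m"
proof -
  define \<tau> where "\<tau> k = real k * h m" for k
  have \<tau>: "0 \<le> \<tau> 0" "mono \<tau>" using h_pos[of m] by (auto simp: \<tau>_def intro!: monoI mult_right_mono)
  let ?K = "m * 2 ^ L m"
  have Kh: "real ?K * h m = real m" by (simp add: h_def power_divide)
  have l0: "0 < (3/4 :: real) ^ m" by simp
  note mi = maximal_inequality[OF \<tau> l0, of ?K "coef m"]
  show "bad m \<in> sets M" unfolding bad_def grid_def using mi(1) unfolding \<tau>_def .
  have mi2: "((3/4) ^ m)\<^sup>2 * prob (bad m) \<le> expectation (\<lambda>\<omega>. (norm (grid m (\<lambda>s. W s \<omega>) ?K))\<^sup>2)"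
    unfolding bad_def grid_def using mi(2) unfolding \<tau>_def .
  have el: "elementary (\<lambda>\<omega>. grid m (\<lambda>s. W s \<omega>) ?K) (\<lambda>r. indicator {0<..real m} r *\<^sub>R coef m (cell (h m) r))"
  proof -
    have "elementary (\<lambda>\<omega>. grid m (\<lambda>s. W s \<omega>) ?K)
      (\<lambda>r. \<Sum>k<?K. indicator {real k * h m<..real (Suc k) * h m} r *\<^sub>R coef m k)"
      unfolding grid_def by (intro elementary_sum elementary_increment)
        (use h_pos[of m] in \<open>auto intro!: mult_right_mono\<close>)
    also have "(\<lambda>r. \<Sum>k<?K. indicator {real k * h m<..real (Suc k) * h m} r *\<^sub>R coef m k)
      = (\<lambda>r. \<Sum>k<?K. indicator {min (real m) (real k * h m)<..min (real m) (real (Suc k) * h m)} r *\<^sub>R coef m k)"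
    proof (intro ext sum.cong refl)
      fix r k assume "k \<in> {..<?K}"
      then have k: "Suc k \<le> ?K" "k \<le> ?K" by auto
      have "real (Suc k) * h m \<le> real ?K * h m" "real k * h m \<le> real ?K * h m"
        by (rule mult_right_mono[OF of_nat_mono[OF k(1)] less_imp_le[OF h_pos]],
            rule mult_right_mono[OF of_nat_mono[OF k(2)] less_imp_le[OF h_pos]])
      then show "indicator {real k * h m<..real (Suc k) * h m} r *\<^sub>R coef m k =
        indicator {min (real m) (real k * h m)<..min (real m) (real (Suc k) * h m)} r *\<^sub>R coef m k"
        unfolding Kh by (simp add: min_absorb2 del: of_nat_Suc)
    qed
    finally show ?thesis
      by (simp only: cell_sum[OF h_pos of_nat_0_le_iff eq_refl[OF Kh[symmetric]]])
  qed
  have "expectation (\<lambda>\<omega>. (norm (grid m (\<lambda>s. W s \<omega>) ?K))\<^sup>2) \<le> real m * (2 * (1/2) ^ m)\<^sup>2"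
  proof -
    have "(\<integral>\<^sup>+\<omega>. ennreal ((norm (grid m (\<lambda>s. W s \<omega>) ?K))\<^sup>2) \<partial>M) \<le> ennreal (real m * (2 * (1/2) ^ m)\<^sup>2)"
    proof (rule elementary_norm_sq_le[OF el])
      fix r assume r: "r \<in> {0<..real m}"
      then have "real (cell (h m) r) * h m \<le> real m" using cell_bounds[OF h_pos, of r m] by auto
      from coef_bound[OF m this] r
      show "norm (indicator {0<..real m} r *\<^sub>R coef m (cell (h m) r)) \<le> 2 * (1/2) ^ m" by simp
    qed auto
    then show ?thesis
      using elementary_isometry[OF el] by (subst (asm) nn_integral_eq_integral) auto
  qed
  with mi2 have le: "((3/4) ^ m)\<^sup>2 * prob (bad m) \<le> real m * (2 * (1/2) ^ m)\<^sup>2" by (rule order_trans)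
  have sq: "((3/4 :: real) ^ m)\<^sup>2 = (9/16) ^ m" "((1/2 :: real) ^ m)\<^sup>2 = (1/4) ^ m"
    by (simp_all add: power2_eq_square flip: power_mult_distrib)
  have "(9/16) ^ m * prob (bad m) \<le> 4 * (real m * (1/4) ^ m)"
    using le by (simp only: sq power_mult_distrib[of 2]) simp
  also have "\<dots> \<le> 4 * (2 ^ m * (1/4) ^ m)"
    by (intro mult_left_mono mult_right_mono) (use of_nat_less_two_power[of m, where 'a = real] in auto)
  also have "\<dots> = (9/16) ^ m * (4 * (8/9) ^ m)"
    by (simp flip: power_mult_distrib)
  finally show "prob (bad m) \<le> 4 * (8/9) ^ m" by simp
qed

text \<open>At grid points the level is below the threshold. Inside a cell the path moves by a
  bounded amount and is multiplied by a coefficient of size at most 2 2^-m. So control at finitely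
  many points per level gives uniform convergence on compact intervals.\<close>

lemma path_series:
  assumes w: "continuous_on {0..} w"
    and good: "\<And>m k. m0 \<le> m \<Longrightarrow> k \<le> m * 2 ^ L m \<Longrightarrow> norm (grid m w k) < (3/4) ^ m"
  shows "continuous_on {0..} (\<lambda>t. \<Sum>m. lev m w t)"
    "0 \<le> t \<Longrightarrow> (\<lambda>n. \<Sum>m\<le>n. lev m w t) \<longlonglongrightarrow> (\<Sum>m. lev m w t)"
proof -
  have *: "uniform_limit {0..real T} (\<lambda>n t. \<Sum>m<n. lev m w t) (\<lambda>t. \<Sum>m. lev m w t) sequentially" for T :: nat
  proof -
    have "bounded (w ` {0..real T})"
      by (intro compact_imp_bounded compact_continuous_image continuous_on_subset[OF w]) auto
    then obtain D where "\<forall>x \<in> w ` {0..real T}. norm x \<le> D" by (auto simp: bounded_iff)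
    then have D: "\<And>t. t \<in> {0..real T} \<Longrightarrow> \<bar>w t\<bar> \<le> D" by simp
    show ?thesis
    proof (rule Weierstrass_m_test_ev)
      show "\<forall>\<^sub>F m in sequentially. \<forall>t\<in>{0..real T}. norm (lev m w t) \<le> (3/4) ^ m + (2 * D) * (2 * (1/2) ^ m)"
        unfolding eventually_sequentially
      proof (intro exI allI impI ballI)
        \<comment> \<open>From level T + 1 on, [0,T] lies in the range [0,m] of the level, and
          \<open>m\<close> is positive as \<open>coef_bound\<close> demands.\<close>
        fix m t assume m: "max m0 (T + 1) \<le> m" and t: "t \<in> {0..real T}"
        obtain k where k: "real k * h m \<le> t" "t < real (Suc k) * h m" using grid_index[of t m] t by auto
        have km: "real k * h m \<le> real m" using k t m by auto
        then have "real k * h m \<le> real (m * 2 ^ L m) * h m" by (simp add: h_def power_divide)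
        then have "k \<le> m * 2 ^ L m" using h_pos[of m] by (simp only: mult_le_cancel_right_pos of_nat_le_iff)
        then have 1: "norm (grid m w k) \<le> (3/4) ^ m" using good[of m k] m by simp
        have 2: "norm (coef m k) \<le> 2 * (1/2) ^ m" by (rule coef_bound[OF _ km]) (use m in simp)
        have 3: "\<bar>w t - w (real k * h m)\<bar> \<le> 2 * D"
          using D[OF t] D[of "real k * h m"] k t h_pos[of m] by (auto simp: abs_le_iff)
        have "norm (lev m w t) = norm (grid m w k + (w t - w (real k * h m)) *\<^sub>R coef m k)"
          using level_eq[OF _ k cells_bound] t by (simp add: lev_def)
        also have "\<dots> \<le> (3/4) ^ m + (2 * D) * (2 * (1/2) ^ m)"
        proof (intro norm_triangle_le add_mono 1)
          have "0 \<le> 2 * D" using 3 by linarith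
          then show "norm ((w t - w (real k * h m)) *\<^sub>R coef m k) \<le> (2 * D) * (2 * (1/2) ^ m)"
            unfolding norm_scaleR by (intro mult_mono 2 3) auto
        qed
        finally show "norm (lev m w t) \<le> (3/4) ^ m + (2 * D) * (2 * (1/2) ^ m)" .
      qed
      show "summable (\<lambda>m. (3/4) ^ m + (2 * D) * (2 * (1/2) ^ m :: real))"
        by (intro summable_add summable_mult summable_geometric) auto
    qed
  qed
  have cl: "continuous_on {0..real T} (lev m w)" for m T
  proof -
    let ?K = "(T + 1) * 2 ^ L m"
    have "continuous_on {0..real T} (level m ?K w)"
      unfolding level_def
      by (intro continuous_intros continuous_on_compose2[OF w]) (use h_pos[of m] in auto)
    moreover have "level m ?K w t = lev m w t" if "t \<in> {0..real T}" for t
    proof (rule lev_eq_level[symmetric])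
      have "real ?K * h m = real T + 1" by (simp add: h_def power_divide field_simps)
      then show "t < real ?K * h m" using that by simp
    qed (use that in auto)
    ultimately show ?thesis by (rule continuous_on_eq) auto
  qed
  show "continuous_on {0..} (\<lambda>t. \<Sum>m. lev m w t)"
    by (intro continuous_on_halfline uniform_limit_theorem[OF _ *] always_eventually allI continuous_on_sum cl) simp
  assume t: "0 \<le> t"
  then have "t \<in> {0..real (nat \<lceil>t\<rceil>)}" by (simp add: real_nat_ceiling_ge)
  from tendsto_uniform_limitI[OF * this]
  show "(\<lambda>n. \<Sum>m\<le>n. lev m w t) \<longlonglongrightarrow> (\<Sum>m. lev m w t)"
    by (subst lessThan_Suc_atMost[symmetric], rule LIMSEQ_Suc)
qed

text \<open>By Borel-Cantelli almost surely only finitely many levels are bad. The exceptional set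
  is enlarged to a measurable null set, on which the process is put to 0; this yields continuity of
  every path and measurability with respect to \<open>M\<close> itself.\<close>

lemma continuous_version:
  "\<exists>Y. (\<forall>t\<ge>0. Y t \<in> borel_measurable M) \<and> (\<forall>\<omega>\<in>space M. continuous_on {0..} (\<lambda>t. Y t \<omega>)) \<and>
    (\<forall>t\<ge>0. AE \<omega> in M. (\<lambda>n. \<Sum>m\<le>n. lev m (\<lambda>s. W s \<omega>) t) \<longlonglongrightarrow> Y t \<omega>)"
proof -
  \<comment> \<open>Level 0 is left out: its coefficients are values of \<sigma> and not small
    differences.\<close>
  have "AE \<omega> in M. \<forall>\<^sub>F m in sequentially. \<omega> \<in> space M - bad (Suc m)"
  proof (rule borel_cantelli_AE1)
    show "summable (\<lambda>m. prob (bad (Suc m)))"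
    proof (rule summable_comparison_test[OF exI[of _ 0]])
      show "\<forall>n\<ge>0. norm (prob (bad (Suc n))) \<le> 4 * (8/9) ^ Suc n"
        by (intro allI impI) (simp only: real_norm_def abs_of_nonneg[OF measure_nonneg] bad_prob zero_less_Suc)
      show "summable (\<lambda>n. 4 * (8/9) ^ Suc n :: real)"
        using summable_mult[OF summable_Suc_iff[THEN iffD2, OF summable_geometric[of "8/9::real"]], of 4] by simp
    qed
  qed (use bad_prob in \<open>auto simp: emeasure_eq_measure\<close>)
  moreover have "AE \<omega> in M. continuous_on {0..} (\<lambda>t. W t \<omega>)"
    using bm by (simp add: brownian_motion_def)
  ultimately have "AE \<omega> in M. (\<forall>\<^sub>F m in sequentially. \<omega> \<in> space M - bad (Suc m)) \<and> continuous_on {0..} (\<lambda>t. W t \<omega>)"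
    by eventually_elim auto
  then obtain N where
    NG: "{\<omega> \<in> space M. \<not> ((\<forall>\<^sub>F m in sequentially. \<omega> \<in> space M - bad (Suc m)) \<and> continuous_on {0..} (\<lambda>t. W t \<omega>))} \<subseteq> N"
    and N: "emeasure M N = 0" "N \<in> sets M"
    by (rule AE_E)
  have G: "continuous_on {0..} (\<lambda>t. \<Sum>m. lev m (\<lambda>s. W s \<omega>) t)"
    "0 \<le> t \<Longrightarrow> (\<lambda>n. \<Sum>m\<le>n. lev m (\<lambda>s. W s \<omega>) t) \<longlonglongrightarrow> (\<Sum>m. lev m (\<lambda>s. W s \<omega>) t)"
    if \<omega>: "\<omega> \<in> space M - N" for \<omega> t
  proof -
    have c: "continuous_on {0..} (\<lambda>t. W t \<omega>)" and "\<forall>\<^sub>F m in sequentially. \<omega> \<in> space M - bad (Suc m)"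
      using \<omega> NG by auto
    then obtain m0 where m0: "\<And>m. m0 \<le> m \<Longrightarrow> \<omega> \<notin> bad (Suc m)"
      by (auto simp: eventually_sequentially)
    have "norm (grid m (\<lambda>s. W s \<omega>) k) < (3/4) ^ m" if "Suc m0 \<le> m" "k \<le> m * 2 ^ L m" for m k
    proof -
      have "\<omega> \<notin> bad m" using m0[of "m - 1"] that(1) by simp
      then show ?thesis using that(2) \<omega> unfolding bad_def by force
    qed
    from path_series[OF c this]
    show "continuous_on {0..} (\<lambda>t. \<Sum>m. lev m (\<lambda>s. W s \<omega>) t)"
      "0 \<le> t \<Longrightarrow> (\<lambda>n. \<Sum>m\<le>n. lev m (\<lambda>s. W s \<omega>) t) \<longlonglongrightarrow> (\<Sum>m. lev m (\<lambda>s. W s \<omega>) t)"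
      by auto
  qed
  define Y where "Y t \<omega> = (if \<omega> \<in> N then 0 else \<Sum>m. lev m (\<lambda>s. W s \<omega>) t)" for t \<omega>
  have "Y t \<in> borel_measurable M" if "0 \<le> t" for t
    unfolding Y_def
    by (intro measurable_If_set borel_measurable_suminf elementary_measurable[OF lev_elementary[OF that]])
      (use N(2) in auto)
  moreover have "continuous_on {0..} (\<lambda>t. Y t \<omega>)" if "\<omega> \<in> space M" for \<omega>
    using G(1)[of \<omega>] that by (cases "\<omega> \<in> N") (simp_all add: Y_def)
  moreover have "AE \<omega> in M. (\<lambda>n. \<Sum>m\<le>n. lev m (\<lambda>s. W s \<omega>) t) \<longlonglongrightarrow> Y t \<omega>" if t: "0 \<le> t" for t
  proof -
    have "AE \<omega> in M. \<omega> \<notin> N" by (rule AE_not_in) (use N in \<open>auto simp: null_sets_def\<close>)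
    then show ?thesis using AE_space
    proof eventually_elim
      case (elim \<omega>)
      then show ?case using G(2)[of \<omega> t] t by (simp add: Y_def)
    qed
  qed
  ultimately show ?thesis by blast
qed

text \<open>The isometry bounds the distance of the partial sum \<open>n\<close> from every later
  one in terms of the oscillation at level \<open>n\<close>; Fatou's lemma carries the bound to the
  almost sure limit.\<close>

lemma partial_L2_bound:
  assumes t: "0 \<le> t" "t \<le> real n + 1" and Ym: "Y \<in> borel_measurable M"
    and Y: "AE \<omega> in M. (\<lambda>n. \<Sum>m\<le>n. lev m (\<lambda>s. W s \<omega>) t) \<longlonglongrightarrow> Y \<omega>"
  shows "(\<integral>\<^sup>+\<omega>. ennreal ((norm ((\<Sum>m\<le>n. lev m (\<lambda>s. W s \<omega>) t) - Y \<omega>))\<^sup>2) \<partial>M) \<le> ennreal (t * (2 * (1/2) ^ n)\<^sup>2)"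
proof -
  let ?Z = "\<lambda>n \<omega>. \<Sum>m\<le>n. lev m (\<lambda>s. W s \<omega>) t"
  note el = partial_elementary[OF t(1)]
  have [measurable]: "?Z n \<in> borel_measurable M" for n by (rule elementary_measurable[OF el])
  note [measurable] = Ym
  have bound: "(\<integral>\<^sup>+\<omega>. ennreal ((norm (?Z n \<omega> - ?Z k \<omega>))\<^sup>2) \<partial>M) \<le> ennreal (t * (2 * (1/2) ^ n)\<^sup>2)" if k: "n \<le> k" for k
  proof (rule elementary_norm_sq_le[OF elementary_diff[OF el el] t(1)])
    fix r assume r: "r \<in> {0<..t}"
    have "norm (\<sigma> (real (cell (h n) r) * h n) - \<sigma> r) \<le> (1/2) ^ n"
      by (rule step_close) (use r t in auto)
    moreover have "norm (\<sigma> (real (cell (h k) r) * h k) - \<sigma> r) \<le> (1/2) ^ k"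
      by (rule step_close) (use r t k in auto)
    moreover have "(1/2 :: real) ^ k \<le> (1/2) ^ n" using k by (simp add: power_decreasing)
    ultimately have "norm (\<sigma> (real (cell (h n) r) * h n) - \<sigma> (real (cell (h k) r) * h k)) \<le> 2 * (1/2) ^ n"
      using norm_triangle_ineq4[of "\<sigma> (real (cell (h n) r) * h n) - \<sigma> r" "\<sigma> (real (cell (h k) r) * h k) - \<sigma> r"]
      unfolding diff_diff_eq2 diff_add_cancel by linarith
    then show "norm (indicator {0<..t} r *\<^sub>R \<sigma> (real (cell (h n) r) * h n)
        - indicator {0<..t} r *\<^sub>R \<sigma> (real (cell (h k) r) * h k)) \<le> 2 * (1/2) ^ n"
      using r by simp
  qed auto
  have "(\<integral>\<^sup>+\<omega>. ennreal ((norm (?Z n \<omega> - Y \<omega>))\<^sup>2) \<partial>M)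
    = (\<integral>\<^sup>+\<omega>. liminf (\<lambda>k. ennreal ((norm (?Z n \<omega> - ?Z k \<omega>))\<^sup>2)) \<partial>M)"
  proof (rule nn_integral_cong_AE)
    show "AE \<omega> in M. ennreal ((norm (?Z n \<omega> - Y \<omega>))\<^sup>2) = liminf (\<lambda>k. ennreal ((norm (?Z n \<omega> - ?Z k \<omega>))\<^sup>2))"
      using Y
    proof eventually_elim
      case (elim \<omega>)
      have "(\<lambda>k. ennreal ((norm (?Z n \<omega> - ?Z k \<omega>))\<^sup>2)) \<longlonglongrightarrow> ennreal ((norm (?Z n \<omega> - Y \<omega>))\<^sup>2)"
        by (intro tendsto_intros tendsto_ennrealI elim)
      from lim_imp_Liminf[OF trivial_limit_sequentially this] show ?case ..
    qed
  qed
  also have "\<dots> \<le> liminf (\<lambda>k. \<integral>\<^sup>+\<omega>. ennreal ((norm (?Z n \<omega> - ?Z k \<omega>))\<^sup>2) \<partial>M)"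
    by (rule nn_integral_liminf) measurable
  also have "\<dots> \<le> ennreal (t * (2 * (1/2) ^ n)\<^sup>2)"
    by (intro Liminf_le eventually_sequentiallyI[of n] bound) simp
  finally show ?thesis .
qed

end


lemma modulus_levels:
  fixes g :: "real \<Rightarrow> 'b::metric_space"
  assumes g: "continuous_on {0..} g"
  shows "\<exists>L. mono L \<and> (\<forall>m r r'. 0 \<le> r \<longrightarrow> r \<le> real m + 1 \<longrightarrow> 0 \<le> r' \<longrightarrow> r' \<le> real m + 1 \<longrightarrow>
      \<bar>r - r'\<bar> \<le> (1/2) ^ L m \<longrightarrow> dist (g r) (g r') \<le> (1/2) ^ m)"
proof -
  have "\<exists>l. \<forall>r r'. 0 \<le> r \<longrightarrow> r \<le> real m + 1 \<longrightarrow> 0 \<le> r' \<longrightarrow> r' \<le> real m + 1 \<longrightarrow>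
      \<bar>r - r'\<bar> \<le> (1/2) ^ l \<longrightarrow> dist (g r) (g r') \<le> (1/2) ^ m" for m
  proof -
    have "uniformly_continuous_on {0..real m + 1} g"
      by (intro compact_uniformly_continuous continuous_on_subset[OF g]) auto
    then obtain d where d: "d > 0" "\<And>x y. x \<in> {0..real m + 1} \<Longrightarrow> y \<in> {0..real m + 1} \<Longrightarrow> dist y x < d \<Longrightarrow> dist (g y) (g x) < (1/2) ^ m"
      unfolding uniformly_continuous_on_def by (metis zero_less_power half_gt_zero zero_less_one)
    obtain l where "(1/2) ^ l < d" using real_arch_pow_inv[OF d(1), of "1/2"] by auto
    then show ?thesis using d(2) by (intro exI[of _ l]) (force simp: dist_real_def intro: less_imp_le)
  qed
  then obtain l where l: "\<And>m r r'. 0 \<le> r \<Longrightarrow> r \<le> real m + 1 \<Longrightarrow> 0 \<le> r' \<Longrightarrow> r' \<le> real m + 1 \<Longrightarrow>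
      \<bar>r - r'\<bar> \<le> (1/2) ^ l m \<Longrightarrow> dist (g r) (g r') \<le> (1/2) ^ m"
    by metis
  \<comment> \<open>Summation makes the depths monotone and keeps each at least as large as
    required.\<close>
  define L where "L m = (\<Sum>i\<le>m. l i)" for m
  have "mono L" unfolding L_def by (intro monoI sum_mono2) auto
  moreover have "dist (g r) (g r') \<le> (1/2) ^ m"
    if "0 \<le> r" "r \<le> real m + 1" "0 \<le> r'" "r' \<le> real m + 1" "\<bar>r - r'\<bar> \<le> (1/2) ^ L m" for m r r'
  proof (rule l)
    have "l m \<le> L m" unfolding L_def by (rule member_le_sum) auto
    then have "(1/2 :: real) ^ L m \<le> (1/2) ^ l m" by (simp add: power_decreasing)
    then show "\<bar>r - r'\<bar> \<le> (1/2) ^ l m" using that by linarith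
  qed (use that in auto)
  ultimately show ?thesis by blast
qed

lemma is_stochastic_integral_cong_AE:
  assumes "is_stochastic_integral M W g t Y" and Z: "Z \<in> borel_measurable M" and eq: "AE \<omega> in M. Y \<omega> = Z \<omega>"
  shows "is_stochastic_integral M W g t Z"
proof -
  have "(\<integral>\<^sup>+\<omega>. ennreal ((norm (S \<omega> - Y \<omega>))\<^sup>2) \<partial>M) = (\<integral>\<^sup>+\<omega>. ennreal ((norm (S \<omega> - Z \<omega>))\<^sup>2) \<partial>M)" for S
    by (rule nn_integral_cong_AE) (use eq in eventually_elim, simp)
  with assms show ?thesis by (simp add: is_stochastic_integral_def)
qed

section \<open>Riemann sums: existence, uniqueness and increments of the Wiener integral\<close>

context brownian
begin

definition riemann :: "(real \<Rightarrow> real^'n) \<Rightarrow> real \<Rightarrow> nat \<Rightarrow> 'w \<Rightarrow> real^'n" where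
  "riemann g t p \<omega> = (\<Sum>k<p. (W (real (Suc k) * t / real p) \<omega> - W (real k * t / real p) \<omega>) *\<^sub>R g (real k * t / real p))"

lemma is_stochastic_integral_iff:
  "is_stochastic_integral M W g t Y \<longleftrightarrow> Y \<in> borel_measurable M \<and>
    (\<lambda>p. \<integral>\<^sup>+\<omega>. ennreal ((norm (riemann g t p \<omega> - Y \<omega>))\<^sup>2) \<partial>M) \<longlonglongrightarrow> 0"
  by (simp add: is_stochastic_integral_def riemann_def)

lemma riemann_elementary:
  assumes t: "0 \<le> t" and p: "p > 0"
  shows "elementary (riemann g t p) (\<lambda>r. indicator {0<..t} r *\<^sub>R g (real (cell (t / real p) r) * (t / real p)))"
proof (cases "t = 0")
  case True
  then show ?thesis by (simp add: riemann_def[abs_def] elementary.zero)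
next
  case False
  define d where "d = t / real p"
  have d: "d > 0" using t p False by (simp add: d_def)
  have pd: "real p * d = t" using p by (simp add: d_def)
  have eq: "real k * t / real p = min t (real k * d)" if "k \<le> p" for k
  proof -
    have "real k * d \<le> real p * d" using that d by (intro mult_right_mono) auto
    then show ?thesis unfolding pd by (simp add: d_def)
  qed
  have "elementary (riemann g t p)
    (\<lambda>r. \<Sum>k<p. indicator {min t (real k * d)<..min t (real (Suc k) * d)} r *\<^sub>R g (real k * d))"
  proof -
    have "riemann g t p = (\<lambda>\<omega>. \<Sum>k<p. (W (min t (real (Suc k) * d)) \<omega> - W (min t (real k * d)) \<omega>) *\<^sub>R g (real k * d))"
      unfolding riemann_def[abs_def]
    proof (intro ext sum.cong refl)
      fix \<omega> k assume "k \<in> {..<p}"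
      then have k: "k \<le> p" "Suc k \<le> p" by auto
      have "real k * t / real p = real k * d" by (simp add: d_def)
      then show "(W (real (Suc k) * t / real p) \<omega> - W (real k * t / real p) \<omega>) *\<^sub>R g (real k * t / real p)
        = (W (min t (real (Suc k) * d)) \<omega> - W (min t (real k * d)) \<omega>) *\<^sub>R g (real k * d)"
        using eq[OF k(1)] eq[OF k(2)] by simp
    qed
    moreover have "elementary (\<lambda>\<omega>. \<Sum>k<p. (W (min t (real (Suc k) * d)) \<omega> - W (min t (real k * d)) \<omega>) *\<^sub>R g (real k * d))
      (\<lambda>r. \<Sum>k<p. indicator {min t (real k * d)<..min t (real (Suc k) * d)} r *\<^sub>R g (real k * d))"
    proof (intro elementary_sum elementary_increment)
      fix k
      show "0 \<le> min t (real k * d)" using t d by simp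
      show "min t (real k * d) \<le> min t (real (Suc k) * d)"
        using d by (intro min.mono mult_right_mono) auto
    qed
    ultimately show ?thesis by (simp only:)
  qed
  then show ?thesis
    by (simp only: cell_sum[OF d t eq_refl[OF pd[symmetric]]] d_def[symmetric])
qed

lemma riemann_measurable:
  assumes "0 \<le> t"
  shows "riemann g t p \<in> borel_measurable M"
proof (cases "p = 0")
  case False
  then show ?thesis using elementary_measurable[OF riemann_elementary[OF assms]] by blast
qed (simp add: riemann_def[abs_def])

lemma riemann_close:
  assumes g: "continuous_on {0..} g" and t: "0 \<le> t" and e: "e > 0"
  shows "\<forall>\<^sub>F p in sequentially. p > 0 \<and> (\<forall>r\<in>{0<..t}. norm (g (real (cell (t / real p) r) * (t / real p)) - g r) \<le> e)"
proof -
  have "uniformly_continuous_on {0..t} g"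
    by (intro compact_uniformly_continuous continuous_on_subset[OF g]) auto
  then obtain d where d: "d > 0" "\<And>x y. x \<in> {0..t} \<Longrightarrow> y \<in> {0..t} \<Longrightarrow> dist y x < d \<Longrightarrow> dist (g y) (g x) < e"
    using e unfolding uniformly_continuous_on_def by metis
  have "(\<lambda>p. t / real p) \<longlonglongrightarrow> 0" by (rule lim_const_over_n)
  then have "\<forall>\<^sub>F p in sequentially. t / real p < d" using d(1) by (rule order_tendstoD)
  then show ?thesis using eventually_gt_at_top[of 0]
  proof eventually_elim
    case (elim p)
    show ?case
    proof (intro conjI ballI)
      fix r assume r: "r \<in> {0<..t}"
      have q: "t / real p > 0" using r elim by simp
      let ?c = "real (cell (t / real p) r) * (t / real p)"
      have b: "?c < r" "r \<le> ?c + t / real p"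
        using cell_bounds[OF q, of r] r by (auto simp: algebra_simps)
      have "0 \<le> ?c" using q by (intro mult_nonneg_nonneg) auto
      then have "dist (g ?c) (g r) < e" using b r elim by (intro d(2)) (auto simp: dist_real_def)
      then show "norm (g ?c - g r) \<le> e" by (simp add: dist_norm)
    qed (use elim in simp)
  qed
qed

lemma is_stochastic_integral_unique:
  assumes Y: "is_stochastic_integral M W g t Y" and Z: "is_stochastic_integral M W g t Z" and t: "0 \<le> t"
  shows "AE \<omega> in M. Y \<omega> = Z \<omega>"
proof -
  note [measurable] = riemann_measurable[OF t, of g]
  have [measurable]: "Y \<in> borel_measurable M" "Z \<in> borel_measurable M"
    using Y Z by (auto simp: is_stochastic_integral_iff)
  let ?d = "\<lambda>X p. \<integral>\<^sup>+\<omega>. ennreal ((norm (riemann g t p \<omega> - X \<omega>))\<^sup>2) \<partial>M"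
  have lim: "(\<lambda>p. 2 * ?d Y p + 2 * ?d Z p) \<longlonglongrightarrow> 2 * 0 + 2 * 0"
    using Y Z unfolding is_stochastic_integral_iff
    by (intro tendsto_add ennreal_tendsto_cmult) auto
  have "(\<integral>\<^sup>+\<omega>. ennreal ((norm (Y \<omega> - Z \<omega>))\<^sup>2) \<partial>M) \<le> 2 * ?d Y p + 2 * ?d Z p" for p
    using nn_integral_norm_sq_triangle[of Y M "riemann g t p" Z] by (simp add: norm_minus_commute)
  then have "(\<integral>\<^sup>+\<omega>. ennreal ((norm (Y \<omega> - Z \<omega>))\<^sup>2) \<partial>M) \<le> 2 * 0 + 2 * 0"
    by (intro LIMSEQ_le_const[OF lim]) auto
  then have "(\<integral>\<^sup>+\<omega>. ennreal ((norm (Y \<omega> - Z \<omega>))\<^sup>2) \<partial>M) = 0" by simp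
  then have "AE \<omega> in M. ennreal ((norm (Y \<omega> - Z \<omega>))\<^sup>2) = 0"
    by (subst (asm) nn_integral_0_iff_AE) auto
  then show ?thesis by eventually_elim simp
qed

text \<open>The Riemann sums at \<open>s\<close> and \<open>t\<close> use different meshes, so they
  do not cancel on (0,s]; there both integrands are within \<open>e\<close> of \<open>g\<close>, and
  the error disappears as \<open>e\<close> tends to 0. Squared triangle inequalities are used
  throughout, and 8 is the product of their three factors 2.\<close>

lemma stochastic_integral_increment:
  assumes g: "continuous_on {0..} g" and st: "0 \<le> s" "s \<le> t"
    and Y: "is_stochastic_integral M W g s Ys" and Z: "is_stochastic_integral M W g t Yt"
  shows "(\<integral>\<^sup>+\<omega>. ennreal ((norm (Yt \<omega> - Ys \<omega>))\<^sup>2) \<partial>M)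
    \<le> 8 * (\<integral>\<^sup>+r. ennreal ((norm (g r))\<^sup>2) * indicator {s<..t} r \<partial>lborel)"
proof -
  have t: "0 \<le> t" using st by simp
  note [measurable] = riemann_measurable[OF t, of g] riemann_measurable[OF st(1), of g]
  have [measurable]: "Ys \<in> borel_measurable M" "Yt \<in> borel_measurable M"
    using Y Z by (auto simp: is_stochastic_integral_iff)
  have gm[measurable]: "(\<lambda>r. ennreal ((norm (g r))\<^sup>2) * indicator {s<..t} r) \<in> borel_measurable lborel"
  proof -
    have "(\<lambda>r. indicator {s<..t} r *\<^sub>R g r) \<in> borel_measurable borel"
      by (rule borel_measurable_continuous_on_indicator) (use st in \<open>auto intro: continuous_on_subset[OF g]\<close>)
    from measurable_compose[OF this, of "\<lambda>x. ennreal ((norm x)\<^sup>2)" borel]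
    have "(\<lambda>r. ennreal ((norm (indicator {s<..t} r *\<^sub>R g r))\<^sup>2)) \<in> borel_measurable lborel"
      unfolding measurable_lborel2 by simp
    moreover have "(\<lambda>r. ennreal ((norm (indicator {s<..t} r *\<^sub>R g r))\<^sup>2)) = (\<lambda>r. ennreal ((norm (g r))\<^sup>2) * indicator {s<..t} r)"
      by (auto simp: indicator_def)
    ultimately show ?thesis by (simp only:)
  qed
  let ?I = "\<integral>\<^sup>+r. ennreal ((norm (g r))\<^sup>2) * indicator {s<..t} r \<partial>lborel"
  let ?Rt = "riemann g t" and ?Rs = "riemann g s"
  let ?dt = "\<lambda>p. \<integral>\<^sup>+\<omega>. ennreal ((norm (?Rt p \<omega> - Yt \<omega>))\<^sup>2) \<partial>M"
  let ?ds = "\<lambda>p. \<integral>\<^sup>+\<omega>. ennreal ((norm (?Rs p \<omega> - Ys \<omega>))\<^sup>2) \<partial>M"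
  have main: "(\<integral>\<^sup>+\<omega>. ennreal ((norm (Yt \<omega> - Ys \<omega>))\<^sup>2) \<partial>M) \<le> 8 * ?I + 16 * ennreal (t * e\<^sup>2)" if e: "e > 0" for e
  proof -
    have "(\<lambda>p. 2 * ?dt p + (8 * ?I + 16 * ennreal (t * e\<^sup>2) + 4 * ?ds p)) \<longlonglongrightarrow> 2 * 0 + (8 * ?I + 16 * ennreal (t * e\<^sup>2) + 4 * 0)"
      using Y Z unfolding is_stochastic_integral_iff
      by (intro tendsto_add ennreal_tendsto_cmult tendsto_const) auto
    moreover have "\<forall>\<^sub>F p in sequentially. (\<integral>\<^sup>+\<omega>. ennreal ((norm (Yt \<omega> - Ys \<omega>))\<^sup>2) \<partial>M)
        \<le> 2 * ?dt p + (8 * ?I + 16 * ennreal (t * e\<^sup>2) + 4 * ?ds p)"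
      using riemann_close[OF g t e] riemann_close[OF g st(1) e]
    proof eventually_elim
      case (elim p)
      let ?ft = "\<lambda>r. indicator {0<..t} r *\<^sub>R g (real (cell (t / real p) r) * (t / real p))"
      let ?fs = "\<lambda>r. indicator {0<..s} r *\<^sub>R g (real (cell (s / real p) r) * (s / real p))"
      have el: "elementary (\<lambda>\<omega>. ?Rt p \<omega> - ?Rs p \<omega>) (\<lambda>r. ?ft r - ?fs r)"
        by (intro elementary_diff riemann_elementary t st) (use elim in auto)
      have "(\<integral>\<^sup>+\<omega>. ennreal ((norm (?Rt p \<omega> - ?Rs p \<omega>))\<^sup>2) \<partial>M)
        \<le> (\<integral>\<^sup>+r. 2 * (ennreal ((norm (g r))\<^sup>2) * indicator {s<..t} r) + ennreal (4 * e\<^sup>2) * indicator {0<..t} r \<partial>lborel)"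
        unfolding elementary_isometry_nn[OF el]
      proof (rule nn_integral_mono)
        fix r
        consider "r \<notin> {0<..t}" | "r \<in> {0<..s}" | "r \<in> {s<..t}" by force
        then show "ennreal ((norm (?ft r - ?fs r))\<^sup>2)
          \<le> 2 * (ennreal ((norm (g r))\<^sup>2) * indicator {s<..t} r) + ennreal (4 * e\<^sup>2) * indicator {0<..t} r"
        proof cases
          case 1
          then show ?thesis using st by (auto simp: indicator_def)
        next
          case 2
          then have r: "r \<in> {0<..t}" "r \<notin> {s<..t}" using st by auto
          have "norm (?ft r - g r) \<le> e" "norm (?fs r - g r) \<le> e" using elim 2 r by auto
          then have "norm (?ft r - ?fs r) \<le> 2 * e"
            using norm_triangle_ineq4[of "?ft r - g r" "?fs r - g r"] unfolding diff_diff_eq2 diff_add_cancel by linarith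
          then have "(norm (?ft r - ?fs r))\<^sup>2 \<le> (2 * e)\<^sup>2" by (intro power_mono) auto
          then have "ennreal ((norm (?ft r - ?fs r))\<^sup>2) \<le> ennreal (4 * e\<^sup>2)"
            by (intro ennreal_leI) (simp add: power_mult_distrib)
          then show ?thesis using r by (simp only: indicator_simps) simp
        next
          case 3
          then have r: "r \<in> {0<..t}" "r \<notin> {0<..s}" using st by auto
          have "norm (?ft r - g r) \<le> e" using elim r by auto
          then have "norm (?ft r) \<le> norm (g r) + e"
            using norm_triangle_sub[of "?ft r" "g r"] by linarith
          then have "(norm (?ft r))\<^sup>2 \<le> (norm (g r) + e)\<^sup>2" by (intro power_mono) auto
          also have "\<dots> \<le> 2 * (norm (g r))\<^sup>2 + 4 * e\<^sup>2"
            using sum_squares_bound[of "norm (g r)" e] zero_le_power2[of e] unfolding power2_sum by linarith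
          finally have "ennreal ((norm (?ft r))\<^sup>2) \<le> ennreal (2 * (norm (g r))\<^sup>2 + 4 * e\<^sup>2)" by (rule ennreal_leI)
          also have "\<dots> = 2 * ennreal ((norm (g r))\<^sup>2) + ennreal (4 * e\<^sup>2)"
            by (simp add: ennreal_plus ennreal_mult)
          finally have "ennreal ((norm (?ft r))\<^sup>2) \<le> 2 * ennreal ((norm (g r))\<^sup>2) + ennreal (4 * e\<^sup>2)" .
          moreover have "?fs r = 0" using r by simp
          ultimately show ?thesis using 3 r by (simp only: indicator_simps) simp
        qed
      qed
      also have "\<dots> = 2 * ?I + 4 * ennreal (t * e\<^sup>2)"
      proof -
        have "(\<integral>\<^sup>+r. 2 * (ennreal ((norm (g r))\<^sup>2) * indicator {s<..t} r) + ennreal (4 * e\<^sup>2) * indicator {0<..t} r \<partial>lborel)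
          = (\<integral>\<^sup>+r. 2 * (ennreal ((norm (g r))\<^sup>2) * indicator {s<..t} r) \<partial>lborel)
            + (\<integral>\<^sup>+r. ennreal (4 * e\<^sup>2) * indicator {0<..t} r \<partial>lborel)"
          by (rule nn_integral_add) (use gm in \<open>auto intro: borel_measurable_times\<close>)
        also have "\<dots> = 2 * ?I + ennreal (4 * e\<^sup>2) * emeasure lborel {0<..t}"
          by (simp only: nn_integral_cmult[OF gm] nn_integral_cmult_indicator sets_lborel greaterThanAtMost_borel)
        also have "ennreal (4 * e\<^sup>2) * emeasure lborel {0<..t} = 4 * ennreal (t * e\<^sup>2)"
          using t by (simp add: ennreal_mult mult_ac)
        finally show ?thesis .
      qed
      finally have 1: "(\<integral>\<^sup>+\<omega>. ennreal ((norm (?Rt p \<omega> - ?Rs p \<omega>))\<^sup>2) \<partial>M) \<le> 2 * ?I + 4 * ennreal (t * e\<^sup>2)" .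
      have "(\<integral>\<^sup>+\<omega>. ennreal ((norm (Yt \<omega> - Ys \<omega>))\<^sup>2) \<partial>M)
        \<le> 2 * ?dt p + 2 * (\<integral>\<^sup>+\<omega>. ennreal ((norm (?Rt p \<omega> - Ys \<omega>))\<^sup>2) \<partial>M)"
        using nn_integral_norm_sq_triangle[of Yt M "?Rt p" Ys] by (simp add: norm_minus_commute)
      also have "(\<integral>\<^sup>+\<omega>. ennreal ((norm (?Rt p \<omega> - Ys \<omega>))\<^sup>2) \<partial>M)
        \<le> 2 * (2 * ?I + 4 * ennreal (t * e\<^sup>2)) + 2 * ?ds p"
      proof (rule order_trans[OF nn_integral_norm_sq_triangle[where Y = "?Rs p"]])
        show "2 * (\<integral>\<^sup>+\<omega>. ennreal ((norm (?Rt p \<omega> - ?Rs p \<omega>))\<^sup>2) \<partial>M) + 2 * ?ds p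
          \<le> 2 * (2 * ?I + 4 * ennreal (t * e\<^sup>2)) + 2 * ?ds p"
          by (intro add_mono mult_left_mono 1) auto
      qed measurable
      finally show ?case
        by (simp add: distrib_left mult.assoc[symmetric] mult_left_mono add_mono)
    qed
    ultimately show ?thesis
      by (intro tendsto_lowerbound[where F = sequentially]) auto
  qed
  have "(\<lambda>n. 8 * ?I + 16 * ennreal (t * (1 / real (Suc n))\<^sup>2)) \<longlonglongrightarrow> 8 * ?I + 16 * ennreal (t * 0\<^sup>2)"
    by (intro tendsto_add tendsto_const ennreal_tendsto_cmult tendsto_ennrealI tendsto_mult tendsto_power LIMSEQ_Suc lim_const_over_n) auto
  then have "(\<integral>\<^sup>+\<omega>. ennreal ((norm (Yt \<omega> - Ys \<omega>))\<^sup>2) \<partial>M) \<le> 8 * ?I + 16 * ennreal (t * 0\<^sup>2)"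
    by (rule LIMSEQ_le_const) (use main in auto)
  then show ?thesis by simp
qed

text \<open>The points of the Riemann sums are in general not dyadic. But Riemann sums and partial
  sums of levels are both step integrals with integrands within 2^-n of \<open>g\<close>, so the
  isometry compares them, and the partial sums are close to the continuous version in mean
  square.\<close>

lemma stochastic_integral_exists:
  fixes g :: "real \<Rightarrow> real^'n"
  assumes g: "continuous_on {0..} g"
  shows "\<exists>Y. (\<forall>t\<ge>0. Y t \<in> borel_measurable M) \<and> (\<forall>\<omega>\<in>space M. continuous_on {0..} (\<lambda>t. Y t \<omega>)) \<and>
    (\<forall>t\<ge>0. is_stochastic_integral M W g t (Y t))"
proof -
  obtain L where "mono L" and "\<And>m r r'. 0 \<le> r \<Longrightarrow> r \<le> real m + 1 \<Longrightarrow> 0 \<le> r' \<Longrightarrow> r' \<le> real m + 1 \<Longrightarrow>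
      \<bar>r - r'\<bar> \<le> (1/2) ^ L m \<Longrightarrow> dist (g r) (g r') \<le> (1/2) ^ m"
    using modulus_levels[OF g] by blast
  then interpret mesh: dyadic_mesh M W g L
    by unfold_locales (auto simp: dist_norm)
  obtain Y where Ym: "\<And>t. 0 \<le> t \<Longrightarrow> Y t \<in> borel_measurable M"
    and Yc: "\<forall>\<omega>\<in>space M. continuous_on {0..} (\<lambda>t. Y t \<omega>)"
    and Yl: "\<And>t. 0 \<le> t \<Longrightarrow> AE \<omega> in M. (\<lambda>n. \<Sum>m\<le>n. mesh.lev m (\<lambda>s. W s \<omega>) t) \<longlonglongrightarrow> Y t \<omega>"
    using mesh.continuous_version by blast
  have "is_stochastic_integral M W g t (Y t)" if t: "0 \<le> t" for t
    unfolding is_stochastic_integral_iff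
  proof (intro conjI Ym[OF t] tendsto_zero_ennreal)
    fix e :: real assume e: "0 < e"
    let ?Z = "\<lambda>n \<omega>. \<Sum>m\<le>n. mesh.lev m (\<lambda>s. W s \<omega>) t"
    note el = mesh.partial_elementary[OF t]
    have [measurable]: "?Z n \<in> borel_measurable M" "Y t \<in> borel_measurable M" "riemann g t n \<in> borel_measurable M" for n
      using elementary_measurable[OF el] Ym[OF t] riemann_measurable[OF t] by auto
    \<comment> \<open>The comparison passes through the partial sum \<open>?Z n\<close>; each of its
      two legs costs 2 t (2 2^-n)^2.\<close>
    have "(\<lambda>n. 16 * t * ((1/2) ^ n)\<^sup>2) \<longlonglongrightarrow> 16 * t * 0\<^sup>2"
      by (intro tendsto_intros LIMSEQ_power_zero) auto
    then have "\<forall>\<^sub>F n in sequentially. 16 * t * ((1/2) ^ n)\<^sup>2 < e" using e by (intro order_tendstoD) auto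
    moreover have "\<forall>\<^sub>F n in sequentially. t \<le> real n" 
      using eventually_ge_at_top[of "nat \<lceil>t\<rceil>"] by eventually_elim linarith
    ultimately obtain n where n: "16 * t * ((1/2) ^ n)\<^sup>2 < e" "t \<le> real n + 1"
      using eventually_conj[THEN eventually_happens] by (metis (no_types, lifting) add_increasing2 trivial_limit_sequentially zero_le_one eventually_conj eventually_happens)
    have Z: "(\<integral>\<^sup>+\<omega>. ennreal ((norm (?Z n \<omega> - Y t \<omega>))\<^sup>2) \<partial>M) \<le> ennreal (t * (2 * (1/2) ^ n)\<^sup>2)"
      by (rule mesh.partial_L2_bound[OF t n(2) Ym[OF t] Yl[OF t]])
    have pos: "0 < (1/2 :: real) ^ n" by simp
    show "\<forall>\<^sub>F p in sequentially. (\<integral>\<^sup>+\<omega>. ennreal ((norm (riemann g t p \<omega> - Y t \<omega>))\<^sup>2) \<partial>M) < ennreal e"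
      using riemann_close[OF g t pos]
    proof eventually_elim
      case (elim p)
      have R: "(\<integral>\<^sup>+\<omega>. ennreal ((norm (riemann g t p \<omega> - ?Z n \<omega>))\<^sup>2) \<partial>M) \<le> ennreal (t * (2 * (1/2) ^ n)\<^sup>2)"
      proof (rule elementary_norm_sq_le[OF elementary_diff[OF riemann_elementary el] t])
        fix r assume r: "r \<in> {0<..t}"
        let ?u = "g (real (cell (t / real p) r) * (t / real p))" and ?v = "g (real (cell (mesh.h n) r) * mesh.h n)"
        have "norm (?u - g r) \<le> (1/2) ^ n" using elim r by auto
        moreover have "norm (?v - g r) \<le> (1/2) ^ n" by (rule mesh.step_close) (use r n in auto)
        ultimately have "norm (?u - ?v) \<le> 2 * (1/2) ^ n"
          using norm_triangle_ineq4[of "?u - g r" "?v - g r"] unfolding diff_diff_eq2 diff_add_cancel by linarith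
        then show "norm (indicator {0<..t} r *\<^sub>R ?u - indicator {0<..t} r *\<^sub>R ?v) \<le> 2 * (1/2) ^ n"
          using r by simp
      qed (use elim t in auto)
      have "(\<integral>\<^sup>+\<omega>. ennreal ((norm (riemann g t p \<omega> - Y t \<omega>))\<^sup>2) \<partial>M)
        \<le> 2 * ennreal (t * (2 * (1/2) ^ n)\<^sup>2) + 2 * ennreal (t * (2 * (1/2) ^ n)\<^sup>2)"
      proof (rule order_trans[OF nn_integral_norm_sq_triangle[where Y = "?Z n"]])
        show "2 * (\<integral>\<^sup>+\<omega>. ennreal ((norm (riemann g t p \<omega> - ?Z n \<omega>))\<^sup>2) \<partial>M)
          + 2 * (\<integral>\<^sup>+\<omega>. ennreal ((norm (?Z n \<omega> - Y t \<omega>))\<^sup>2) \<partial>M)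
          \<le> 2 * ennreal (t * (2 * (1/2) ^ n)\<^sup>2) + 2 * ennreal (t * (2 * (1/2) ^ n)\<^sup>2)"
          by (intro add_mono mult_left_mono R Z) auto
      qed measurable
      also have "\<dots> = ennreal (2 * (t * (2 * (1/2) ^ n)\<^sup>2) + 2 * (t * (2 * (1/2) ^ n)\<^sup>2))"
      proof -
        have q: "0 \<le> 2 * (t * (2 * (1/2) ^ n)\<^sup>2)" using t by simp
        have "2 * ennreal (t * (2 * (1/2) ^ n)\<^sup>2) = ennreal (2 * (t * (2 * (1/2) ^ n)\<^sup>2))"
          using t by (subst ennreal_mult) auto
        then show ?thesis by (simp only: ennreal_plus[OF q q])
      qed
      also have "\<dots> = ennreal (16 * t * ((1/2) ^ n)\<^sup>2)" by (simp add: power_mult_distrib mult.assoc)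
      also have "\<dots> < ennreal e" using n(1) e by (simp add: ennreal_lessI)
      finally show ?case .
    qed
  qed
  then show ?thesis using Ym Yc by blast
qed

end

section \<open>Linear equations driven by a Wiener integral\<close>

text \<open>Every path is continuous, not merely almost every one. This matches the notion of a
  trajectory and makes pathwise constructions measurable without completing
  \<open>M\<close>.\<close>

definition cont_process :: "'w measure \<Rightarrow> (real \<Rightarrow> 'w \<Rightarrow> 'b::euclidean_space) \<Rightarrow> bool" where
  "cont_process M f \<longleftrightarrow> (\<forall>t\<ge>0. f t \<in> borel_measurable M) \<and> (\<forall>\<omega>\<in>space M. continuous_on {0..} (\<lambda>t. f t \<omega>))"

text \<open>The largest multiple of 1 / (n + 1) not exceeding \<open>t\<close>, for nonnegative
  \<open>t\<close>. Its values are countably many, which reduces statements about all times to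
  countably many times.\<close>

definition grid_floor :: "nat \<Rightarrow> real \<Rightarrow> real" where
  "grid_floor n t = real (nat \<lfloor>t * real (Suc n)\<rfloor>) / real (Suc n)"

lemma grid_floor_tendsto:
  assumes "0 \<le> t"
  shows "(\<lambda>n. grid_floor n t) \<longlonglongrightarrow> t"
proof (rule LIM_zero_cancel, rule Lim_null_comparison[OF _ LIMSEQ_inverse_real_of_nat], rule always_eventually, rule allI)
  fix n
  have "0 \<le> t * real (Suc n)" using assms by simp
  then have "real (nat \<lfloor>t * real (Suc n)\<rfloor>) \<le> t * real (Suc n)" "t * real (Suc n) < real (nat \<lfloor>t * real (Suc n)\<rfloor>) + 1"
    by linarith+
  then have "grid_floor n t \<le> t" "t \<le> grid_floor n t + inverse (real (Suc n))"
    unfolding grid_floor_def by (simp_all add: divide_simps del: of_nat_Suc)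
  then show "norm (grid_floor n t - t) \<le> inverse (real (Suc n))" by simp
qed

lemma continuous_grid_floor_tendsto:
  assumes f: "continuous_on {0..} f" and t: "0 \<le> t"
  shows "(\<lambda>n. f (grid_floor n t)) \<longlonglongrightarrow> f t"
  by (rule continuous_on_tendsto_compose[OF f grid_floor_tendsto[OF t]])
    (use t in \<open>auto simp: grid_floor_def\<close>)

text \<open>Rounding time down to a grid glues countably many random variables along measurable
  pieces, and path continuity identifies the limit. The argument \<open>max 0 t\<close> extends the
  process to negative times, where it is arbitrary.\<close>

lemma cont_process_joint:
  assumes f: "cont_process M f"
  shows "(\<lambda>(t, \<omega>). f (max 0 t) \<omega>) \<in> borel_measurable (borel \<Otimes>\<^sub>M M)"
proof (rule borel_measurable_LIMSEQ_metric)
  fix n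
  show "(\<lambda>(t, \<omega>). f (grid_floor n (max 0 t)) \<omega>) \<in> borel_measurable (borel \<Otimes>\<^sub>M M)"
  proof -
    have "(\<lambda>z. f (real k / real (Suc n)) (snd z)) \<in> borel_measurable (borel \<Otimes>\<^sub>M M)" for k :: nat
      by (rule measurable_compose[OF measurable_snd]) (use f in \<open>auto simp: cont_process_def\<close>)
    moreover have "(\<lambda>z. nat \<lfloor>max 0 (fst z) * real (Suc n)\<rfloor>) \<in> measurable (borel \<Otimes>\<^sub>M M) (count_space UNIV)"
      by measurable
    ultimately show ?thesis
      unfolding grid_floor_def case_prod_beta by (rule measurable_compose_countable)
  qed
next
  fix z :: "real \<times> 'a" assume "z \<in> space (borel \<Otimes>\<^sub>M M)"
  then have "continuous_on {0..} (\<lambda>t. f t (snd z))"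
    using f by (auto simp: cont_process_def space_pair_measure)
  from continuous_grid_floor_tendsto[OF this, of "max 0 (fst z)"]
  show "(\<lambda>n. case z of (t, \<omega>) \<Rightarrow> f (grid_floor n (max 0 t)) \<omega>) \<longlonglongrightarrow> (case z of (t, \<omega>) \<Rightarrow> f (max 0 t) \<omega>)"
    by (simp add: case_prod_beta)
qed

lemma continuous_integral_halfline:
  fixes g :: "real \<Rightarrow> 'b::euclidean_space"
  assumes "continuous_on {0..} g"
  shows "continuous_on {0..} (\<lambda>t. integral {0..t} g)"
  by (intro continuous_on_halfline indefinite_integral_continuous_1 integrable_continuous_real
      continuous_on_subset[OF assms]) auto

text \<open>Along a continuous path the gauge integral is a Lebesgue integral, and joint
  measurability makes the latter measurable in \<omega>.\<close>

lemma cont_process_integral: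
  fixes f :: "real \<Rightarrow> 'w \<Rightarrow> 'b::euclidean_space"
  assumes f: "cont_process M f"
  shows "cont_process M (\<lambda>t \<omega>. integral {0..t} (\<lambda>s. f s \<omega>))"
  unfolding cont_process_def
proof (intro conjI ballI allI impI)
  fix \<omega> assume "\<omega> \<in> space M"
  then show "continuous_on {0..} (\<lambda>t. integral {0..t} (\<lambda>s. f s \<omega>))"
    using f by (intro continuous_integral_halfline) (auto simp: cont_process_def)
next
  fix t :: real assume t: "0 \<le> t"
  have j: "(\<lambda>z. f (max 0 (snd z)) (fst z)) \<in> borel_measurable (M \<Otimes>\<^sub>M lborel)"
  proof -
    have e: "measurable (M \<Otimes>\<^sub>M lborel) borel = measurable (M \<Otimes>\<^sub>M (borel :: real measure)) (borel :: 'b measure)"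
      by (intro measurable_cong_sets sets_pair_measure_cong) auto
    show ?thesis
      unfolding e using measurable_compose[OF measurable_pair_swap' cont_process_joint[OF f]]
      by (simp add: case_prod_beta)
  qed
  have "(\<lambda>(\<omega>, s). indicator {0..t} s *\<^sub>R f (max 0 s) \<omega>) \<in> borel_measurable (M \<Otimes>\<^sub>M lborel)"
    unfolding case_prod_beta by (rule borel_measurable_scaleR[OF _ j]) measurable
  then have "(\<lambda>\<omega>. \<integral>s. indicator {0..t} s *\<^sub>R f (max 0 s) \<omega> \<partial>lborel) \<in> borel_measurable M"
    by (rule lborel.borel_measurable_lebesgue_integral)
  moreover have "(\<integral>s. indicator {0..t} s *\<^sub>R f (max 0 s) \<omega> \<partial>lborel) = integral {0..t} (\<lambda>s. f s \<omega>)"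
    if "\<omega> \<in> space M" for \<omega>
  proof -
    have "continuous_on {0..t} (\<lambda>s. f s \<omega>)"
      using f that by (auto simp: cont_process_def intro: continuous_on_subset)
    from set_borel_integral_eq_integral(2)[OF borel_integrable_atLeastAtMost'[OF this]]
    have "(\<integral>s. indicator {0..t} s *\<^sub>R f s \<omega> \<partial>lborel) = integral {0..t} (\<lambda>s. f s \<omega>)"
      by (simp add: set_lebesgue_integral_def)
    moreover have "indicator {0..t} s *\<^sub>R f (max 0 s) \<omega> = indicator {0..t} s *\<^sub>R f s \<omega>" for s
      by (auto simp: indicator_def max_def)
    ultimately show ?thesis by (simp only:)
  qed
  ultimately show "(\<lambda>\<omega>. integral {0..t} (\<lambda>s. f s \<omega>)) \<in> borel_measurable M"
    by (simp cong: measurable_cong)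
qed

lemma cont_process_add:
  "cont_process M f \<Longrightarrow> cont_process M g \<Longrightarrow> cont_process M (\<lambda>t \<omega>. f t \<omega> + g t \<omega>)"
  by (auto simp: cont_process_def intro: continuous_on_add borel_measurable_add)

lemma cont_process_diff:
  "cont_process M f \<Longrightarrow> cont_process M g \<Longrightarrow> cont_process M (\<lambda>t \<omega>. f t \<omega> - g t \<omega>)"
  by (auto simp: cont_process_def intro: continuous_on_diff borel_measurable_diff)

lemma cont_process_matrix:
  fixes A :: "real^'n^'m"
  assumes "cont_process M f"
  shows "cont_process M (\<lambda>t \<omega>. A *v f t \<omega>)"
  using assms unfolding cont_process_def
  by (auto intro: bounded_linear.continuous_on[OF matrix_vector_mul_bounded_linear]
      measurable_compose[OF _ borel_measurable_continuous_onI[OF linear_continuous_on[OF matrix_vector_mul_bounded_linear]]])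

lemma cont_process_det: "continuous_on {0..} g \<Longrightarrow> cont_process M (\<lambda>t \<omega>. g t)"
  by (simp add: cont_process_def)

lemma cont_process_rv: "X \<in> borel_measurable M \<Longrightarrow> cont_process M (\<lambda>t. X)"
  by (simp add: cont_process_def)

text \<open>The Picard series; the weight \<open>exp (2 K t)\<close> makes it geometric.\<close>

fun picard :: "real^'n^'n \<Rightarrow> (real \<Rightarrow> real^'n) \<Rightarrow> nat \<Rightarrow> real \<Rightarrow> real^'n" where
  "picard A b 0 t = b t"
| "picard A b (Suc k) t = integral {0..t} (\<lambda>s. A *v picard A b k s)"

lemma picard_continuous:
  assumes "continuous_on {0..} b"
  shows "continuous_on {0..} (picard A b k)"
proof (induction k)
  case 0
  then show ?case using assms by (simp cong: continuous_on_cong)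
next
  case (Suc k)
  then show ?case unfolding picard.simps
    by (intro continuous_integral_halfline bounded_linear.continuous_on[OF matrix_vector_mul_bounded_linear])
qed

lemma picard_bound:
  assumes b: "continuous_on {0..} b" and K: "K > 0" "\<And>v. norm (A *v v) \<le> norm v * K"
    and D: "\<And>t. t \<in> {0..T} \<Longrightarrow> norm (b t) \<le> D" and t: "t \<in> {0..T}"
  shows "norm (picard A b k t) \<le> D * (1/2) ^ k * exp (2 * K * t)"
  using t
proof (induction k arbitrary: t)
  case 0
  have "norm (b t) \<le> D" "0 \<le> D" using D[OF 0] norm_ge_zero[of "b t"] by linarith+
  moreover have "1 \<le> exp (2 * K * t)" using 0 K by simp
  ultimately show ?case using mult_left_mono[of 1 "exp (2 * K * t)" D] by simp
next
  case (Suc k)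
  have D0: "0 \<le> D" using D[OF Suc.prems] norm_ge_zero[of "b t"] by linarith
  have c: "continuous_on {0..t} (\<lambda>s. A *v picard A b k s)"
    by (intro bounded_linear.continuous_on[OF matrix_vector_mul_bounded_linear]
        continuous_on_subset[OF picard_continuous[OF b]]) auto
  \<comment> \<open>One application of \<open>A\<close> costs a factor \<open>K\<close>, integrating
    the weight returns 1 / (2 K): each iterate gains 1/2.\<close>
  have "((\<lambda>s. D * (1/2) ^ Suc k * (2 * K * exp (2 * K * s))) has_integral
      D * (1/2) ^ Suc k * exp (2 * K * t) - D * (1/2) ^ Suc k * exp (2 * K * 0)) {0..t}"
    using Suc.prems
    by (intro fundamental_theorem_of_calculus)
      (auto intro!: derivative_eq_intros simp: has_real_derivative_iff_has_vector_derivative[symmetric])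
  note I = this
  have "norm (integral {0..t} (\<lambda>s. A *v picard A b k s)) \<le> integral {0..t} (\<lambda>s. D * (1/2) ^ Suc k * (2 * K * exp (2 * K * s)))"
  proof (rule integral_norm_bound_integral[OF integrable_continuous_real[OF c]])
    show "(\<lambda>s. D * (1/2) ^ Suc k * (2 * K * exp (2 * K * s))) integrable_on {0..t}" using I by blast
    fix s assume s: "s \<in> {0..t}"
    have "norm (A *v picard A b k s) \<le> norm (picard A b k s) * K" by (rule K)
    also have "\<dots> \<le> (D * (1/2) ^ k * exp (2 * K * s)) * K"
      using Suc.IH[of s] s Suc.prems K by (intro mult_right_mono) auto
    finally show "norm (A *v picard A b k s) \<le> D * (1/2) ^ Suc k * (2 * K * exp (2 * K * s))"
      by (simp add: mult_ac)
  qed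
  also have "\<dots> = D * (1/2) ^ Suc k * exp (2 * K * t) - D * (1/2) ^ Suc k"
    by (simp only: integral_unique[OF I] mult_zero_right exp_zero mult_1_right)
  also have "\<dots> \<le> D * (1/2) ^ Suc k * exp (2 * K * t)" using D0 by simp
  finally show ?case by simp
qed

lemma picard_series:
  fixes A :: "real^'n^'n" and b :: "real \<Rightarrow> real^'n"
  assumes b: "continuous_on {0..} b"
  defines "x \<equiv> \<lambda>t. \<Sum>k. picard A b k t"
  shows "continuous_on {0..} x" "0 \<le> t \<Longrightarrow> x t = b t + integral {0..t} (\<lambda>s. A *v x s)"
proof -
  obtain K where K: "K > 0" "\<And>v. norm (A *v v) \<le> norm v * K"
    using bounded_linear.pos_bounded[OF matrix_vector_mul_bounded_linear[of A]] by blast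
  have pc: "continuous_on S (picard A b k)" if "S \<subseteq> {0..}" for k S
    using picard_continuous[OF b] continuous_on_subset that by blast
  have U: "uniform_limit {0..T} (\<lambda>n t. \<Sum>k<n. picard A b k t) x sequentially" for T
  proof -
    have "bounded (b ` {0..T})"
      by (intro compact_imp_bounded compact_continuous_image continuous_on_subset[OF b]) auto
    then obtain D where D: "\<And>t. t \<in> {0..T} \<Longrightarrow> norm (b t) \<le> D" by (fastforce simp: bounded_iff)
    show ?thesis
      unfolding x_def
    proof (rule Weierstrass_m_test)
      fix n t assume t: "t \<in> {0..T}"
      have "0 \<le> D" using D[OF t] norm_ge_zero[of "b t"] by linarith
      then have "D * (1/2) ^ n * exp (2 * K * t) \<le> D * (1/2) ^ n * exp (2 * K * T)"
        using t K by (intro mult_left_mono) auto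
      then show "norm (picard A b n t) \<le> D * (1/2) ^ n * exp (2 * K * T)"
        using picard_bound[OF b K D t, of n] by linarith
    qed (intro summable_mult2 summable_mult summable_geometric, simp)
  qed
  show xc: "continuous_on {0..} x"
    by (intro continuous_on_halfline uniform_limit_theorem[OF _ U] always_eventually allI continuous_on_sum pc) auto
  assume t: "0 \<le> t"
  have U': "uniform_limit {0..t} (\<lambda>n s. A *v (\<Sum>k<n. picard A b k s)) (\<lambda>s. A *v x s) sequentially"
    by (rule bounded_linear.uniform_limit[OF matrix_vector_mul_bounded_linear U])
  obtain I J where IJ: "\<And>n. ((\<lambda>s. A *v (\<Sum>k<n. picard A b k s)) has_integral I n) {0..t}"
    "((\<lambda>s. A *v x s) has_integral J) {0..t}" "I \<longlonglongrightarrow> J"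
    using uniform_limit_integral[OF U' bounded_linear.continuous_on[OF matrix_vector_mul_bounded_linear continuous_on_sum[OF pc]]]
    by (metis atLeastAtMost_iff atLeast_iff subsetI trivial_limit_sequentially)
  have step: "(\<Sum>k<Suc n. picard A b k t) = b t + I n" for n
  proof -
    have "I n = integral {0..t} (\<lambda>s. \<Sum>k<n. A *v picard A b k s)"
      using IJ(1)[of n] by (simp add: linear_sum[OF matrix_vector_mul_linear] integral_unique[symmetric])
    also have "\<dots> = (\<Sum>k<n. picard A b (Suc k) t)"
      unfolding picard.simps
      by (intro integral_sum integrable_continuous_real bounded_linear.continuous_on[OF matrix_vector_mul_bounded_linear] pc) auto
    finally show ?thesis by (simp only: sum.lessThan_Suc_shift picard.simps(1))
  qed
  have "(\<lambda>n. \<Sum>k<Suc n. picard A b k t) \<longlonglongrightarrow> x t"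
    by (rule LIMSEQ_Suc, rule tendsto_uniform_limitI[OF U[of t]]) (use t in simp)
  moreover have "(\<lambda>n. \<Sum>k<Suc n. picard A b k t) \<longlonglongrightarrow> b t + J"
    unfolding step by (intro tendsto_intros IJ)
  ultimately have "x t = b t + J" by (rule LIMSEQ_unique)
  then show "x t = b t + integral {0..t} (\<lambda>s. A *v x s)" using IJ(2) by (simp add: integral_unique)
qed

text \<open>The iterated integrals are again processes with continuous paths, so measurability at a
  fixed time passes to the sum of the series, while continuity is obtained path by path.\<close>

lemma linear_volterra_process:
  fixes b :: "real \<Rightarrow> 'w \<Rightarrow> real^'n"
  assumes b: "cont_process M b"
  shows "\<exists>x. cont_process M x \<and> (\<forall>\<omega>\<in>space M. \<forall>t\<ge>0. x t \<omega> = b t \<omega> + integral {0..t} (\<lambda>s. A *v x s \<omega>))"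
proof -
  have bc: "continuous_on {0..} (\<lambda>t. b t \<omega>)" if "\<omega> \<in> space M" for \<omega>
    using b that by (simp add: cont_process_def)
  have p: "cont_process M (\<lambda>t \<omega>. picard A (\<lambda>t. b t \<omega>) k t)" for k
    by (induction k) (auto simp: b intro!: cont_process_integral cont_process_matrix)
  define x where "x t \<omega> = (\<Sum>k. picard A (\<lambda>t. b t \<omega>) k t)" for t \<omega>
  have "x t \<in> borel_measurable M" if "0 \<le> t" for t
    unfolding x_def by (rule borel_measurable_suminf) (use p that in \<open>auto simp: cont_process_def\<close>)
  then have "cont_process M x"
    using picard_series(1)[OF bc] by (simp add: cont_process_def x_def)
  moreover have "x t \<omega> = b t \<omega> + integral {0..t} (\<lambda>s. A *v x s \<omega>)" if "\<omega> \<in> space M" "0 \<le> t" for \<omega> t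
    unfolding x_def by (rule picard_series(2)[OF bc[OF that(1)] that(2)])
  ultimately show ?thesis by blast
qed

lemma linear_volterra_zero:
  fixes d :: "real \<Rightarrow> real^'n"
  assumes d: "continuous_on {0..} d" and eq: "\<And>t. 0 \<le> t \<Longrightarrow> d t = integral {0..t} (\<lambda>s. A *v d s)" and t: "0 \<le> t"
  shows "d t = 0"
proof (rule linear_ode_zero[where M = A])
  show "(d has_vector_derivative A *v d r) (at r within {0..})" if r: "0 \<le> r" for r
  proof -
    have "continuous_on {0..r + 1} (\<lambda>s. A *v d s)"
      by (intro bounded_linear.continuous_on[OF matrix_vector_mul_bounded_linear] continuous_on_subset[OF d]) auto
    from integral_has_vector_derivative[OF this, of r]
    have "((\<lambda>u. integral {0..u} (\<lambda>s. A *v d s)) has_vector_derivative A *v d r) (at r within {0..r + 1})"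
      using r by simp
    then have "(d has_vector_derivative A *v d r) (at r within {0..r + 1})"
      by (rule has_vector_derivative_transform[rotated 2]) (use r eq in auto)
    moreover have "at r within {0..r + 1} = at r within {0..}"
      by (rule at_within_nhd[of _ "{..<r + 1}"]) auto
    ultimately show ?thesis by simp
  qed
  show "d 0 = 0" using eq[of 0] by simp
qed (rule t)

text \<open>Continuous paths that agree at the nonnegative rationals agree, and only countably many
  null sets are involved.\<close>

lemma AE_eq_all_times:
  fixes f g :: "real \<Rightarrow> 'w \<Rightarrow> 'b::euclidean_space"
  assumes f: "cont_process M f" and g: "cont_process M g"
    and eq: "\<And>t. 0 \<le> t \<Longrightarrow> AE \<omega> in M. f t \<omega> = g t \<omega>"
  shows "AE \<omega> in M. \<forall>t\<ge>0. f t \<omega> = g t \<omega>"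
proof -
  have "AE \<omega> in M. \<forall>k n. f (real k / real (Suc n)) \<omega> = g (real k / real (Suc n)) \<omega>"
    unfolding AE_all_countable by (intro allI eq) simp
  then show ?thesis using AE_space
  proof eventually_elim
    case (elim \<omega>)
    show ?case
    proof (intro allI impI)
      fix t :: real assume t: "0 \<le> t"
      have "(\<lambda>n. f (grid_floor n t) \<omega>) \<longlonglongrightarrow> f t \<omega>" "(\<lambda>n. g (grid_floor n t) \<omega>) \<longlonglongrightarrow> g t \<omega>"
        using f g elim t by (auto simp: cont_process_def intro: continuous_grid_floor_tendsto)
      moreover have "f (grid_floor n t) \<omega> = g (grid_floor n t) \<omega>" for n
        using elim by (simp add: grid_floor_def)
      ultimately show "f t \<omega> = g t \<omega>" by (simp add: LIMSEQ_unique)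
    qed
  qed
qed

section \<open>Affine feedback laws and their trajectories\<close>

definition affine_law :: "real^'n^'r \<Rightarrow> real^'n^'n \<Rightarrow> (real \<Rightarrow> real^'n) \<Rightarrow> ('n::finite, 'r::finite) control_law" where
  "affine_law C P g = (\<lambda>i t x. - (C *v (P *v x i t + g t)))"

lemma affine_law_drift:
  "A *v x i t \<omega> + B *v open_loop_value (affine_law C P g) x i t \<omega>
    = (A - B ** C ** P) *v x i t \<omega> - (B ** C) *v g t"
proof -
  have neg: "B *v (- v) = - (B *v v)" for v
    using matrix_vector_mult_diff_distrib[of B 0 v] by simp
  show ?thesis
    by (simp add: open_loop_value_def affine_law_def neg matrix_vector_right_distrib
      matrix_vector_mult_diff_rdistrib algebra_simps flip: matrix_vector_mul_assoc)
qed

text \<open>The existentially quantified integral in \<open>generates\<close> is determined by the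
  trajectory: up to a null set it is the state minus its initial value minus the integrated drift.
  Along continuous paths the drift is integrable, so the equation says that this residual is a
  Wiener integral of \<sigma>.\<close>

lemma generates_affine:
  fixes x :: "('n::finite, 'w) trajectory"
  defines "drive \<equiv> \<lambda>F f (x :: real \<Rightarrow> 'w \<Rightarrow> real^'n) t \<omega>. x t \<omega> - x 0 \<omega> - integral {0..t} (\<lambda>\<tau>. F *v x \<tau> \<omega> - f \<tau>)"
  assumes g: "continuous_on {0..} g"
  shows "generates M N A B \<sigma> W x0 (affine_law C P g) x \<longleftrightarrow> (\<forall>i\<in>{1..N}. cont_process M (x i) \<and>
    (AE \<omega> in M. x i 0 \<omega> = x0 i \<omega>) \<and>
    (\<forall>t\<ge>0. is_stochastic_integral M (W i) \<sigma> t (drive (A - B ** C ** P) (\<lambda>t. (B ** C) *v g t) (x i) t)))"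
proof -
  let ?F = "A - B ** C ** P" and ?f = "\<lambda>t. (B ** C) *v g t"
  define solves where "solves i \<longleftrightarrow> (\<forall>t\<ge>0. \<exists>Y. is_stochastic_integral M (W i) \<sigma> t Y \<and>
        (AE \<omega> in M.
           (\<lambda>\<tau>. ?F *v x i \<tau> \<omega> - ?f \<tau>) absolutely_integrable_on {0..t} \<and>
           x i t \<omega> = x i 0 \<omega> + integral {0..t} (\<lambda>\<tau>. ?F *v x i \<tau> \<omega> - ?f \<tau>) + Y \<omega>))" for i
  have *: "solves i
    \<longleftrightarrow> (\<forall>t\<ge>0. is_stochastic_integral M (W i) \<sigma> t (drive ?F ?f (x i) t))" if x: "cont_process M (x i)" for i
    unfolding solves_def
  proof (intro all_cong1 imp_cong refl iffI)
    fix t :: real assume t: "0 \<le> t"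
    have f: "continuous_on {0..} ?f"
      by (intro bounded_linear.continuous_on[OF matrix_vector_mul_bounded_linear] g)
    have drift: "cont_process M (\<lambda>\<tau> \<omega>. ?F *v x i \<tau> \<omega> - ?f \<tau>)"
      by (intro cont_process_diff cont_process_matrix x cont_process_det f)
    then have ai: "(\<lambda>\<tau>. ?F *v x i \<tau> \<omega> - ?f \<tau>) absolutely_integrable_on {0..t}" if "\<omega> \<in> space M" for \<omega>
      using that by (intro absolutely_integrable_continuous_real)
        (auto simp: cont_process_def intro: continuous_on_subset)
    have dm: "drive ?F ?f (x i) t \<in> borel_measurable M"
      unfolding drive_def
      using x cont_process_integral[OF drift] t by (intro borel_measurable_diff) (auto simp: cont_process_def)
    {
      assume "\<exists>Y. is_stochastic_integral M (W i) \<sigma> t Y \<and> (AE \<omega> in M.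
           (\<lambda>\<tau>. ?F *v x i \<tau> \<omega> - ?f \<tau>) absolutely_integrable_on {0..t} \<and>
           x i t \<omega> = x i 0 \<omega> + integral {0..t} (\<lambda>\<tau>. ?F *v x i \<tau> \<omega> - ?f \<tau>) + Y \<omega>)"
      then obtain Y where Y: "is_stochastic_integral M (W i) \<sigma> t Y" and "AE \<omega> in M.
           (\<lambda>\<tau>. ?F *v x i \<tau> \<omega> - ?f \<tau>) absolutely_integrable_on {0..t} \<and>
           x i t \<omega> = x i 0 \<omega> + integral {0..t} (\<lambda>\<tau>. ?F *v x i \<tau> \<omega> - ?f \<tau>) + Y \<omega>" by blast
      then have "AE \<omega> in M. Y \<omega> = drive ?F ?f (x i) t \<omega>" by (auto simp: drive_def elim: AE_mp)
      then show "is_stochastic_integral M (W i) \<sigma> t (drive ?F ?f (x i) t)"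
        by (rule is_stochastic_integral_cong_AE[OF Y dm])
    }
    assume "is_stochastic_integral M (W i) \<sigma> t (drive ?F ?f (x i) t)"
    then show "\<exists>Y. is_stochastic_integral M (W i) \<sigma> t Y \<and> (AE \<omega> in M.
           (\<lambda>\<tau>. ?F *v x i \<tau> \<omega> - ?f \<tau>) absolutely_integrable_on {0..t} \<and>
           x i t \<omega> = x i 0 \<omega> + integral {0..t} (\<lambda>\<tau>. ?F *v x i \<tau> \<omega> - ?f \<tau>) + Y \<omega>)"
      using ai by (intro exI[of _ "drive ?F ?f (x i) t"]) (auto simp: drive_def intro!: AE_I2)
  qed
  show ?thesis
  proof -
    have "generates M N A B \<sigma> W x0 (affine_law C P g) x \<longleftrightarrow>
      (\<forall>i\<in>{1..N}. cont_process M (x i) \<and> (AE \<omega> in M. x i 0 \<omega> = x0 i \<omega>) \<and> solves i)"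
      unfolding generates_def affine_law_drift solves_def[symmetric] cont_process_def by blast
    then show ?thesis using * by blast
  qed
qed

text \<open>The noise is additive, so for each \<omega> this is a linear Volterra equation whose
  free term contains the path of the Wiener integral.\<close>

lemma affine_law_trajectory_exists:
  assumes M: "prob_space M" and W: "\<And>i. i \<in> {1..N} \<Longrightarrow> brownian_motion M (W i)"
    and \<sigma>: "continuous_on {0..} \<sigma>" and g: "continuous_on {0..} g"
    and x0: "\<And>i. i \<in> {1..N} \<Longrightarrow> x0 i \<in> borel_measurable M"
  shows "\<exists>x. generates M N A B \<sigma> W x0 (affine_law C P g) x"
proof -
  let ?F = "A - B ** C ** P" and ?f = "\<lambda>t. (B ** C) *v g t"
  have f: "continuous_on {0..} ?f"
    by (intro bounded_linear.continuous_on[OF matrix_vector_mul_bounded_linear] g)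
  have "\<exists>x. cont_process M x \<and> (AE \<omega> in M. x 0 \<omega> = x0 i \<omega>) \<and>
    (\<forall>t\<ge>0. is_stochastic_integral M (W i) \<sigma> t (\<lambda>\<omega>. x t \<omega> - x 0 \<omega> - integral {0..t} (\<lambda>\<tau>. ?F *v x \<tau> \<omega> - ?f \<tau>)))"
    if i: "i \<in> {1..N}" for i
  proof -
    interpret prob_space M by (rule M)
    interpret brownian M "W i" by unfold_locales (rule W[OF i])
    obtain Y where Y: "cont_process M Y" "\<And>t. 0 \<le> t \<Longrightarrow> is_stochastic_integral M (W i) \<sigma> t (Y t)"
      using stochastic_integral_exists[OF \<sigma>] unfolding cont_process_def by blast
    define b where "b t \<omega> = x0 i \<omega> + Y t \<omega> - integral {0..t} ?f" for t \<omega>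
    have "cont_process M b"
      unfolding b_def
      by (intro cont_process_diff cont_process_add cont_process_rv[OF x0[OF i]] Y(1)
          cont_process_det continuous_integral_halfline f)
    then obtain x where x: "cont_process M x"
      and xe: "\<And>\<omega> t. \<omega> \<in> space M \<Longrightarrow> 0 \<le> t \<Longrightarrow> x t \<omega> = b t \<omega> + integral {0..t} (\<lambda>s. ?F *v x s \<omega>)"
      using linear_volterra_process by blast
    \<comment> \<open>The constant 0 is a Wiener integral up to time 0, so by uniqueness the chosen
      version starts at 0 almost surely.\<close>
    have "is_stochastic_integral M (W i) \<sigma> 0 (\<lambda>\<omega>. 0)"
      by (simp add: is_stochastic_integral_def)
    from is_stochastic_integral_unique[OF Y(2)[OF order_refl] this] have Y0: "AE \<omega> in M. Y 0 \<omega> = 0" by simp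
    have "AE \<omega> in M. x 0 \<omega> = x0 i \<omega>"
      using Y0 AE_space by eventually_elim (simp add: xe b_def)
    moreover have "is_stochastic_integral M (W i) \<sigma> t (\<lambda>\<omega>. x t \<omega> - x 0 \<omega> - integral {0..t} (\<lambda>\<tau>. ?F *v x \<tau> \<omega> - ?f \<tau>))"
      if t: "0 \<le> t" for t
    proof (rule is_stochastic_integral_cong_AE[OF Y(2)[OF t]])
      have "cont_process M (\<lambda>t \<omega>. x t \<omega> - x 0 \<omega> - integral {0..t} (\<lambda>\<tau>. ?F *v x \<tau> \<omega> - ?f \<tau>))"
        using x by (intro cont_process_diff cont_process_integral cont_process_matrix x cont_process_det f cont_process_rv)
          (simp add: cont_process_def)
      then show "(\<lambda>\<omega>. x t \<omega> - x 0 \<omega> - integral {0..t} (\<lambda>\<tau>. ?F *v x \<tau> \<omega> - ?f \<tau>)) \<in> borel_measurable M"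
        using t by (simp add: cont_process_def)
      show "AE \<omega> in M. Y t \<omega> = x t \<omega> - x 0 \<omega> - integral {0..t} (\<lambda>\<tau>. ?F *v x \<tau> \<omega> - ?f \<tau>)"
        using Y0 AE_space
      proof eventually_elim
        case (elim \<omega>)
        have "continuous_on {0..} (\<lambda>\<tau>. ?F *v x \<tau> \<omega>)"
          using cont_process_matrix[OF x, of ?F] elim by (simp add: cont_process_def)
        then have "integral {0..t} (\<lambda>\<tau>. ?F *v x \<tau> \<omega> - ?f \<tau>) = integral {0..t} (\<lambda>\<tau>. ?F *v x \<tau> \<omega>) - integral {0..t} ?f"
          by (intro integral_diff integrable_continuous_real continuous_on_subset[OF f]) (auto intro: continuous_on_subset)
        then show ?case using xe[OF elim(2) t] xe[OF elim(2) order_refl] elim(1) by (simp add: b_def)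
      qed
    qed
    ultimately show ?thesis using x by blast
  qed
  then have "\<forall>i\<in>{1..N}. \<exists>x. cont_process M x \<and> (AE \<omega> in M. x 0 \<omega> = x0 i \<omega>) \<and>
    (\<forall>t\<ge>0. is_stochastic_integral M (W i) \<sigma> t (\<lambda>\<omega>. x t \<omega> - x 0 \<omega> - integral {0..t} (\<lambda>\<tau>. ?F *v x \<tau> \<omega> - ?f \<tau>)))"
    by (intro ballI)
  from bchoice[OF this] show ?thesis unfolding generates_affine[OF g] .
qed

text \<open>The residuals of two trajectories are Wiener integrals of the same integrand, hence
  almost surely equal at each time and by continuity at all times at once. The noise cancels, and
  the difference solves a homogeneous linear equation from 0.\<close>

lemma affine_law_trajectory_unique:
  assumes M: "prob_space M" and W: "\<And>i. i \<in> {1..N} \<Longrightarrow> brownian_motion M (W i)"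
    and g: "continuous_on {0..} g"
    and x: "generates M N A B \<sigma> W x0 (affine_law C P g) x"
    and y: "generates M N A B \<sigma> W x0 (affine_law C P g) y"
  shows "indistinguishable M N x y"
  unfolding indistinguishable_def
proof
  fix i assume i: "i \<in> {1..N}"
  interpret prob_space M by (rule M)
  interpret brownian M "W i" by unfold_locales (rule W[OF i])
  let ?F = "A - B ** C ** P" and ?f = "\<lambda>t. (B ** C) *v g t"
  let ?D = "\<lambda>x t \<omega>. x i t \<omega> - x i 0 \<omega> - integral {0..t} (\<lambda>\<tau>. ?F *v x i \<tau> \<omega> - ?f \<tau>)"
  have f: "continuous_on {0..} ?f"
    by (intro bounded_linear.continuous_on[OF matrix_vector_mul_bounded_linear] g)
  have X: "cont_process M (x i)" "AE \<omega> in M. x i 0 \<omega> = x0 i \<omega>" "\<And>t. 0 \<le> t \<Longrightarrow> is_stochastic_integral M (W i) \<sigma> t (?D x t)"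
    and Y: "cont_process M (y i)" "AE \<omega> in M. y i 0 \<omega> = x0 i \<omega>" "\<And>t. 0 \<le> t \<Longrightarrow> is_stochastic_integral M (W i) \<sigma> t (?D y t)"
    using x y i unfolding generates_affine[OF g] by auto
  have D: "cont_process M (?D z)" if "cont_process M (z i)" for z
    using that by (intro cont_process_diff cont_process_integral cont_process_matrix that cont_process_det f cont_process_rv)
      (simp add: cont_process_def)
  have "AE \<omega> in M. \<forall>t\<ge>0. ?D x t \<omega> = ?D y t \<omega>"
    by (intro AE_eq_all_times D X(1) Y(1) is_stochastic_integral_unique[OF X(3) Y(3)])
  then show "AE \<omega> in M. \<forall>t\<ge>0. x i t \<omega> = y i t \<omega>"
    using X(2) Y(2) AE_space
  proof eventually_elim
    case (elim \<omega>)
    have cx: "continuous_on {0..} (\<lambda>t. x i t \<omega>)" and cy: "continuous_on {0..} (\<lambda>t. y i t \<omega>)"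
      using X(1) Y(1) elim by (auto simp: cont_process_def)
    show ?case
    proof (intro allI impI)
      fix t :: real assume t: "0 \<le> t"
      have "x i t \<omega> - y i t \<omega> = 0"
      proof (rule linear_volterra_zero[where A = ?F and d = "\<lambda>t. x i t \<omega> - y i t \<omega>", OF continuous_on_diff[OF cx cy] _ t])
        fix t :: real assume t: "0 \<le> t"
        have int: "(\<lambda>\<tau>. ?F *v z \<tau> - ?f \<tau>) integrable_on {0..t}" if "continuous_on {0..} z" for z
          by (intro integrable_continuous_real continuous_on_diff bounded_linear.continuous_on[OF matrix_vector_mul_bounded_linear]
              continuous_on_subset[OF that] continuous_on_subset[OF g]) auto
        have "x i t \<omega> - y i t \<omega> = integral {0..t} (\<lambda>\<tau>. ?F *v x i \<tau> \<omega> - ?f \<tau>) - integral {0..t} (\<lambda>\<tau>. ?F *v y i \<tau> \<omega> - ?f \<tau>)"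
        proof -
          have "?D x t \<omega> = ?D y t \<omega>" using elim(1) t by blast
          then show ?thesis using elim(2,3) by (simp add: algebra_simps)
        qed
        also have "\<dots> = integral {0..t} (\<lambda>\<tau>. (?F *v x i \<tau> \<omega> - ?f \<tau>) - (?F *v y i \<tau> \<omega> - ?f \<tau>))"
          by (rule integral_diff[symmetric]) (rule int[OF cx], rule int[OF cy])
        also have "\<dots> = integral {0..t} (\<lambda>\<tau>. ?F *v (x i \<tau> \<omega> - y i \<tau> \<omega>))"
          by (simp add: matrix_vector_mult_diff_distrib)
        finally show "x i t \<omega> - y i t \<omega> = integral {0..t} (\<lambda>s. ?F *v (x i s \<omega> - y i s \<omega>))" .
      qed
      then show "x i t \<omega> = y i t \<omega>" by simp
    qed
  qed
qed

section \<open>Discounted energy\<close>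

lemma bilinear_quadratic_bound:
  fixes \<beta> :: "'a::euclidean_space \<Rightarrow> 'a \<Rightarrow> real"
  assumes "bilinear \<beta>"
  obtains C where "C \<ge> 1" "\<And>u. \<beta> u u \<le> C * (norm u)\<^sup>2"
proof -
  obtain C where C: "\<And>u w. \<bar>\<beta> u w\<bar> \<le> C * norm u * norm w"
    using bilinear_bounded[OF assms] by auto
  have "\<beta> u u \<le> max 1 C * (norm u)\<^sup>2" for u
  proof -
    have "\<beta> u u \<le> C * norm u * norm u" using C[of u u] by linarith
    also have "\<dots> \<le> max 1 C * (norm u)\<^sup>2"
      by (simp add: power2_eq_square mult.assoc mult_right_mono)
    finally show ?thesis .
  qed
  then show ?thesis using that[of "max 1 C"] by simp
qed

lemma bilinear_young:
  fixes \<beta> :: "'a::real_vector \<Rightarrow> 'a \<Rightarrow> real"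
  assumes b: "bilinear \<beta>" and sym: "\<And>u w. \<beta> u w = \<beta> w u" and nn: "\<And>u. 0 \<le> \<beta> u u" and c: "c > 0"
  shows "2 * \<beta> u w \<le> c * \<beta> u u + \<beta> w w / c"
proof -
  have "0 \<le> \<beta> (c *\<^sub>R u - w) (c *\<^sub>R u - w) / c" using nn c by simp
  also have "\<dots> = c * \<beta> u u + \<beta> w w / c - 2 * \<beta> u w"
    using c sym[of w u] by (simp add: bilinear_lsub[OF b] bilinear_rsub[OF b] bilinear_lmul[OF b] bilinear_rmul[OF b] field_simps)
  finally show ?thesis by simp
qed

lemma bilinear_continuous_quadratic:
  fixes \<beta> :: "'a::euclidean_space \<Rightarrow> 'a \<Rightarrow> real" and f :: "real \<Rightarrow> 'a"
  shows "bilinear \<beta> \<Longrightarrow> continuous_on S f \<Longrightarrow> continuous_on S (\<lambda>t. \<beta> (f t) (f t))"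
  by (intro bilinear_continuous_on_compose[where h = \<beta>])

text \<open>The shift by \<rho>/2 makes the discounted form decay at the rate \<kappa>. Half of the
  rate absorbs the forcing by Young's inequality, whence 2 / \<kappa>; the other half is the
  exponential factor.\<close>

lemma lyapunov_step:
  fixes y q :: "real \<Rightarrow> real^'n"
  assumes lf: "lyapunov_form ((*v) (A - (\<rho> / 2) *\<^sub>R mat 1)) \<beta> \<kappa>"
    and y': "\<And>t. t \<in> {a..b} \<Longrightarrow> (y has_vector_derivative (A *v y t + q t)) (at t within {a..b})"
    and q: "continuous_on {a..b} q" and t: "t \<in> {a..b}"
  shows "exp (- \<rho> * t) * \<beta> (y t) (y t) \<le> exp (- (\<kappa> / 2) * (t - a)) * (exp (- \<rho> * a) * \<beta> (y a) (y a))
    + (2 / \<kappa>) * integral {a..t} (\<lambda>r. exp (- \<rho> * r) * \<beta> (q r) (q r))"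
proof -
  have \<kappa>: "\<kappa> > 0" and bil: "bilinear \<beta>" and sym: "\<And>u w. \<beta> u w = \<beta> w u"
    and nn: "\<And>u. 0 \<le> \<beta> u u"
    and de: "\<And>u. 2 * \<beta> u ((A - (\<rho> / 2) *\<^sub>R mat 1) *v u) \<le> - \<kappa> * \<beta> u u"
    using lf by (auto simp: lyapunov_form_def intro: order_trans[OF zero_le_power2])
  have bb: "bounded_bilinear \<beta>" using bil by (simp add: bilinear_conv_bounded_bilinear)
  define U where "U t = exp (- \<rho> * t) * \<beta> (y t) (y t)" for t
  define H where "H t = (2 / \<kappa>) * integral {a..t} (\<lambda>r. exp (- \<rho> * r) * \<beta> (q r) (q r))" for t
  \<comment> \<open>Subtracting the accumulated forcing makes \<Psi> nonincreasing, since
    \<open>H\<close> is nonnegative.\<close>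
  define \<Psi> where "\<Psi> t = exp ((\<kappa> / 2) * (t - a)) * (U t - H t)" for t
  define U' where "U' t = exp (- \<rho> * t) * (2 * \<beta> (y t) (A *v y t + q t) - \<rho> * \<beta> (y t) (y t))" for t
  define H' where "H' t = (2 / \<kappa>) * (exp (- \<rho> * t) * \<beta> (q t) (q t))" for t
  have cq: "continuous_on {a..t} (\<lambda>r. exp (- \<rho> * r) * \<beta> (q r) (q r))" if "t \<le> b" for t
    by (intro continuous_intros bilinear_continuous_quadratic[OF bil] continuous_on_subset[OF q]) (use that in auto)
  have H0: "0 \<le> H t" if "t \<in> {a..b}" for t
    unfolding H_def using \<kappa> nn that
    by (intro mult_nonneg_nonneg integral_nonneg integrable_continuous_real cq) auto
  have "\<Psi> t \<le> \<Psi> a"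
  proof (rule nonincreasing_if_derivative_nonpos[where f = \<Psi> and
        f' = "\<lambda>r. exp ((\<kappa> / 2) * (r - a)) * ((\<kappa> / 2) * (U r - H r) + (U' r - H' r))"])
    fix r assume r: "r \<in> {a..t}"
    then have rb: "r \<in> {a..b}" using t by auto
    have y1: "(y has_vector_derivative (A *v y r + q r)) (at r within {a..t})"
      using y'[OF rb] by (rule has_vector_derivative_within_subset) (use t in auto)
    have "((\<lambda>t. \<beta> (y t) (y t)) has_real_derivative (2 * \<beta> (y r) (A *v y r + q r))) (at r within {a..t})"
      using bounded_bilinear.has_vector_derivative[OF bb y1 y1] sym[of "A *v y r + q r" "y r"]
      by (simp add: has_real_derivative_iff_has_vector_derivative)
    then have dU: "(U has_real_derivative U' r) (at r within {a..t})"
      unfolding U_def U'_def by (auto intro!: derivative_eq_intros simp: algebra_simps)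
    have dH: "(H has_real_derivative H' r) (at r within {a..t})"
      unfolding H_def H'_def
      using integral_has_vector_derivative[OF cq r] t \<kappa>
      by (auto intro!: derivative_eq_intros simp: has_real_derivative_iff_has_vector_derivative[symmetric])
    show "(\<Psi> has_real_derivative (exp ((\<kappa> / 2) * (r - a)) * ((\<kappa> / 2) * (U r - H r) + (U' r - H' r)))) (at r within {a..t})"
      unfolding \<Psi>_def by (rule derivative_eq_intros dU dH refl)+ (simp add: algebra_simps)
  next
    fix r assume "r \<in> {a<..<t}"
    then have rb: "r \<in> {a..b}" using t by auto
    have "2 * \<beta> (y r) (A *v y r) \<le> (\<rho> - \<kappa>) * \<beta> (y r) (y r)"
      using de[of "y r"]
      by (simp add: matrix_vector_mult_diff_rdistrib scaleR_matrix_vector_assoc[symmetric] bilinear_rsub[OF bil]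
          bilinear_rmul[OF bil] algebra_simps)
    moreover have "2 * \<beta> (y r) (q r) \<le> (\<kappa> / 2) * \<beta> (y r) (y r) + \<beta> (q r) (q r) / (\<kappa> / 2)"
      by (rule bilinear_young[OF bil sym nn]) (use \<kappa> in simp)
    ultimately have "2 * \<beta> (y r) (A *v y r + q r) - \<rho> * \<beta> (y r) (y r)
        \<le> - (\<kappa> / 2) * \<beta> (y r) (y r) + (2 / \<kappa>) * \<beta> (q r) (q r)"
      by (simp add: bilinear_radd[OF bil] algebra_simps)
    then have "U' r \<le> exp (- \<rho> * r) * (- (\<kappa> / 2) * \<beta> (y r) (y r) + (2 / \<kappa>) * \<beta> (q r) (q r))"
      unfolding U'_def by (rule mult_left_mono) simp
    also have "\<dots> = - (\<kappa> / 2) * U r + H' r" by (simp add: U_def H'_def algebra_simps)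
    finally have "(\<kappa> / 2) * (U r - H r) + (U' r - H' r) \<le> - (\<kappa> / 2) * H r"
      unfolding right_diff_distrib by linarith
    also have "\<dots> \<le> 0" using H0[OF rb] \<kappa> by simp
    finally show "exp ((\<kappa> / 2) * (r - a)) * ((\<kappa> / 2) * (U r - H r) + (U' r - H' r)) \<le> 0"
      by (simp add: mult_le_0_iff)
  qed (use t in auto)
  then have "exp ((\<kappa> / 2) * (t - a)) * (U t - H t) \<le> U a" by (simp add: \<Psi>_def H_def)
  then have "exp (- (\<kappa> / 2) * (t - a)) * (exp ((\<kappa> / 2) * (t - a)) * (U t - H t)) \<le> exp (- (\<kappa> / 2) * (t - a)) * U a"
    by (rule mult_left_mono) simp
  moreover have "exp (- (\<kappa> / 2) * (t - a)) * (exp ((\<kappa> / 2) * (t - a)) * (U t - H t)) = U t - H t"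
  proof -
    have "exp (- (\<kappa> / 2) * (t - a)) * exp ((\<kappa> / 2) * (t - a)) = 1" by (simp flip: exp_add)
    then show ?thesis by (simp only: mult.assoc[symmetric] mult_1)
  qed
  ultimately show ?thesis unfolding U_def H_def by linarith
qed

text \<open>On \<open>[k, k + 1]\<close> the path \<open>x - (Y - Y k)\<close> solves an ordinary differential equation, to which the
  Lyapunov form applies.\<close>

lemma lyapunov_path:
  fixes A :: "real^'n^'n"
  assumes lf: "lyapunov_form ((*v) (A - (\<rho> / 2) *\<^sub>R mat 1)) \<beta> \<kappa>"
  shows "\<exists>\<gamma> C. 0 \<le> \<gamma> \<and> \<gamma> < 1 \<and> 0 \<le> C \<and>
    (\<forall>x Y f (k::nat) t. continuous_on {0..} x \<longrightarrow> continuous_on {0..} Y \<longrightarrow> continuous_on {0..} f \<longrightarrow>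
      (\<forall>t\<ge>0. Y t = x t - x 0 - integral {0..t} (\<lambda>\<tau>. A *v x \<tau> - f \<tau>)) \<longrightarrow> t \<in> {real k..real k + 1} \<longrightarrow>
      exp (- \<rho> * t) * (norm (x t))\<^sup>2 \<le> C * (exp (- \<rho> * real k) * \<beta> (x (real k)) (x (real k))
        + integral {real k..real k + 1} (\<lambda>r. exp (- \<rho> * r) * ((norm (f r))\<^sup>2 + (norm (Y r - Y (real k)))\<^sup>2))
        + exp (- \<rho> * t) * (norm (Y t - Y (real k)))\<^sup>2) \<and>
      exp (- \<rho> * (real k + 1)) * \<beta> (x (real k + 1)) (x (real k + 1)) \<le>
        \<gamma> * (exp (- \<rho> * real k) * \<beta> (x (real k)) (x (real k)))
        + C * (integral {real k..real k + 1} (\<lambda>r. exp (- \<rho> * r) * ((norm (f r))\<^sup>2 + (norm (Y r - Y (real k)))\<^sup>2))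
        + exp (- \<rho> * (real k + 1)) * (norm (Y (real k + 1) - Y (real k)))\<^sup>2))"
proof -
  have \<kappa>: "\<kappa> > 0" and bil: "bilinear \<beta>" and sym: "\<And>u w. \<beta> u w = \<beta> w u"
    and lo: "\<And>u. (norm u)\<^sup>2 \<le> \<beta> u u" and nn: "\<And>u. 0 \<le> \<beta> u u"
    using lf by (auto simp: lyapunov_form_def intro: order_trans[OF zero_le_power2])
  obtain Cb where Cb: "Cb \<ge> 1" "\<And>u. \<beta> u u \<le> Cb * (norm u)\<^sup>2"
    using bilinear_quadratic_bound[OF bil] by blast
  obtain K where K: "K > 0" "\<And>v. norm (A *v v) \<le> norm v * K"
    using bounded_linear.pos_bounded[OF matrix_vector_mul_bounded_linear[of A]] by blast
  \<comment> \<open>Over a unit interval the discounted form of \<open>y\<close> shrinks by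
    \<theta>. Returning to x = y + D costs a factor 1 + \<epsilon>, chosen so that \<gamma> stays
    below 1; the price is the constant 1 + 1/\<epsilon> at the noise.\<close>
  define \<theta> where "\<theta> = exp (- (\<kappa> / 2))"
  have \<theta>: "0 < \<theta>" "\<theta> < 1" using \<kappa> by (auto simp: \<theta>_def)
  define \<epsilon> where "\<epsilon> = (1 - \<theta>) / 2"
  have \<epsilon>: "0 < \<epsilon>" "\<epsilon> < 1" using \<theta> by (auto simp: \<epsilon>_def)
  define \<gamma> where "\<gamma> = (1 + \<epsilon>) * \<theta>"
  have \<gamma>: "0 \<le> \<gamma>" "\<gamma> < 1"
  proof -
    have "(1 - \<theta>) * \<theta> < (1 - \<theta>) * 1" using \<theta> by (intro mult_strict_left_mono) auto
    then show "\<gamma> < 1" using \<theta> unfolding \<gamma>_def \<epsilon>_def by (simp add: field_simps)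
  qed (use \<epsilon> \<theta> in \<open>simp add: \<gamma>_def\<close>)
  define L where "L = (2 / \<kappa>) * (2 * Cb * (1 + K\<^sup>2))"
  have L: "0 \<le> L" using \<kappa> Cb by (simp add: L_def)
  define C where "C = 2 + 2 * L + (1 + 1 / \<epsilon>) * Cb + 2 * Cb"
  have e0: "0 \<le> (1 + 1 / \<epsilon>) * Cb" using \<epsilon> Cb by simp
  have C: "0 \<le> C" "2 \<le> C" "2 * L \<le> C" "2 * Cb \<le> C" "(1 + 1 / \<epsilon>) * Cb \<le> C"
    using L Cb e0 by (auto simp: C_def)
  have split: "\<beta> (u + w) (u + w) \<le> (1 + c) * \<beta> u u + (1 + 1 / c) * \<beta> w w" if "c > 0" for u w c
    using bilinear_young[OF bil sym nn that, of u w] sym[of u w]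
    by (simp add: bilinear_ladd[OF bil] bilinear_radd[OF bil] algebra_simps)
  have main: "exp (- \<rho> * t) * (norm (x t))\<^sup>2 \<le> C * (exp (- \<rho> * real k) * \<beta> (x (real k)) (x (real k)) + h
        + exp (- \<rho> * t) * (norm (Y t - Y (real k)))\<^sup>2) \<and>
      exp (- \<rho> * (real k + 1)) * \<beta> (x (real k + 1)) (x (real k + 1)) \<le>
        \<gamma> * (exp (- \<rho> * real k) * \<beta> (x (real k)) (x (real k)))
        + C * (h + exp (- \<rho> * (real k + 1)) * (norm (Y (real k + 1) - Y (real k)))\<^sup>2)"
    if x: "continuous_on {0..} x" and Yc: "continuous_on {0..} Y" and f: "continuous_on {0..} f"
      and Y: "\<And>t. 0 \<le> t \<Longrightarrow> Y t = x t - x 0 - integral {0..t} (\<lambda>\<tau>. A *v x \<tau> - f \<tau>)"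
      and t: "t \<in> {real k..real k + 1}"
      and h: "h = integral {real k..real k + 1} (\<lambda>r. exp (- \<rho> * r) * ((norm (f r))\<^sup>2 + (norm (Y r - Y (real k)))\<^sup>2))"
    for x Y f h and k :: nat and t
  proof -
    let ?I = "{real k..real k + 1}"
    define D where "D t = Y t - Y (real k)" for t
    define y where "y t = x t - D t" for t
    define q where "q t = A *v D t - f t" for t
    have I0: "?I \<subseteq> {0..}" by auto
    have Dc: "continuous_on ?I D"
      unfolding D_def by (intro continuous_intros continuous_on_subset[OF Yc I0])
    have qc: "continuous_on ?I q"
      unfolding q_def
      by (intro continuous_on_diff bounded_linear.continuous_on[OF matrix_vector_mul_bounded_linear] Dc continuous_on_subset[OF f I0])
    have drift: "continuous_on {0..} (\<lambda>\<tau>. A *v x \<tau> - f \<tau>)"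
      by (intro continuous_on_diff bounded_linear.continuous_on[OF matrix_vector_mul_bounded_linear] x f)
    \<comment> \<open>Subtracting the noise increment leaves a differentiable function; the noise
      reappears in the forcing \<open>q\<close>, without being differentiated.\<close>
    have y': "(y has_vector_derivative (A *v y r + q r)) (at r within ?I)" if r: "r \<in> ?I" for r
    proof -
      have "((\<lambda>u. integral {0..u} (\<lambda>\<tau>. A *v x \<tau> - f \<tau>)) has_vector_derivative (A *v x r - f r)) (at r within {0..real k + 1})"
        using r by (intro integral_has_vector_derivative continuous_on_subset[OF drift]) auto
      then have "((\<lambda>u. integral {0..u} (\<lambda>\<tau>. A *v x \<tau> - f \<tau>)) has_vector_derivative (A *v x r - f r)) (at r within ?I)"
        by (rule has_vector_derivative_within_subset) auto
      then have "((\<lambda>u. x 0 + Y (real k) + integral {0..u} (\<lambda>\<tau>. A *v x \<tau> - f \<tau>)) has_vector_derivative (0 + (A *v x r - f r))) (at r within ?I)"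
        by (intro has_vector_derivative_add has_vector_derivative_const)
      then have "(y has_vector_derivative (0 + (A *v x r - f r))) (at r within ?I)"
        by (rule has_vector_derivative_transform[rotated 2]) (use r Y in \<open>auto simp: y_def D_def\<close>)
      moreover have "0 + (A *v x r - f r) = A *v y r + q r"
        by (simp add: y_def q_def matrix_vector_mult_diff_distrib)
      ultimately show ?thesis by simp
    qed
    have yk: "y (real k) = x (real k)" by (simp add: y_def D_def)
    define v where "v = exp (- \<rho> * real k) * \<beta> (x (real k)) (x (real k))"
    have v0: "0 \<le> v" using nn by (simp add: v_def)
    have hc: "continuous_on ?I (\<lambda>r. exp (- \<rho> * r) * ((norm (f r))\<^sup>2 + (norm (D r))\<^sup>2))"
      by (intro continuous_intros Dc continuous_on_subset[OF f I0])
    have h': "h = integral ?I (\<lambda>r. exp (- \<rho> * r) * ((norm (f r))\<^sup>2 + (norm (D r))\<^sup>2))"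
      unfolding h D_def ..
    have h0: "0 \<le> h" unfolding h' by (intro integral_nonneg integrable_continuous_real hc) auto
    have qb: "\<beta> (q r) (q r) \<le> (2 * Cb * (1 + K\<^sup>2)) * ((norm (f r))\<^sup>2 + (norm (D r))\<^sup>2)" for r
    proof -
      have "norm (q r) \<le> norm (D r) * K + norm (f r)"
        unfolding q_def by (rule order_trans[OF norm_triangle_ineq4]) (use K in simp)
      then have "(norm (q r))\<^sup>2 \<le> (norm (D r) * K + norm (f r))\<^sup>2" by (intro power_mono) auto
      also have "\<dots> \<le> 2 * (norm (D r))\<^sup>2 * K\<^sup>2 + 2 * (norm (f r))\<^sup>2"
        using sum_squares_bound[of "norm (D r) * K" "norm (f r)"]
        by (simp add: power2_sum power_mult_distrib mult.commute[of "K\<^sup>2"])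
      also have "\<dots> \<le> 2 * (1 + K\<^sup>2) * ((norm (f r))\<^sup>2 + (norm (D r))\<^sup>2)"
        by (simp add: algebra_simps)
      finally have "Cb * (norm (q r))\<^sup>2 \<le> Cb * (2 * (1 + K\<^sup>2) * ((norm (f r))\<^sup>2 + (norm (D r))\<^sup>2))"
        using Cb by (intro mult_left_mono) auto
      then show ?thesis using Cb(2)[of "q r"] by (simp add: mult_ac)
    qed
    have Ub: "exp (- \<rho> * t) * \<beta> (y t) (y t) \<le> exp (- (\<kappa> / 2) * (t - real k)) * v + L * h" if t: "t \<in> ?I" for t
    proof -
      let ?g = "\<lambda>r. exp (- \<rho> * r) * \<beta> (q r) (q r)"
      have gc: "continuous_on ?I ?g"
        by (intro continuous_intros bilinear_continuous_quadratic[OF bil] qc)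
      have "integral {real k..t} ?g \<le> integral ?I ?g"
      proof (rule integral_subset_le)
        show "?g integrable_on {real k..t}" "?g integrable_on ?I"
          by (intro integrable_continuous_real continuous_on_subset[OF gc]; use t in simp)+
      qed (use t nn in auto)
      also have "\<dots> \<le> integral ?I (\<lambda>r. (2 * Cb * (1 + K\<^sup>2)) * (exp (- \<rho> * r) * ((norm (f r))\<^sup>2 + (norm (D r))\<^sup>2)))"
      proof (rule integral_le)
        show "(\<lambda>r. (2 * Cb * (1 + K\<^sup>2)) * (exp (- \<rho> * r) * ((norm (f r))\<^sup>2 + (norm (D r))\<^sup>2))) integrable_on ?I"
          by (intro integrable_continuous_real continuous_intros hc Dc continuous_on_subset[OF f I0])
        show "?g integrable_on ?I" by (intro integrable_continuous_real gc)
        show "?g r \<le> (2 * Cb * (1 + K\<^sup>2)) * (exp (- \<rho> * r) * ((norm (f r))\<^sup>2 + (norm (D r))\<^sup>2))" for r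
          using mult_left_mono[OF qb[of r], of "exp (- \<rho> * r)"] by (simp add: mult_ac)
      qed
      also have "\<dots> = (2 * Cb * (1 + K\<^sup>2)) * h" unfolding h' by simp
      finally have "(2 / \<kappa>) * integral {real k..t} ?g \<le> (2 / \<kappa>) * ((2 * Cb * (1 + K\<^sup>2)) * h)"
        using \<kappa> by (intro mult_left_mono) auto
      also have "\<dots> = L * h" by (simp add: L_def)
      finally have "(2 / \<kappa>) * integral {real k..t} ?g \<le> L * h" .
      with lyapunov_step[OF lf y' qc t] show ?thesis unfolding yk v_def by linarith
    qed
    have xy: "x t = y t + D t" for t by (simp add: y_def)
    have xb: "exp (- \<rho> * t) * \<beta> (x t) (x t) \<le> (1 + c) * (exp (- \<rho> * t) * \<beta> (y t) (y t))
        + ((1 + 1 / c) * Cb) * (exp (- \<rho> * t) * (norm (D t))\<^sup>2)" if c: "c > 0" for c t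
    proof -
      have "\<beta> (x t) (x t) \<le> (1 + c) * \<beta> (y t) (y t) + (1 + 1 / c) * \<beta> (D t) (D t)"
        unfolding xy by (rule split[OF c])
      also have "\<dots> \<le> (1 + c) * \<beta> (y t) (y t) + (1 + 1 / c) * (Cb * (norm (D t))\<^sup>2)"
        using Cb(2)[of "D t"] c by (intro add_left_mono mult_left_mono) auto
      finally have "exp (- \<rho> * t) * \<beta> (x t) (x t)
        \<le> exp (- \<rho> * t) * ((1 + c) * \<beta> (y t) (y t) + (1 + 1 / c) * (Cb * (norm (D t))\<^sup>2))"
        by (rule mult_left_mono) simp
      also have "\<dots> = (1 + c) * (exp (- \<rho> * t) * \<beta> (y t) (y t)) + ((1 + 1 / c) * Cb) * (exp (- \<rho> * t) * (norm (D t))\<^sup>2)"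
        by (simp only: distrib_left distrib_right mult_ac)
      finally show ?thesis .
    qed
    have d0: "0 \<le> exp (- \<rho> * t) * (norm (D t))\<^sup>2" for t by simp
    show ?thesis
    proof
      have "exp (- \<rho> * t) * (norm (x t))\<^sup>2 \<le> exp (- \<rho> * t) * \<beta> (x t) (x t)" by (intro mult_left_mono lo) simp
      also have "\<dots> \<le> 2 * (exp (- \<rho> * t) * \<beta> (y t) (y t)) + (2 * Cb) * (exp (- \<rho> * t) * (norm (D t))\<^sup>2)"
        using xb[of 1 t] by simp
      also have "\<dots> \<le> 2 * (v + L * h) + (2 * Cb) * (exp (- \<rho> * t) * (norm (D t))\<^sup>2)"
      proof -
        have "exp (- (\<kappa> / 2) * (t - real k)) \<le> 1" using \<kappa> t by simp
        then have "exp (- (\<kappa> / 2) * (t - real k)) * v \<le> 1 * v" using v0 by (rule mult_right_mono)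
        then have "exp (- (\<kappa> / 2) * (t - real k)) * v \<le> v" by (simp only: mult_1)
        with Ub[OF t] have "exp (- \<rho> * t) * \<beta> (y t) (y t) \<le> v + L * h" by (meson add_right_mono order_trans)
        then show ?thesis by (intro add_right_mono mult_left_mono) auto
      qed
      also have "\<dots> \<le> C * v + C * h + C * (exp (- \<rho> * t) * (norm (D t))\<^sup>2)"
      proof -
        have "2 * (v + L * h) = 2 * v + 2 * L * h" by (simp add: distrib_left)
        then show ?thesis by (simp only:) (intro add_mono mult_right_mono C v0 h0 d0)
      qed
      finally show "exp (- \<rho> * t) * (norm (x t))\<^sup>2 \<le> C * (exp (- \<rho> * real k) * \<beta> (x (real k)) (x (real k)) + h
        + exp (- \<rho> * t) * (norm (Y t - Y (real k)))\<^sup>2)"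
        by (simp only: v_def D_def distrib_left)
      let ?s = "real k + 1"
      have "(1 + \<epsilon>) * (exp (- \<rho> * ?s) * \<beta> (y ?s) (y ?s)) \<le> (1 + \<epsilon>) * (\<theta> * v + L * h)"
        using Ub[of ?s] \<epsilon> by (intro mult_left_mono) (auto simp: \<theta>_def)
      also have "\<dots> = \<gamma> * v + (1 + \<epsilon>) * (L * h)" by (simp add: \<gamma>_def algebra_simps)
      also have "\<dots> \<le> \<gamma> * v + 2 * (L * h)"
        using \<epsilon> L h0 by (intro add_left_mono mult_right_mono) auto
      also have "\<dots> = \<gamma> * v + 2 * L * h" by simp
      finally have "exp (- \<rho> * ?s) * \<beta> (x ?s) (x ?s) \<le> \<gamma> * v + 2 * L * h
        + ((1 + 1 / \<epsilon>) * Cb) * (exp (- \<rho> * ?s) * (norm (D ?s))\<^sup>2)"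
        by (rule order_trans[OF xb[OF \<epsilon>(1)] add_right_mono])
      also have "\<dots> \<le> \<gamma> * v + (C * h + C * (exp (- \<rho> * ?s) * (norm (D ?s))\<^sup>2))"
        unfolding add.assoc by (intro add_left_mono add_mono mult_right_mono C h0 d0)
      finally show "exp (- \<rho> * ?s) * \<beta> (x ?s) (x ?s) \<le> \<gamma> * (exp (- \<rho> * real k) * \<beta> (x (real k)) (x (real k)))
        + C * (h + exp (- \<rho> * ?s) * (norm (Y ?s - Y (real k)))\<^sup>2)"
        by (simp only: v_def D_def distrib_left)
    qed
  qed
  show ?thesis
    by (intro exI[of _ \<gamma>] exI[of _ C] conjI \<gamma> C(1) allI impI main[THEN conjunct1] main[THEN conjunct2]) auto
qed

section \<open>Summation over unit time intervals\<close>

lemma summable_affine_recursion: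
  fixes v b :: "nat \<Rightarrow> real"
  assumes v: "\<And>k. 0 \<le> v k" and b: "summable b" "\<And>k. 0 \<le> b k"
    and rec: "\<And>k. v (Suc k) \<le> \<gamma> * v k + b k" and \<gamma>: "0 \<le> \<gamma>" "\<gamma> < 1"
  shows "summable v"
proof (rule summableI_nonneg_bounded)
  fix n
  have "sum v {..<n} \<le> sum v {..<Suc n}" using v by simp
  also have "\<dots> = v 0 + (\<Sum>k<n. v (Suc k))" by (rule sum.lessThan_Suc_shift)
  also have "\<dots> \<le> v 0 + (\<Sum>k<n. \<gamma> * v k + b k)" by (intro add_left_mono sum_mono rec)
  also have "\<dots> = v 0 + \<gamma> * sum v {..<n} + sum b {..<n}" by (simp add: sum.distrib sum_distrib_left)
  also have "\<dots> \<le> v 0 + \<gamma> * sum v {..<n} + suminf b"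
    using sum_le_suminf[OF b(1), of "{..<n}"] b(2) by simp
  finally have "(1 - \<gamma>) * sum v {..<n} \<le> v 0 + suminf b" by (simp add: algebra_simps)
  then show "sum v {..<n} \<le> (v 0 + suminf b) / (1 - \<gamma>)" using \<gamma> by (simp add: pos_le_divide_eq mult.commute)
qed (rule v)

text \<open>The real version subtracts \<gamma> times the sum, so the terms have to be finite before
  it applies; their finiteness follows by induction along the recursion.\<close>

lemma suminf_affine_recursion_ennreal:
  fixes v b :: "nat \<Rightarrow> ennreal"
  assumes v0: "v 0 < \<infinity>" and b: "(\<Sum>k. b k) < \<infinity>"
    and rec: "\<And>k. v (Suc k) \<le> ennreal \<gamma> * v k + b k" and \<gamma>: "0 \<le> \<gamma>" "\<gamma> < 1"
  shows "(\<Sum>k. v k) < \<infinity>"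
proof -
  have bf: "b k < \<infinity>" for k
  proof -
    have "sum b {k} \<le> suminf b" by (rule sum_le_suminf) auto
    from le_less_trans[OF this b] show ?thesis by simp
  qed
  have vf: "v k < \<infinity>" for k
  proof (induction k)
    case (Suc k)
    then have "ennreal \<gamma> * v k + b k < \<infinity>" using bf[of k] by (simp add: ennreal_mult_less_top)
    then show ?case by (rule le_less_trans[OF rec])
  qed (rule v0)
  define v' where "v' k = enn2real (v k)" for k
  define b' where "b' k = enn2real (b k)" for k
  have v': "v k = ennreal (v' k)" and b': "b k = ennreal (b' k)" for k
    using vf[of k] bf[of k] by (auto simp: v'_def b'_def less_top)
  have nn: "0 \<le> v' k" "0 \<le> b' k" for k by (auto simp: v'_def b'_def)
  have "summable b'"
    using b nn unfolding b' by (intro summable_suminf_not_top) auto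
  moreover have "v' (Suc k) \<le> \<gamma> * v' k + b' k" for k
  proof -
    have "ennreal (v' (Suc k)) \<le> ennreal (\<gamma> * v' k + b' k)"
      using rec[of k] nn \<gamma> unfolding v' b' by (simp add: ennreal_mult)
    then show ?thesis using nn \<gamma> by (subst (asm) ennreal_le_iff) auto
  qed
  ultimately have "summable v'" using summable_affine_recursion[of v' b' \<gamma>] nn \<gamma> by blast
  then show ?thesis unfolding v' using nn by (simp add: suminf_ennreal2)
qed

text \<open>Neighbouring closed intervals share only an end point, so they may be replaced by
  half-open ones, which form a partition. The pathwise estimate lives on the closed ones.\<close>

lemma nn_integral_unit_intervals:
  fixes g :: "real \<Rightarrow> ennreal"
  assumes [measurable]: "g \<in> borel_measurable borel"
  shows "(\<Sum>k. \<integral>\<^sup>+r. g r * indicator {real k..real k + 1} r \<partial>lborel) = (\<integral>\<^sup>+r. g r * indicator {0..} r \<partial>lborel)"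
proof -
  have "(\<integral>\<^sup>+r. g r * indicator {real k..real k + 1} r \<partial>lborel) = (\<integral>\<^sup>+r. g r * indicator {real k..<real k + 1} r \<partial>lborel)" for k
    by (rule nn_integral_cong_AE) (use AE_lborel_singleton[of "real k + 1"] in eventually_elim, auto simp: indicator_def)
  then have "(\<Sum>k. \<integral>\<^sup>+r. g r * indicator {real k..real k + 1} r \<partial>lborel)
    = (\<Sum>k. \<integral>\<^sup>+r. g r * indicator {real k..<real k + 1} r \<partial>lborel)" by simp
  also have "\<dots> = (\<integral>\<^sup>+r. (\<Sum>k. g r * indicator {real k..<real k + 1} r) \<partial>lborel)"
    by (rule nn_integral_suminf[symmetric]) measurable
  also have "(\<lambda>r. \<Sum>k. g r * indicator {real k..<real k + 1} r) = (\<lambda>r. g r * indicator {0..} r)"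
  proof
    fix r :: real
    show "(\<Sum>k. g r * indicator {real k..<real k + 1} r) = g r * indicator {0..} r"
    proof (cases "0 \<le> r")
      case True
      have "indicator {real k..<real k + 1} r = (if k = nat \<lfloor>r\<rfloor> then 1 else 0 :: ennreal)" for k :: nat
        using True by (auto simp: indicator_def) linarith+
      then have "(\<Sum>k. g r * indicator {real k..<real k + 1} r) = (\<Sum>k\<in>{nat \<lfloor>r\<rfloor>}. g r * indicator {real k..<real k + 1} r)"
        by (intro suminf_finite) auto
      also have "\<dots> = g r" using \<open>\<And>k. indicator {real k..<real k + 1} r = _ k\<close> by simp
      finally show ?thesis using True by simp
    qed (auto simp: indicator_def)
  qed
  finally show ?thesis .
qed

text \<open>Functions on the half-line are arbitrary at negative times; read through
  \<open>max 0\<close> they become continuous, hence Borel, on the whole line.\<close>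

lemma continuous_on_max0:
  fixes f :: "real \<Rightarrow> 'b::topological_space"
  assumes "continuous_on {0..} f"
  shows "continuous_on UNIV (\<lambda>r. f (max 0 r))"
  by (rule continuous_on_compose2[OF assms]) (auto intro: continuous_intros)

lemma C_weighted_nn_integral:
  assumes "h \<in> C_weighted (\<rho> / 2)"
  shows "(\<integral>\<^sup>+r. ennreal (exp (- \<rho> * r) * (norm (h (max 0 r)))\<^sup>2) * indicator {0..} r \<partial>lborel) < \<infinity>"
proof -
  have "integrable lborel (\<lambda>r. indicator {0..} r *\<^sub>R (exp (- (2 * (\<rho> / 2)) * r) * (norm (h r))\<^sup>2))"
    using C_weightedD(2)[OF assms] by (simp add: set_integrable_def)
  then have "(\<integral>\<^sup>+r. ennreal (norm (indicator {0..} r *\<^sub>R (exp (- (2 * (\<rho> / 2)) * r) * (norm (h r))\<^sup>2))) \<partial>lborel) < \<infinity>"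
    by (simp only: integrable_iff_bounded)
  also have "(\<lambda>r. ennreal (norm (indicator {0..} r *\<^sub>R (exp (- (2 * (\<rho> / 2)) * r) * (norm (h r))\<^sup>2))))
    = (\<lambda>r. ennreal (exp (- \<rho> * r) * (norm (h (max 0 r)))\<^sup>2) * indicator {0..} r)"
    by (auto simp: fun_eq_iff indicator_def max_def)
  finally show ?thesis .
qed

lemma nn_integral_Icc_continuous:
  fixes g g' :: "real \<Rightarrow> real"
  assumes g: "continuous_on {a..b} g" and nn: "\<And>r. r \<in> {a..b} \<Longrightarrow> 0 \<le> g r"
    and eq: "\<And>r. r \<in> {a..b} \<Longrightarrow> g' r = g r"
  shows "(\<integral>\<^sup>+r. ennreal (g' r) * indicator {a..b} r \<partial>lborel) = ennreal (integral {a..b} g)"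
proof -
  note si = borel_integrable_atLeastAtMost'[OF g]
  have "(\<integral>\<^sup>+r. ennreal (g' r) * indicator {a..b} r \<partial>lborel) = (\<integral>\<^sup>+r. ennreal (indicator {a..b} r *\<^sub>R g r) \<partial>lborel)"
    by (intro nn_integral_cong) (auto simp: indicator_def eq)
  also have "\<dots> = ennreal (LINT r:{a..b}|lborel. g r)"
    unfolding set_lebesgue_integral_def
    by (rule nn_integral_eq_integral) (use si nn in \<open>auto simp: set_integrable_def indicator_def\<close>)
  also have "\<dots> = ennreal (integral {a..b} g)" using set_borel_integral_eq_integral(2)[OF si] by simp
  finally show ?thesis .
qed

text \<open>In expectation the pathwise estimate becomes a recursion with ratio \<gamma> for the
  discounted Lyapunov form \<open>V k\<close> at integer times, whose forcing \<open>b k\<close>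
  collects the energies of \<open>f\<close> and \<sigma> on [k, k + 1]. The forcing is summable,
  hence so is \<open>V\<close>, and the two together bound the energy of the state on the same
  interval.\<close>

lemma energy_finite:
  fixes A :: "real^'n^'n" and x :: "real \<Rightarrow> 'w \<Rightarrow> real^'n"
  assumes M: "prob_space M" and W: "brownian_motion M W" and \<rho>: "0 \<le> \<rho>"
    and F: "hurwitz (A - (\<rho> / 2) *\<^sub>R mat 1)"
    and \<sigma>: "\<sigma> \<in> C_weighted (\<rho> / 2)" and f: "f \<in> C_weighted (\<rho> / 2)"
    and x: "cont_process M x" and x0: "(\<integral>\<^sup>+\<omega>. ennreal ((norm (x 0 \<omega>))\<^sup>2) \<partial>M) < \<infinity>"
    and si: "\<And>t. 0 \<le> t \<Longrightarrow> is_stochastic_integral M W \<sigma> t (\<lambda>\<omega>. x t \<omega> - x 0 \<omega> - integral {0..t} (\<lambda>\<tau>. A *v x \<tau> \<omega> - f \<tau>))"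
  shows "(\<integral>\<^sup>+\<omega>. (\<integral>\<^sup>+t. ennreal (exp (- \<rho> * t) * (norm (x (max 0 t) \<omega>))\<^sup>2) * indicator {0..} t \<partial>lborel) \<partial>M) < \<infinity>"
proof -
  interpret prob_space M by (rule M)
  interpret brownian M W by unfold_locales (rule W)
  interpret pair_sigma_finite lborel M ..
  obtain \<beta> \<kappa> where lf: "lyapunov_form ((*v) (A - (\<rho> / 2) *\<^sub>R mat 1)) \<beta> \<kappa>" using hurwitz_lyapunov[OF F] by blast
  then have bil: "bilinear \<beta>" and nn: "\<And>u. 0 \<le> \<beta> u u"
    by (auto simp: lyapunov_form_def intro: order_trans[OF zero_le_power2])
  obtain Cb where Cb: "Cb \<ge> 1" "\<And>u. \<beta> u u \<le> Cb * (norm u)\<^sup>2"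
    using bilinear_quadratic_bound[OF bil] by blast
  have fc: "continuous_on {0..} f" and \<sigma>c: "continuous_on {0..} \<sigma>" using C_weightedD(1) f \<sigma> by blast+
  define Y where "Y t \<omega> = x t \<omega> - x 0 \<omega> - integral {0..t} (\<lambda>\<tau>. A *v x \<tau> \<omega> - f \<tau>)" for t \<omega>
  have xm: "x t \<in> borel_measurable M" if "0 \<le> t" for t using x that by (simp add: cont_process_def)
  have Y: "cont_process M Y"
    unfolding Y_def by (intro cont_process_diff cont_process_integral cont_process_matrix x cont_process_det fc cont_process_rv xm) simp
  have Ym: "Y t \<in> borel_measurable M" if "0 \<le> t" for t using Y that by (simp add: cont_process_def)
  let ?e = "\<lambda>t. exp (- \<rho> * t)"
  let ?I = "\<lambda>k::nat. {real k..real k + 1}"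
  obtain \<gamma> C where \<gamma>: "0 \<le> \<gamma>" "\<gamma> < 1" and C: "0 \<le> C" and path:
    "\<And>x Y f (k::nat) t. continuous_on {0..} x \<Longrightarrow> continuous_on {0..} Y \<Longrightarrow> continuous_on {0..} f \<Longrightarrow>
      \<forall>t\<ge>0. Y t = x t - x 0 - integral {0..t} (\<lambda>\<tau>. A *v x \<tau> - f \<tau>) \<Longrightarrow> t \<in> {real k..real k + 1} \<Longrightarrow>
      exp (- \<rho> * t) * (norm (x t))\<^sup>2 \<le> C * (exp (- \<rho> * real k) * \<beta> (x (real k)) (x (real k))
        + integral {real k..real k + 1} (\<lambda>r. exp (- \<rho> * r) * ((norm (f r))\<^sup>2 + (norm (Y r - Y (real k)))\<^sup>2))
        + exp (- \<rho> * t) * (norm (Y t - Y (real k)))\<^sup>2) \<and>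
      exp (- \<rho> * (real k + 1)) * \<beta> (x (real k + 1)) (x (real k + 1)) \<le>
        \<gamma> * (exp (- \<rho> * real k) * \<beta> (x (real k)) (x (real k)))
        + C * (integral {real k..real k + 1} (\<lambda>r. exp (- \<rho> * r) * ((norm (f r))\<^sup>2 + (norm (Y r - Y (real k)))\<^sup>2))
        + exp (- \<rho> * (real k + 1)) * (norm (Y (real k + 1) - Y (real k)))\<^sup>2)"
    using lyapunov_path[OF lf] by blast
  define v where "v k \<omega> = ennreal (?e (real k) * \<beta> (x (real k) \<omega>) (x (real k) \<omega>))" for k :: nat and \<omega>
  define h where "h k \<omega> = (\<integral>\<^sup>+r. ennreal (?e r * ((norm (f (max 0 r)))\<^sup>2 + (norm (Y (max 0 r) \<omega> - Y (real k) \<omega>))\<^sup>2)) * indicator (?I k) r \<partial>lborel)" for k :: nat and \<omega>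
  define d where "d k t \<omega> = ennreal (?e t * (norm (Y t \<omega> - Y (real k) \<omega>))\<^sup>2)" for k :: nat and t \<omega>
  have \<beta>m: "(\<lambda>u. \<beta> u u) \<in> borel_measurable borel"
    by (intro borel_measurable_continuous_onI bilinear_continuous_on_compose[where h = \<beta>] continuous_on_id bil)
  have vm[measurable]: "v k \<in> borel_measurable M" for k
    unfolding v_def using measurable_compose[OF xm \<beta>m, of "real k"] by measurable
  have dm[measurable]: "d k t \<in> borel_measurable M" if "0 \<le> t" for k t
    unfolding d_def using Ym[OF that] Ym[of "real k"] by measurable
  have fm[measurable]: "(\<lambda>r. f (max 0 r)) \<in> borel_measurable borel" "(\<lambda>r. \<sigma> (max 0 r)) \<in> borel_measurable borel"
    using continuous_on_max0[OF fc] continuous_on_max0[OF \<sigma>c] by (auto intro: borel_measurable_continuous_onI)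
  have e: "measurable (lborel \<Otimes>\<^sub>M M) N = measurable ((borel :: real measure) \<Otimes>\<^sub>M M) N" for N :: "'c measure"
    by (intro measurable_cong_sets sets_pair_measure_cong) auto
  have joint: "(\<lambda>z. Z (max 0 (fst z)) (snd z)) \<in> borel_measurable (lborel \<Otimes>\<^sub>M M)"
    if "cont_process M Z" for Z :: "real \<Rightarrow> 'w \<Rightarrow> real^'n"
    unfolding e using cont_process_joint[OF that] by (simp add: case_prod_beta)
  define hh where "hh k z = ennreal (?e (fst z) * ((norm (f (max 0 (fst z))))\<^sup>2
      + (norm (Y (max 0 (fst z)) (snd z) - Y (real k) (snd z)))\<^sup>2)) * indicator (?I k) (fst z)" for k :: nat and z :: "real \<times> 'w"
  have hhm[measurable]: "hh k \<in> borel_measurable (lborel \<Otimes>\<^sub>M M)" for k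
  proof -
    note [measurable] = joint[OF Y] measurable_compose[OF measurable_snd[of lborel M] Ym[of "real k"], simplified]
    have [measurable]: "(\<lambda>z. f (max 0 (fst z))) \<in> borel_measurable (lborel \<Otimes>\<^sub>M M)"
      by (rule measurable_compose[OF measurable_fst]) (use fm in simp)
    show ?thesis unfolding hh_def by measurable
  qed
  have h_hh: "h k \<omega> = (\<integral>\<^sup>+r. hh k (r, \<omega>) \<partial>lborel)" for k \<omega> by (simp add: h_def hh_def)
  have hm[measurable]: "h k \<in> borel_measurable M" for k
    unfolding h_hh by (rule lborel.borel_measurable_nn_integral) (use measurable_compose[OF measurable_pair_swap' hhm[of k]] in \<open>simp add: case_prod_beta\<close>)
  define Fk where "Fk k = (\<integral>\<^sup>+r. ennreal (?e r * (norm (f (max 0 r)))\<^sup>2) * indicator (?I k) r \<partial>lborel)" for k :: nat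
  define Sk where "Sk k = (\<integral>\<^sup>+r. ennreal (?e r * (norm (\<sigma> (max 0 r)))\<^sup>2) * indicator (?I k) r \<partial>lborel)" for k :: nat
  have D: "(\<integral>\<^sup>+\<omega>. d k t \<omega> \<partial>M) \<le> 8 * Sk k" if t: "t \<in> ?I k" for k t
  proof -
    have t0: "0 \<le> t" "real k \<le> t" using t by auto
    have sm: "(\<lambda>r. ennreal ((norm (\<sigma> (max 0 r)))\<^sup>2) * indicator {real k<..t} r) \<in> borel_measurable lborel"
      using fm by measurable
    have inc: "(\<integral>\<^sup>+\<omega>. ennreal ((norm (Y t \<omega> - Y (real k) \<omega>))\<^sup>2) \<partial>M)
      \<le> 8 * (\<integral>\<^sup>+r. ennreal ((norm (\<sigma> r))\<^sup>2) * indicator {real k<..t} r \<partial>lborel)"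
      unfolding Y_def by (intro stochastic_integral_increment[OF \<sigma>c] si t0) auto
    also have "(\<integral>\<^sup>+r. ennreal ((norm (\<sigma> r))\<^sup>2) * indicator {real k<..t} r \<partial>lborel)
      = (\<integral>\<^sup>+r. ennreal ((norm (\<sigma> (max 0 r)))\<^sup>2) * indicator {real k<..t} r \<partial>lborel)"
      by (intro nn_integral_cong) (auto simp: indicator_def max_def)
    finally have inc': "(\<integral>\<^sup>+\<omega>. ennreal ((norm (Y t \<omega> - Y (real k) \<omega>))\<^sup>2) \<partial>M)
      \<le> 8 * (\<integral>\<^sup>+r. ennreal ((norm (\<sigma> (max 0 r)))\<^sup>2) * indicator {real k<..t} r \<partial>lborel)" .
    have "(\<integral>\<^sup>+\<omega>. d k t \<omega> \<partial>M) = ennreal (?e t) * (\<integral>\<^sup>+\<omega>. ennreal ((norm (Y t \<omega> - Y (real k) \<omega>))\<^sup>2) \<partial>M)"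
      unfolding d_def using Ym[OF t0(1)] Ym[of "real k"] by (simp add: ennreal_mult nn_integral_cmult)
    also have "\<dots> \<le> ennreal (?e t) * (8 * (\<integral>\<^sup>+r. ennreal ((norm (\<sigma> (max 0 r)))\<^sup>2) * indicator {real k<..t} r \<partial>lborel))"
      by (intro mult_left_mono inc') simp
    also have "\<dots> = 8 * (\<integral>\<^sup>+r. ennreal (?e t) * (ennreal ((norm (\<sigma> (max 0 r)))\<^sup>2) * indicator {real k<..t} r) \<partial>lborel)"
      using nn_integral_cmult[OF sm, of "ennreal (?e t)"] by (simp only: mult.left_commute)
    also have "\<dots> \<le> 8 * Sk k"
      unfolding Sk_def
    proof (intro mult_left_mono nn_integral_mono)
      fix r
      show "ennreal (?e t) * (ennreal ((norm (\<sigma> (max 0 r)))\<^sup>2) * indicator {real k<..t} r)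
        \<le> ennreal (?e r * (norm (\<sigma> (max 0 r)))\<^sup>2) * indicator (?I k) r"
      proof (cases "r \<in> {real k<..t}")
        case True
        \<comment> \<open>The discount at the later time \<open>t\<close> is at most that at
          \<open>r\<close>, so it can be moved under the integral.\<close>
        have "?e t \<le> ?e r" using True \<rho> by (auto intro!: mult_left_mono)
        then have "ennreal (?e t * (norm (\<sigma> (max 0 r)))\<^sup>2) \<le> ennreal (?e r * (norm (\<sigma> (max 0 r)))\<^sup>2)"
          by (intro ennreal_leI mult_right_mono) auto
        moreover have "r \<in> ?I k" using True t by auto
        ultimately show ?thesis using True by (simp add: ennreal_mult)
      qed simp
    qed simp
    finally show ?thesis .
  qed
  have unit: "(\<integral>\<^sup>+r. c * indicator (?I k) r \<partial>lborel) = c" for c and k :: nat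
    by (subst nn_integral_cmult_indicator) auto
  have H: "(\<integral>\<^sup>+\<omega>. h k \<omega> \<partial>M) \<le> Fk k + 8 * Sk k" for k
  proof -
    \<comment> \<open>With the integrations exchanged, the second moment of the noise increment can
      be bounded at each fixed time.\<close>
    have "(\<integral>\<^sup>+\<omega>. h k \<omega> \<partial>M) = (\<integral>\<^sup>+r. (\<integral>\<^sup>+\<omega>. hh k (r, \<omega>) \<partial>M) \<partial>lborel)"
      unfolding h_hh by (rule Fubini'[of "\<lambda>r \<omega>. hh k (r, \<omega>)"]) simp
    also have "\<dots> \<le> (\<integral>\<^sup>+r. ennreal (?e r * (norm (f (max 0 r)))\<^sup>2) * indicator (?I k) r + 8 * Sk k * indicator (?I k) r \<partial>lborel)"
    proof (rule nn_integral_mono)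
      fix r
      show "(\<integral>\<^sup>+\<omega>. hh k (r, \<omega>) \<partial>M) \<le> ennreal (?e r * (norm (f (max 0 r)))\<^sup>2) * indicator (?I k) r + 8 * Sk k * indicator (?I k) r"
      proof (cases "r \<in> ?I k")
        case True
        then have r0: "0 \<le> r" by auto
        have "(\<integral>\<^sup>+\<omega>. hh k (r, \<omega>) \<partial>M) = (\<integral>\<^sup>+\<omega>. ennreal (?e r * (norm (f (max 0 r)))\<^sup>2) + d k r \<omega> \<partial>M)"
          using True r0 by (intro nn_integral_cong) (simp add: hh_def d_def distrib_left ennreal_plus[symmetric] del: ennreal_plus)
        also have "\<dots> = ennreal (?e r * (norm (f (max 0 r)))\<^sup>2) + (\<integral>\<^sup>+\<omega>. d k r \<omega> \<partial>M)"
          by (subst nn_integral_add) (auto intro: dm[OF r0] simp: emeasure_space_1)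
        also have "\<dots> \<le> ennreal (?e r * (norm (f (max 0 r)))\<^sup>2) + 8 * Sk k"
          by (intro add_left_mono D True)
        finally show ?thesis using True by simp
      qed (simp add: hh_def)
    qed
    also have "\<dots> = (\<integral>\<^sup>+r. ennreal (?e r * (norm (f (max 0 r)))\<^sup>2) * indicator (?I k) r \<partial>lborel)
        + (\<integral>\<^sup>+r. 8 * Sk k * indicator (?I k) r \<partial>lborel)"
      by (rule nn_integral_add) measurable
    also have "\<dots> = Fk k + 8 * Sk k" by (simp only: Fk_def unit)
    finally show ?thesis .
  qed
  have h_eq: "h k \<omega> = ennreal (integral (?I k) (\<lambda>r. ?e r * ((norm (f r))\<^sup>2 + (norm (Y r \<omega> - Y (real k) \<omega>))\<^sup>2)))" if "\<omega> \<in> space M" for k \<omega>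
    unfolding h_def
  proof (rule nn_integral_Icc_continuous)
    show "continuous_on (?I k) (\<lambda>r. ?e r * ((norm (f r))\<^sup>2 + (norm (Y r \<omega> - Y (real k) \<omega>))\<^sup>2))"
      using Y that by (intro continuous_intros continuous_on_subset[OF fc]) (auto simp: cont_process_def intro: continuous_on_subset)
  qed auto
  \<comment> \<open>A function that is not integrable has integral 0, so this holds for every
    \<omega>, also outside \<open>space M\<close>.\<close>
  have I0: "0 \<le> integral (?I k) (\<lambda>r. ?e r * ((norm (f r))\<^sup>2 + (norm (Y r \<omega> - Y (real k) \<omega>))\<^sup>2))" for k \<omega>
    by (cases "(\<lambda>r. ?e r * ((norm (f r))\<^sup>2 + (norm (Y r \<omega> - Y (real k) \<omega>))\<^sup>2)) integrable_on ?I k")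
      (auto intro: integral_nonneg simp: not_integrable_integral)
  have P: "ennreal (?e t * (norm (x t \<omega>))\<^sup>2) \<le> ennreal C * (v k \<omega> + h k \<omega> + d k t \<omega>)"
    "v (Suc k) \<omega> \<le> ennreal \<gamma> * v k \<omega> + ennreal C * (h k \<omega> + d k (real k + 1) \<omega>)"
    if \<omega>: "\<omega> \<in> space M" and t: "t \<in> ?I k" for \<omega> k t
  proof -
    let ?i = "integral (?I k) (\<lambda>r. ?e r * ((norm (f r))\<^sup>2 + (norm (Y r \<omega> - Y (real k) \<omega>))\<^sup>2))"
    let ?v = "?e (real k) * \<beta> (x (real k) \<omega>) (x (real k) \<omega>)"
    have p: "?e t * (norm (x t \<omega>))\<^sup>2 \<le> C * (?v + ?i + ?e t * (norm (Y t \<omega> - Y (real k) \<omega>))\<^sup>2)"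
      "?e (real k + 1) * \<beta> (x (real k + 1) \<omega>) (x (real k + 1) \<omega>)
        \<le> \<gamma> * ?v + C * (?i + ?e (real k + 1) * (norm (Y (real k + 1) \<omega> - Y (real k) \<omega>))\<^sup>2)"
      using path[of "\<lambda>t. x t \<omega>" "\<lambda>t. Y t \<omega>" f t k] x Y fc \<omega> t by (auto simp: cont_process_def Y_def)
    have v0: "0 \<le> ?v" using nn by simp
    show "ennreal (?e t * (norm (x t \<omega>))\<^sup>2) \<le> ennreal C * (v k \<omega> + h k \<omega> + d k t \<omega>)"
      unfolding v_def h_eq[OF \<omega>] d_def using ennreal_leI[OF p(1)] v0 I0[of k \<omega>] C
      by (simp add: ennreal_mult ennreal_plus)
    show "v (Suc k) \<omega> \<le> ennreal \<gamma> * v k \<omega> + ennreal C * (h k \<omega> + d k (real k + 1) \<omega>)"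
      unfolding v_def h_eq[OF \<omega>] d_def using ennreal_leI[OF p(2)] v0 I0[of k \<omega>] C \<gamma> nn
      by (simp add: ennreal_mult ennreal_plus add.commute)
  qed
  define V where "V k = (\<integral>\<^sup>+\<omega>. v k \<omega> \<partial>M)" for k
  \<comment> \<open>The accumulated noise in \<open>h\<close> and the noise increment in
    \<open>d\<close> contribute 8 each.\<close>
  define b where "b k = ennreal C * (Fk k + 16 * Sk k)" for k
  have rec: "V (Suc k) \<le> ennreal \<gamma> * V k + b k" for k
  proof -
    have [measurable]: "d k (real k + 1) \<in> borel_measurable M" by (rule dm) simp
    have "V (Suc k) \<le> (\<integral>\<^sup>+\<omega>. ennreal \<gamma> * v k \<omega> + ennreal C * (h k \<omega> + d k (real k + 1) \<omega>) \<partial>M)"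
      unfolding V_def by (intro nn_integral_mono P(2)[of _ "real k"]) auto
    also have "\<dots> = ennreal \<gamma> * V k + ennreal C * ((\<integral>\<^sup>+\<omega>. h k \<omega> \<partial>M) + (\<integral>\<^sup>+\<omega>. d k (real k + 1) \<omega> \<partial>M))"
      unfolding V_def by (simp add: nn_integral_add nn_integral_cmult)
    also have "\<dots> \<le> ennreal \<gamma> * V k + ennreal C * ((Fk k + 8 * Sk k) + 8 * Sk k)"
      by (intro add_left_mono mult_left_mono add_mono H D) auto
    also have "(Fk k + 8 * Sk k) + 8 * Sk k = Fk k + 16 * Sk k"
      by (simp add: add.assoc flip: distrib_right)
    finally show ?thesis by (simp add: b_def)
  qed
  have FS: "(\<Sum>k. Fk k) < \<infinity>" "(\<Sum>k. Sk k) < \<infinity>"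
    unfolding Fk_def Sk_def
    using C_weighted_nn_integral[OF f] C_weighted_nn_integral[OF \<sigma>] by (subst nn_integral_unit_intervals; simp)+
  have bs: "(\<Sum>k. b k) < \<infinity>"
  proof -
    have "(\<Sum>k. b k) = ennreal C * ((\<Sum>k. Fk k) + 16 * (\<Sum>k. Sk k))"
      unfolding b_def by (simp add: suminf_add[OF summableI summableI, symmetric])
    also have "\<dots> < \<infinity>" using FS by (simp add: ennreal_mult_less_top)
    finally show ?thesis .
  qed
  have V0: "V 0 < \<infinity>"
  proof -
    have "V 0 \<le> (\<integral>\<^sup>+\<omega>. ennreal Cb * ennreal ((norm (x 0 \<omega>))\<^sup>2) \<partial>M)"
      unfolding V_def v_def using Cb by (intro nn_integral_mono) (simp add: ennreal_mult[symmetric] ennreal_leI)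
    also have "\<dots> = ennreal Cb * (\<integral>\<^sup>+\<omega>. ennreal ((norm (x 0 \<omega>))\<^sup>2) \<partial>M)"
    proof (rule nn_integral_cmult)
      note [measurable] = xm[OF order_refl]
      show "(\<lambda>\<omega>. ennreal ((norm (x 0 \<omega>))\<^sup>2)) \<in> borel_measurable M" by measurable
    qed
    also have "\<dots> < \<infinity>" using x0 by (simp add: ennreal_mult_less_top)
    finally show ?thesis .
  qed
  have Vs: "(\<Sum>k. V k) < \<infinity>" by (rule suminf_affine_recursion_ennreal[OF V0 bs rec \<gamma>])
  define G where "G z = ennreal (?e (fst z) * (norm (x (max 0 (fst z)) (snd z)))\<^sup>2)" for z
  have Gm[measurable]: "G \<in> borel_measurable (lborel \<Otimes>\<^sub>M M)"
    unfolding G_def using joint[OF x] by measurable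
  define X where "X t = (\<integral>\<^sup>+\<omega>. G (t, \<omega>) \<partial>M)" for t
  have Xm[measurable]: "X \<in> borel_measurable borel"
  proof -
    have "X \<in> borel_measurable lborel" unfolding X_def by (rule sigma_finite_measure.borel_measurable_nn_integral_fst[OF prob_space_imp_sigma_finite[OF M] Gm])
    then show ?thesis by simp
  qed
  have Xb: "X t \<le> ennreal C * V k + b k" if t: "t \<in> ?I k" for t k
  proof -
    have t0: "0 \<le> t" using t by auto
    note [measurable] = dm[OF t0, of k]
    have "X t \<le> (\<integral>\<^sup>+\<omega>. ennreal C * (v k \<omega> + h k \<omega> + d k t \<omega>) \<partial>M)"
      unfolding X_def G_def using P(1)[OF _ t] t0 by (intro nn_integral_mono) simp
    also have "\<dots> = ennreal C * (V k + (\<integral>\<^sup>+\<omega>. h k \<omega> \<partial>M) + (\<integral>\<^sup>+\<omega>. d k t \<omega> \<partial>M))"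
      unfolding V_def by (simp add: nn_integral_add nn_integral_cmult)
    also have "\<dots> \<le> ennreal C * (V k + (Fk k + 8 * Sk k) + 8 * Sk k)"
      by (intro mult_left_mono add_mono H D t) auto
    also have "V k + (Fk k + 8 * Sk k) + 8 * Sk k = V k + (Fk k + 16 * Sk k)"
      by (simp add: add.assoc flip: distrib_right)
    finally show ?thesis by (simp add: b_def distrib_left)
  qed
  have "(\<integral>\<^sup>+\<omega>. (\<integral>\<^sup>+t. ennreal (exp (- \<rho> * t) * (norm (x (max 0 t) \<omega>))\<^sup>2) * indicator {0..} t \<partial>lborel) \<partial>M)
    = (\<integral>\<^sup>+\<omega>. (\<integral>\<^sup>+t. G (t, \<omega>) * indicator {0..} t \<partial>lborel) \<partial>M)"
    by (simp add: G_def)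
  also have "\<dots> = (\<integral>\<^sup>+t. (\<integral>\<^sup>+\<omega>. G (t, \<omega>) * indicator {0..} t \<partial>M) \<partial>lborel)"
    by (rule Fubini'[of "\<lambda>t \<omega>. G (t, \<omega>) * indicator {0..} t"]) (simp add: case_prod_beta)
  also have "\<dots> = (\<integral>\<^sup>+t. X t * indicator {0..} t \<partial>lborel)"
    unfolding X_def by (intro nn_integral_cong nn_integral_multc) measurable
  also have "\<dots> = (\<Sum>k. \<integral>\<^sup>+t. X t * indicator (?I k) t \<partial>lborel)"
    by (rule nn_integral_unit_intervals[symmetric]) measurable
  also have "\<dots> \<le> (\<Sum>k. ennreal C * V k + b k)"
  proof (intro suminf_le summableI)
    fix k :: nat
    have "(\<integral>\<^sup>+t. X t * indicator (?I k) t \<partial>lborel) \<le> (\<integral>\<^sup>+t. (ennreal C * V k + b k) * indicator (?I k) t \<partial>lborel)"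
      using Xb by (intro nn_integral_mono) (auto simp: indicator_def)
    then show "(\<integral>\<^sup>+t. X t * indicator (?I k) t \<partial>lborel) \<le> ennreal C * V k + b k" by (simp only: unit)
  qed
  also have "\<dots> = ennreal C * (\<Sum>k. V k) + (\<Sum>k. b k)"
    by (simp add: suminf_add[OF summableI summableI, symmetric])
  also have "\<dots> < \<infinity>" using Vs bs by (simp add: ennreal_mult_less_top)
  finally show ?thesis .
qed

section \<open>Representation\<close>

lemma cont_process_joint_halfline:
  assumes f: "cont_process M f"
  shows "(\<lambda>(t, \<omega>). f t \<omega>) \<in> borel_measurable (restrict_space borel {0..} \<Otimes>\<^sub>M M)"
proof -
  have "(\<lambda>t. t) \<in> measurable (restrict_space borel {0..}) (borel :: real measure)"
    by (rule measurable_restrict_space1) simp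
  then have "(\<lambda>z. (fst z, snd z)) \<in> measurable (restrict_space borel {0..} \<Otimes>\<^sub>M M) ((borel :: real measure) \<Otimes>\<^sub>M M)"
    by (intro measurable_Pair measurable_compose[OF measurable_fst] measurable_snd)
  from measurable_compose[OF this cont_process_joint[OF f]]
  have "(\<lambda>z. f (max 0 (fst z)) (snd z)) \<in> borel_measurable (restrict_space borel {0..} \<Otimes>\<^sub>M M)"
    by (simp add: case_prod_beta)
  moreover have "f (max 0 (fst z)) (snd z) = (case z of (t, \<omega>) \<Rightarrow> f t \<omega>)"
    if "z \<in> space (restrict_space borel {0..} \<Otimes>\<^sub>M M)" for z
    using that by (auto simp: space_pair_measure space_restrict_space case_prod_beta)
  ultimately show ?thesis by (simp cong: measurable_cong)
qed

lemma history_measurable: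
  assumes "0 \<le> t"
  shows "z t \<in> borel_measurable (history M z t)"
proof (rule measurableI)
  let ?G = "{z \<tau> -` S \<inter> space M | \<tau> S. \<tau> \<in> {0..t} \<and> S \<in> sets borel}"
  have G: "?G \<subseteq> Pow (space M)" by auto
  fix S :: "(real^'b) set" assume "S \<in> sets borel"
  then have "z t -` S \<inter> space M \<in> ?G" using assms by auto
  then show "z t -` S \<inter> space (history M z t) \<in> sets (history M z t)"
    unfolding history_def space_measure_of[OF G] sets_measure_of[OF G] by (rule sigma_sets.Basic)
qed simp

text \<open>The offset enters the state equation only through its product with \<open>C\<close> and
  at nonnegative times, so offsets that differ by kernel elements of the gain have the same
  trajectories.\<close>

lemma generates_affine_cong:
  assumes g: "continuous_on {0..} g" "continuous_on {0..} g'"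
    and eq: "\<And>t. 0 \<le> t \<Longrightarrow> C *v g t = C *v g' t"
  shows "generates M N A B \<sigma> W x0 (affine_law C P g) x \<longleftrightarrow> generates M N A B \<sigma> W x0 (affine_law C P g') x"
proof -
  have "integral {0..t} (\<lambda>\<tau>. F *v x i \<tau> \<omega> - (B ** C) *v g \<tau>) = integral {0..t} (\<lambda>\<tau>. F *v x i \<tau> \<omega> - (B ** C) *v g' \<tau>)"
    for F t i \<omega>
    by (rule integral_cong) (simp add: eq flip: matrix_vector_mul_assoc)
  then show ?thesis unfolding generates_affine[OF g(1)] generates_affine[OF g(2)] by simp
qed

text \<open>At a fixed time the law is a continuous function of the agent's current state, hence
  adapted without completion. Its energy is dominated by those of the state and of the offset, and
  the former is finite because the shifted closed loop is Hurwitz.\<close>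

lemma affine_law_admissible:
  fixes A P :: "real^'n^'n" and B :: "real^'r^'n"
  assumes M: "prob_space M" and W: "\<And>i. i \<in> {1..N} \<Longrightarrow> brownian_motion M (W i)" and \<rho>: "0 \<le> \<rho>"
    and x0: "\<And>i. i \<in> {1..N} \<Longrightarrow> x0 i \<in> borel_measurable M"
    and x0_sq: "\<And>i. i \<in> {1..N} \<Longrightarrow> integrable M (\<lambda>\<omega>. (norm (x0 i \<omega>))\<^sup>2)"
    and \<sigma>: "\<sigma> \<in> C_weighted (\<rho> / 2)" and g: "g \<in> C_weighted (\<rho> / 2)"
    and F: "hurwitz (A - B ** C ** P - (\<rho> / 2) *\<^sub>R mat 1)"
  shows "affine_law C P g \<in> admissible M N \<rho> A B \<sigma> W x0"
proof -
  interpret prob_space M by (rule M)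
  have gc: "continuous_on {0..} g" and \<sigma>c: "continuous_on {0..} \<sigma>" using C_weightedD(1) g \<sigma> by blast+
  have gen: "(\<lambda>(t, \<omega>). open_loop_value (affine_law C P g) x i t \<omega>) \<in> borel_measurable (restrict_space borel {0..} \<Otimes>\<^sub>M M) \<and>
      (\<forall>t\<ge>0. open_loop_value (affine_law C P g) x i t \<in> borel_measurable (history M (x i) t)) \<and>
      (\<integral>\<^sup>+\<omega>. (\<integral>\<^sup>+t\<in>{0..}. ennreal (exp (- \<rho> * t) * (norm (open_loop_value (affine_law C P g) x i t \<omega>))\<^sup>2) \<partial>lborel) \<partial>M) < \<infinity>"
    if x: "generates M N A B \<sigma> W x0 (affine_law C P g) x" and i: "i \<in> {1..N}" for x :: "('n, 'a) trajectory" and i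
  proof -
    have X: "cont_process M (x i)" "AE \<omega> in M. x i 0 \<omega> = x0 i \<omega>"
      and si: "\<And>t. 0 \<le> t \<Longrightarrow> is_stochastic_integral M (W i) \<sigma> t
        (\<lambda>\<omega>. x i t \<omega> - x i 0 \<omega> - integral {0..t} (\<lambda>\<tau>. (A - B ** C ** P) *v x i \<tau> \<omega> - (B ** C) *v g \<tau>))"
      using x i unfolding generates_affine[OF gc] by auto
    define U where "U t \<omega> = open_loop_value (affine_law C P g) x i t \<omega>" for t \<omega>
    have U: "U t \<omega> = 0 - C *v (P *v x i t \<omega> + g t)" for t \<omega>
      by (simp add: U_def open_loop_value_def affine_law_def)
    have Uc: "cont_process M U"
      unfolding U[abs_def]
      by (intro cont_process_diff cont_process_matrix cont_process_add X(1) cont_process_det gc continuous_on_const)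
    have 1: "(\<lambda>(t, \<omega>). U t \<omega>) \<in> borel_measurable (restrict_space borel {0..} \<Otimes>\<^sub>M M)"
      by (rule cont_process_joint_halfline[OF Uc])
    have 2: "U t \<in> borel_measurable (history M (x i) t)" if "0 \<le> t" for t
    proof -
      have "continuous_on UNIV (\<lambda>v. 0 - C *v (P *v v + g t))"
        by (intro continuous_on_diff continuous_on_add bounded_linear.continuous_on[OF matrix_vector_mul_bounded_linear] continuous_on_const continuous_on_id)
      from measurable_compose[OF history_measurable[OF that, of "x i" M] borel_measurable_continuous_onI[OF this]]
      show ?thesis by (simp only: U[abs_def])
    qed
    obtain K where K: "K > 0" "\<And>v. norm (C *v v) \<le> norm v * K"
      using bounded_linear.pos_bounded[OF matrix_vector_mul_bounded_linear[of C]] by blast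
    obtain L where L: "L > 0" "\<And>v. norm (P *v v) \<le> norm v * L"
      using bounded_linear.pos_bounded[OF matrix_vector_mul_bounded_linear[of P]] by blast
    define a where "a = 2 * L\<^sup>2 * K\<^sup>2"
    define b where "b = 2 * K\<^sup>2"
    have ab: "0 \<le> a" "0 \<le> b" by (simp_all add: a_def b_def)
    have Ub: "(norm (U t \<omega>))\<^sup>2 \<le> a * (norm (x i t \<omega>))\<^sup>2 + b * (norm (g t))\<^sup>2" for t \<omega>
    proof -
      have "norm (U t \<omega>) \<le> norm (P *v x i t \<omega> + g t) * K" using K(2) by (simp add: U)
      also have "\<dots> \<le> (norm (x i t \<omega>) * L + norm (g t)) * K"
        using K(1) by (intro mult_right_mono norm_triangle_le add_mono L) auto
      finally have "(norm (U t \<omega>))\<^sup>2 \<le> ((norm (x i t \<omega>) * L + norm (g t)) * K)\<^sup>2" by (intro power_mono) auto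
      also have "\<dots> = (norm (x i t \<omega>) * L + norm (g t))\<^sup>2 * K\<^sup>2" by (rule power_mult_distrib)
      also have "\<dots> \<le> (2 * (norm (x i t \<omega>) * L)\<^sup>2 + 2 * (norm (g t))\<^sup>2) * K\<^sup>2"
        using sum_squares_bound[of "norm (x i t \<omega>) * L" "norm (g t)"] by (intro mult_right_mono) (simp_all add: power2_sum)
      also have "\<dots> = a * (norm (x i t \<omega>))\<^sup>2 + b * (norm (g t))\<^sup>2"
        by (simp add: a_def b_def power_mult_distrib algebra_simps)
      finally show ?thesis .
    qed
    let ?X = "\<lambda>t \<omega>. ennreal (exp (- \<rho> * t) * (norm (x i (max 0 t) \<omega>))\<^sup>2) * indicator {0..} t"
    let ?g = "\<lambda>t. ennreal (exp (- \<rho> * t) * (norm (g (max 0 t)))\<^sup>2) * indicator {0..} t"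
    have x0f: "(\<integral>\<^sup>+\<omega>. ennreal ((norm (x i 0 \<omega>))\<^sup>2) \<partial>M) < \<infinity>"
    proof -
      have "(\<integral>\<^sup>+\<omega>. ennreal ((norm (x i 0 \<omega>))\<^sup>2) \<partial>M) = (\<integral>\<^sup>+\<omega>. ennreal ((norm (x0 i \<omega>))\<^sup>2) \<partial>M)"
        by (rule nn_integral_cong_AE) (use X(2) in eventually_elim, simp)
      also have "\<dots> < \<infinity>" using x0_sq[OF i] by (simp add: nn_integral_eq_integral)
      finally show ?thesis .
    qed
    have fw: "(\<lambda>t. (B ** C) *v g t) \<in> C_weighted (\<rho> / 2)"
      using C_weighted_comb[OF g g, of "B ** C" 0] by simp
    have EX: "(\<integral>\<^sup>+\<omega>. (\<integral>\<^sup>+t. ?X t \<omega> \<partial>lborel) \<partial>M) < \<infinity>"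
      by (rule energy_finite[OF M W[OF i] \<rho> F \<sigma> fw X(1) x0f si])
    have Eg: "(\<integral>\<^sup>+t. ?g t \<partial>lborel) < \<infinity>" by (rule C_weighted_nn_integral[OF g])
    have gm: "?g \<in> borel_measurable lborel"
    proof -
      have [measurable]: "(\<lambda>t. g (max 0 t)) \<in> borel_measurable borel"
        by (intro borel_measurable_continuous_onI continuous_on_max0 gc)
      show ?thesis by measurable
    qed
    have e: "measurable (M \<Otimes>\<^sub>M lborel) N = measurable (M \<Otimes>\<^sub>M (borel :: real measure)) N" for N :: "'c measure"
      by (intro measurable_cong_sets sets_pair_measure_cong) auto
    have Xj: "(\<lambda>(\<omega>, t). ?X t \<omega>) \<in> borel_measurable (M \<Otimes>\<^sub>M lborel)"
    proof -
      have [measurable]: "(\<lambda>z. x i (max 0 (snd z)) (fst z)) \<in> borel_measurable (M \<Otimes>\<^sub>M borel)"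
        using measurable_compose[OF measurable_pair_swap' cont_process_joint[OF X(1)]] by (simp add: case_prod_beta)
      show ?thesis unfolding e case_prod_beta by measurable
    qed
    have Xo: "(\<lambda>\<omega>. \<integral>\<^sup>+t. ?X t \<omega> \<partial>lborel) \<in> borel_measurable M"
      by (rule lborel.borel_measurable_nn_integral[OF Xj])
    have Xi: "(\<lambda>t. ?X t \<omega>) \<in> borel_measurable lborel" if "\<omega> \<in> space M" for \<omega>
    proof -
      have [measurable]: "(\<lambda>t. x i (max 0 t) \<omega>) \<in> borel_measurable borel"
        using X(1) that by (intro borel_measurable_continuous_onI continuous_on_max0) (auto simp: cont_process_def)
      show ?thesis by measurable
    qed
    have "(\<integral>\<^sup>+\<omega>. (\<integral>\<^sup>+t\<in>{0..}. ennreal (exp (- \<rho> * t) * (norm (U t \<omega>))\<^sup>2) \<partial>lborel) \<partial>M)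
      \<le> (\<integral>\<^sup>+\<omega>. ennreal a * (\<integral>\<^sup>+t. ?X t \<omega> \<partial>lborel) + ennreal b * (\<integral>\<^sup>+t. ?g t \<partial>lborel) \<partial>M)"
    proof (rule nn_integral_mono)
      fix \<omega> assume \<omega>: "\<omega> \<in> space M"
      have "(\<integral>\<^sup>+t\<in>{0..}. ennreal (exp (- \<rho> * t) * (norm (U t \<omega>))\<^sup>2) \<partial>lborel)
        \<le> (\<integral>\<^sup>+t. ennreal a * ?X t \<omega> + ennreal b * ?g t \<partial>lborel)"
      proof (rule nn_integral_mono)
        fix t
        show "ennreal (exp (- \<rho> * t) * (norm (U t \<omega>))\<^sup>2) * indicator {0..} t \<le> ennreal a * ?X t \<omega> + ennreal b * ?g t"
        proof (cases "0 \<le> t")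
          case True
          have "exp (- \<rho> * t) * (norm (U t \<omega>))\<^sup>2 \<le> exp (- \<rho> * t) * (a * (norm (x i t \<omega>))\<^sup>2 + b * (norm (g t))\<^sup>2)"
            by (intro mult_left_mono Ub) simp
          also have "\<dots> = a * (exp (- \<rho> * t) * (norm (x i t \<omega>))\<^sup>2) + b * (exp (- \<rho> * t) * (norm (g t))\<^sup>2)"
            by (simp add: algebra_simps)
          finally have "ennreal (exp (- \<rho> * t) * (norm (U t \<omega>))\<^sup>2)
            \<le> ennreal (a * (exp (- \<rho> * t) * (norm (x i t \<omega>))\<^sup>2) + b * (exp (- \<rho> * t) * (norm (g t))\<^sup>2))" by (rule ennreal_leI)
          also have "\<dots> = ennreal a * ennreal (exp (- \<rho> * t) * (norm (x i t \<omega>))\<^sup>2) + ennreal b * ennreal (exp (- \<rho> * t) * (norm (g t))\<^sup>2)"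
            using ab by (simp add: ennreal_plus ennreal_mult')
          finally show ?thesis using True by simp
        qed simp
      qed
      also have "\<dots> = (\<integral>\<^sup>+t. ennreal a * ?X t \<omega> \<partial>lborel) + (\<integral>\<^sup>+t. ennreal b * ?g t \<partial>lborel)"
        by (rule nn_integral_add) (use Xi[OF \<omega>] gm in \<open>auto intro: borel_measurable_times\<close>)
      also have "\<dots> = ennreal a * (\<integral>\<^sup>+t. ?X t \<omega> \<partial>lborel) + ennreal b * (\<integral>\<^sup>+t. ?g t \<partial>lborel)"
        by (simp only: nn_integral_cmult[OF Xi[OF \<omega>]] nn_integral_cmult[OF gm])
      finally show "(\<integral>\<^sup>+t\<in>{0..}. ennreal (exp (- \<rho> * t) * (norm (U t \<omega>))\<^sup>2) \<partial>lborel)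
        \<le> ennreal a * (\<integral>\<^sup>+t. ?X t \<omega> \<partial>lborel) + ennreal b * (\<integral>\<^sup>+t. ?g t \<partial>lborel)" .
    qed
    also have "\<dots> = (\<integral>\<^sup>+\<omega>. ennreal a * (\<integral>\<^sup>+t. ?X t \<omega> \<partial>lborel) \<partial>M) + (\<integral>\<^sup>+\<omega>. ennreal b * (\<integral>\<^sup>+t. ?g t \<partial>lborel) \<partial>M)"
      by (rule nn_integral_add) (use Xo in \<open>auto intro: borel_measurable_times\<close>)
    also have "\<dots> = ennreal a * (\<integral>\<^sup>+\<omega>. (\<integral>\<^sup>+t. ?X t \<omega> \<partial>lborel) \<partial>M) + ennreal b * (\<integral>\<^sup>+t. ?g t \<partial>lborel)"
      by (simp only: nn_integral_cmult[OF Xo] nn_integral_const emeasure_space_1 mult_1_right)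
    also have "\<dots> < \<infinity>" using EX Eg by (simp only: ennreal_add_less_top ennreal_mult_less_top infinity_ennreal_def) simp
    finally show ?thesis using 1 2 unfolding U_def by blast
  qed
  have "\<exists>x. generates M N A B \<sigma> W x0 (affine_law C P g) x"
    by (rule affine_law_trajectory_exists[OF M W \<sigma>c gc x0])
  then show ?thesis using gen unfolding admissible_def by blast
qed

text \<open>With equal state feedback the two laws differ only in their offsets. Existence,
  uniqueness and admissibility hold for every offset in the weighted space; equality of the offsets
  after multiplication by the gain then identifies both the trajectories and the control
  values.\<close>

theorem proposition4p1:
  fixes M :: "'w measure" and N :: nat and \<rho> C0 :: real
    and A \<Gamma> Q :: "real^'n^'n" and B :: "real^'r^'n" and R :: "real^'r^'r"
    and \<sigma> \<eta> :: "real \<Rightarrow> real^'n"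
    and W :: "nat \<Rightarrow> real \<Rightarrow> 'w \<Rightarrow> real" and x0 :: "nat \<Rightarrow> 'w \<Rightarrow> real^'n" and xbar0 :: "real^'n"
    and P Pm Ps Kbar Abar :: "real^'n^'n"
    and s xbar xdag \<phi> :: "real \<Rightarrow> real^'n"
  assumes prob: "prob_space M"
    and rho: "\<rho> > 0"
    and Q_sym: "transpose Q = Q"
    and R_pos: "pos_def R"
    and sigma: "\<sigma> \<in> C_weighted (\<rho> / 2)"
    and eta: "\<eta> \<in> C_weighted (\<rho> / 2)"
    and W_bm: "\<And>i. i \<in> {1..N} \<Longrightarrow> brownian_motion M (W i)"
    and W_indep: "independent_processes M W {1..N}"
    and x0_meas: "\<And>i. i \<in> {1..N} \<Longrightarrow> x0 i \<in> borel_measurable M"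
    and x0_indep: "prob_space.indep_vars M (\<lambda>_. borel) x0 {1..N}"
    and x0_sq: "\<And>i. i \<in> {1..N} \<Longrightarrow> integrable M (\<lambda>\<omega>. (norm (x0 i \<omega>))\<^sup>2)"
    and x0_bound: "\<And>i. i \<in> {1..N} \<Longrightarrow> (\<integral>\<omega>. (norm (x0 i \<omega>))\<^sup>2 \<partial>M) < C0"
    and x0_mean: "\<And>i. i \<in> {1..N} \<Longrightarrow> (\<integral>\<omega>. x0 i \<omega> \<partial>M) = xbar0"
    \<comment> \<open>data of the first set of laws\<close>
    and P_max: "maximal_riccati_solution \<rho> A B R Q P"
    and Pi_max: "maximal_riccati_solution \<rho> A B R (Q - Xi \<Gamma> Q) Pm"
    and s_space: "s \<in> C_weighted (\<rho> / 2)"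
    and s_ode: "\<And>t. t \<ge> 0 \<Longrightarrow>
      (s has_vector_derivative
        (\<rho> *\<^sub>R s t - transpose (A - B ** matrix_inv R ** transpose B ** Pm) *v s t + eta_bar \<Gamma> Q \<eta> t))
      (at t within {0..})"
    and xbar_space: "xbar \<in> C_weighted (\<rho> / 2)"
    and xbar_ode: "\<And>t. t \<ge> 0 \<Longrightarrow>
      (xbar has_vector_derivative
        (A *v xbar t - (B ** matrix_inv R ** transpose B) *v (Pm *v xbar t + s t)))
      (at t within {0..})"
    and xbar_init: "xbar 0 = xbar0"
    \<comment> \<open>data of the second set of laws\<close>
    and Ps_stab: "stabilizing_riccati_solution \<rho> A B R Q Ps"
    and Abar: "Abar = A - B ** matrix_inv R ** transpose B ** Ps"
    and Kbar: "\<rho> *\<^sub>R Kbar = Kbar ** Abar + transpose Abar ** Kbar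
      - Kbar ** B ** matrix_inv R ** transpose B ** transpose Kbar - Xi \<Gamma> Q"
    and xdag_space: "xdag \<in> C_weighted (\<rho> / 2)"
    and xdag_ode: "\<And>t. t \<ge> 0 \<Longrightarrow>
      (xdag has_vector_derivative
        (Abar *v xdag t - (B ** matrix_inv R ** transpose B) *v (Kbar *v xdag t + \<phi> t)))
      (at t within {0..})"
    and xdag_init: "xdag 0 = xbar0"
    and phi_space: "\<phi> \<in> C_weighted (\<rho> / 2)"
    and phi_ode: "\<And>t. t \<ge> 0 \<Longrightarrow>
      (\<phi> has_vector_derivative
        (- (transpose (A - B ** matrix_inv R ** transpose B ** (Ps + Kbar) - \<rho> *\<^sub>R mat 1) *v \<phi> t)
          + eta_bar \<Gamma> Q \<eta> t))
      (at t within {0..})"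
  shows "is_representation M N \<rho> A B \<sigma> W x0
    (\<lambda>i t x. - ((matrix_inv R ** transpose B) *v (P *v x i t + (Pm - P) *v xbar t + s t)))
    (\<lambda>i t x. - ((matrix_inv R ** transpose B) *v (Ps *v x i t + (Kbar *v xdag t + \<phi> t))))"
proof -
  define C where "C = matrix_inv R ** transpose B"
  define g1 where "g1 t = (Pm - Ps) *v xbar t + s t" for t
  define g2 where "g2 t = Kbar *v xdag t + \<phi> t" for t
  have P: "P = Ps" by (rule maximal_eq_stabilizing[OF R_pos P_max Ps_stab])
  have law1: "(\<lambda>i t x. - ((matrix_inv R ** transpose B) *v (P *v x i t + (Pm - P) *v xbar t + s t))) = affine_law C Ps g1"
    by (simp add: affine_law_def C_def g1_def P add.assoc)
  have law2: "(\<lambda>i t x. - ((matrix_inv R ** transpose B) *v (Ps *v x i t + (Kbar *v xdag t + \<phi> t)))) = affine_law C Ps g2"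
    by (simp add: affine_law_def C_def g2_def)
  have g: "g1 \<in> C_weighted (\<rho> / 2)" "g2 \<in> C_weighted (\<rho> / 2)"
    using C_weighted_comb[OF xbar_space s_space, of "Pm - Ps" "mat 1"]
      C_weighted_comb[OF xdag_space phi_space, of Kbar "mat 1"]
    by (simp_all add: g1_def[abs_def] g2_def[abs_def])
  note gc = C_weightedD(1)[OF g(1)] C_weightedD(1)[OF g(2)]
  note \<sigma>c = C_weightedD(1)[OF sigma]
  have F: "hurwitz (A - B ** C ** Ps - (\<rho> / 2) *\<^sub>R mat 1)"
    using Ps_stab by (simp add: stabilizing_riccati_solution_def C_def matrix_mul_assoc)
  have Pm: "riccati_solution \<rho> A B R (Q - Xi \<Gamma> Q) Pm" using Pi_max by (simp add: maximal_riccati_solution_def)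
  have eq: "C *v g1 t = C *v g2 t" if "0 \<le> t" for t
    unfolding C_def g1_def g2_def
    by (rule feedback_offsets_equal[OF R_pos Q_sym Pm s_space s_ode xbar_space xbar_ode Ps_stab Abar Kbar
        xdag_space xdag_ode phi_space phi_ode _ that]) (simp_all add: xbar_init xdag_init)
  have gen: "generates M N A B \<sigma> W x0 (affine_law C Ps g1) y \<longleftrightarrow> generates M N A B \<sigma> W x0 (affine_law C Ps g2) y" for y
    by (rule generates_affine_cong[OF gc eq])
  have adm: "affine_law C Ps g \<in> admissible M N \<rho> A B \<sigma> W x0" if "g \<in> C_weighted (\<rho> / 2)" for g
    by (rule affine_law_admissible[OF prob W_bm less_imp_le[OF rho] x0_meas x0_sq sigma that F])
  have uniq: "indistinguishable M N y x"
    if "generates M N A B \<sigma> W x0 (affine_law C Ps g) y" "generates M N A B \<sigma> W x0 (affine_law C Ps g) x"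
      "continuous_on {0..} g" for x y g
    by (rule affine_law_trajectory_unique[OF prob W_bm that(3,1,2)])
  have "\<exists>x. generates M N A B \<sigma> W x0 (affine_law C Ps g1) x"
    by (rule affine_law_trajectory_exists[OF prob W_bm \<sigma>c gc(1) x0_meas])
  then obtain x where x: "generates M N A B \<sigma> W x0 (affine_law C Ps g1) x" by blast
  have "indistinguishable M N (open_loop_value (affine_law C Ps g1) x) (open_loop_value (affine_law C Ps g2) x)"
    using eq by (auto simp: indistinguishable_def open_loop_value_def affine_law_def matrix_vector_right_distrib)
  then show ?thesis
    unfolding law1 law2 is_representation_def
    using adm[OF g(1)] adm[OF g(2)] x gen uniq[OF _ x gc(1)] uniq[OF _ gen[THEN iffD1, OF x] gc(2)] by blast
qed

end
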